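(* Let $X,Y\subseteq\mathbb{R}^2$ be compact sets with $\dim_H(X)>0$ and $\dim_H(Y)>0$. Let $\sigma_X<\dim_H(X)$ and $\sigma_Y<\dim_H(Y)$. Let $\mu,\nu$ be Borel probability measures whose supports are $X$ and $Y$, respectively, such that $\mu$ satisfies the $\dim_H(X)$-dimensional Frostman condition and $\nu$ satisfies the $\dim_H(Y)$-dimensional Frostman condition. Let $A$ be an oracle relative to which $X$ and $Y$ are effectively compact and relative to which $\mu$ and $\nu$ are computable. Assume $\mu(\ell)\nu(\ell)<1$ for every line $\ell\subset\mathbb{R}^2$. Then there are points $x\in X$ and $y\in Y$, $x\neq y$, such that, denoting by $\ell$ the line joining $x$ and $y$, $$\dim_H^A(x)>\sigma_X,\qquad \dim_H^A(y)>\sigma_Y,\qquad \dim_H^{A,x}(\ell)>0,$$ and such that for all sufficiently large $n$ and $m\le n$, $$K_m^A(\ell)\ \le\ K_m^A(\ell\mid x)+K_{m,n}^A(\ell\mid y)+O(\log m)+O(\log n)$$ and $$K_n^A(\ell)\ \le\ K_n^A(\ell\mid y)+K_n^{A,x}(\ell)+O(\log n),$$ where the implied constants do not depend on $m$ and $n$.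
   Context: $\dim_H$ of a set denotes Hausdorff dimension. A probability measure $\mu$ on $\mathbb{R}^d$ satisfies the $s$-dimensional Frostman condition if there is a constant $C>0$ with $\mu(B(x,r))\le Cr^s$ for all $x\in\mathbb{R}^d$ and all $r>0$. Kolmogorov complexity. $K^A(\cdot)$ and $K^A(\cdot\mid\cdot)$ denote Kolmogorov complexity and conditional Kolmogorov complexity relative to an oracle $A$ (of finite objects under a fixed standard encoding). For $x\in\mathbb{R}^d$ and $n\in\mathbb{N}$, $K^A_n(x)=K^A(Q)$ where $Q$ is the dyadic cube of side length $2^{-n}$ containing $x$. For points $x,y$, $K^A_{n,m}(x\mid y)$ is the conditional complexity, relative to $A$, of the dyadic cube of side length $2^{-n}$ containing $x$ given the dyadic cube of side length $2^{-m}$ containing $y$; $K^A_n(x\mid y)=K^A_{n,n}(x\mid y)$. A superscript $A,x$ means that both $A$ and (a binary encoding of the coordinates of) the point $x$ are used as oracles. Effective dimension: $\dim_H^A(x)=\liminf_{n\to\infty}K^A_n(x)/n$. Lines are identified with points of $\mathbb{R}^2$ by the standard point-line duality (the line $\{(u,v): v=au+b\}$ corresponds to $(a,b)$; for vertical lines use the same parametrization with the two coordinates interchanged), and $K_n$, conditional complexities and effective dimension of a line are those of its dual point. A set $K\subseteq\mathbb{R}^d$ is effectively compact relative to $A$ if $K$ is compact and the set of finite open covers of $K$ by dyadic cubes is computably enumerable relative to $A$. A Borel probability measure $\mu$ is computable relative to $A$ if for every dyadic cube $Q$, $\mu(Q)$ is computable relative to $A$ (uniformly in $Q$). *)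

theory Defs
  imports "HOL-Probability.Probability" "HOL-Library.Nat_Bijection" "HOL-Library.Sublist"
begin

datatype recf =
    Zero
  | Succ
  | Query
  | Proj nat
  | Comp recf "recf list"
  | Prec recf recf
  | Mu recf

text \<open>Partial recursive functions relative to an oracle: \<open>eval A f xs y\<close> means that \<open>f\<close>, with oracle \<open>A\<close>,
  halts on the arguments \<open>xs\<close> with value \<open>y\<close>.\<close>

inductive eval :: "nat set \<Rightarrow> recf \<Rightarrow> nat list \<Rightarrow> nat \<Rightarrow> bool" for A where
  Zero: "eval A Zero xs 0"
| Succ: "eval A Succ (x # xs) (Suc x)"
| Query: "eval A Query (x # xs) (of_bool (x \<in> A))"
| Proj: "i < length xs \<Longrightarrow> eval A (Proj i) xs (xs ! i)"
| Comp: "list_all2 (\<lambda>g y. eval A g xs y) gs ys \<Longrightarrow> eval A f ys z \<Longrightarrow> eval A (Comp f gs) xs z"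
| Prec_0: "eval A f xs y \<Longrightarrow> eval A (Prec f g) (0 # xs) y"
| Prec_Suc: "eval A (Prec f g) (n # xs) y \<Longrightarrow> eval A g (n # y # xs) z
    \<Longrightarrow> eval A (Prec f g) (Suc n # xs) z"
| Mu: "eval A f (n # xs) 0 \<Longrightarrow> (\<And>m. m < n \<Longrightarrow> \<exists>y. eval A f (m # xs) (Suc y))
    \<Longrightarrow> eval A (Mu f) xs n"

inductive_cases eval_ZeroE: "eval A Zero xs y"
inductive_cases eval_SuccE: "eval A Succ xs y"
inductive_cases eval_QueryE: "eval A Query xs y"
inductive_cases eval_ProjE: "eval A (Proj i) xs y"
inductive_cases eval_CompE: "eval A (Comp f gs) xs y"
inductive_cases eval_Prec_0E: "eval A (Prec f g) (0 # xs) y"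
inductive_cases eval_Prec_SucE: "eval A (Prec f g) (Suc n # xs) y"
inductive_cases eval_MuE: "eval A (Mu f) xs y"

lemma eval_deterministic: "eval A f xs y \<Longrightarrow> eval A f xs z \<Longrightarrow> y = z"
proof (induction arbitrary: z rule: eval.induct)
  case (Comp xs gs ys f w)
  from Comp.prems obtain ys' where ys': "list_all2 (\<lambda>g y. eval A g xs y) gs ys'" "eval A f ys' z"
    by (rule eval_CompE)
  have "ys = ys'"
    using Comp.IH(1) ys'(1) by (auto simp: list_all2_conv_all_nth list_eq_iff_nth_eq)
  with Comp.IH(2) ys'(2) show ?case by blast
next
  case (Prec_Suc f g n xs y w)
  from Prec_Suc.prems obtain y' where "eval A (Prec f g) (n # xs) y'" "eval A g (n # y' # xs) z"
    by (rule eval_Prec_SucE)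
  with Prec_Suc.IH show ?case by blast
next
  case (Mu f n xs)
  from Mu.prems have z: "eval A f (z # xs) 0" "\<And>m. m < z \<Longrightarrow> \<exists>y. eval A f (m # xs) (Suc y)"
    by (rule eval_MuE, blast)+
  show ?case
  proof (rule linorder_cases[of n z])
    assume "n < z"
    then obtain y where "eval A f (n # xs) (Suc y)" using z(2) by blast
    with Mu.IH(1) have "0 = Suc y" by blast
    then show ?thesis by simp
  next
    assume "z < n"
    with Mu.IH(2) obtain y where "\<forall>w. eval A f (z # xs) w \<longrightarrow> Suc y = w" by blast
    with z(1) have "Suc y = 0" by blast
    then show ?thesis by simp
  qed
qed (blast elim: eval_ZeroE eval_SuccE eval_QueryE eval_ProjE eval_Prec_0E)+

fun code :: "recf \<Rightarrow> nat" where
  "code Zero = prod_encode (0, 0)"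
| "code Succ = prod_encode (1, 0)"
| "code Query = prod_encode (2, 0)"
| "code (Proj i) = prod_encode (3, i)"
| "code (Comp f gs) = prod_encode (4, prod_encode (code f, list_encode (map code gs)))"
| "code (Prec f g) = prod_encode (5, prod_encode (code f, code g))"
| "code (Mu f) = prod_encode (6, code f)"

definition computably_enumerable :: "nat set \<Rightarrow> nat set \<Rightarrow> bool" where
  "computably_enumerable A S \<longleftrightarrow> (\<exists>f. \<forall>c. c \<in> S \<longleftrightarrow> (\<exists>y. eval A f [c] y))"

definition oracle_join :: "nat set \<Rightarrow> nat set \<Rightarrow> nat set" where
  "oracle_join A B = (\<lambda>k. 2 * k) ` A \<union> (\<lambda>k. 2 * k + 1) ` B"

text \<open>
  Finite objects are encoded as natural numbers; the trivial condition is the number 0.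
  We use prefix complexity. A machine \<open>f\<close> with condition \<open>y\<close> reads its program from a one-way
  bit tape: after having read the bits \<open>q\<close> it either asks for one more bit
  (value \<open>0\<close> at \<open>q\<close>) or stops with output \<open>x\<close> (value \<open>Suc x\<close> at \<open>q\<close>). So \<open>p\<close> is a program
  for \<open>x\<close> if the machine stops with output \<open>x\<close> having read exactly \<open>p\<close>; these programs
  form a prefix-free set.
\<close>

definition bits_code :: "bool list \<Rightarrow> nat" where
  "bits_code p = list_encode (map of_bool p)"

definition produces :: "nat set \<Rightarrow> recf \<Rightarrow> bool list \<Rightarrow> nat \<Rightarrow> nat \<Rightarrow> bool" where
  "produces A f p y x \<longleftrightarrow> eval A f [bits_code p, y] (Suc x) \<and>
     (\<forall>q. strict_prefix q p \<longrightarrow> eval A f [bits_code q, y] 0)"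

text \<open>The universal machine reads the code of a machine in unary and then runs this machine.\<close>

definition universal :: "nat set \<Rightarrow> bool list \<Rightarrow> nat \<Rightarrow> nat \<Rightarrow> bool" where
  "universal A p y x \<longleftrightarrow>
     (\<exists>f q. p = replicate (code f) True @ False # q \<and> produces A f q y x)"

definition KC :: "nat set \<Rightarrow> nat \<Rightarrow> nat \<Rightarrow> nat" where
  "KC A x y = (LEAST n. \<exists>p. length p = n \<and> universal A p y x)"

lemma produces_prefix_free:
  assumes "produces A f p y x" and "produces A f p' y x'" and "prefix p p'"
  shows "p = p' \<and> x = x'"
  using assms eval_deterministic unfolding produces_def
  by (metis Zero_not_Suc nat.inject prefix_order.le_less)

lemma ex_universal_program: "\<exists>p. universal A p y x"
proof -
  define c where "c = ((\<lambda>f. Comp recf.Succ [f]) ^^ Suc x) recf.Zero"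
  have "eval A (((\<lambda>f. Comp recf.Succ [f]) ^^ n) recf.Zero) xs n" for n xs
    by (induction n) (auto intro!: eval.intros)
  then have "eval A c [bits_code [], y] (Suc x)" unfolding c_def by blast
  then show ?thesis unfolding universal_def produces_def by fastforce
qed

text \<open>The triple \<open>(n, i, j)\<close> stands for the half-open square of side length \<open>2\<^sup>-\<^sup>n\<close>
  with lower left corner \<open>(i / 2\<^sup>n, j / 2\<^sup>n)\<close>.\<close>

fun dyadic_cube :: "nat \<times> int \<times> int \<Rightarrow> (real ^ 2) set" where
  "dyadic_cube (n, i, j) =
     {p. of_int i / 2 ^ n \<le> p $ 1 \<and> p $ 1 < (of_int i + 1) / 2 ^ n \<and>
         of_int j / 2 ^ n \<le> p $ 2 \<and> p $ 2 < (of_int j + 1) / 2 ^ n}"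

fun cube_code :: "nat \<times> int \<times> int \<Rightarrow> nat" where
  "cube_code (n, i, j) = prod_encode (n, prod_encode (int_encode i, int_encode j))"

definition cube_at :: "nat \<Rightarrow> real ^ 2 \<Rightarrow> nat \<times> int \<times> int" where
  "cube_at n x = (n, \<lfloor>2 ^ n * x $ 1\<rfloor>, \<lfloor>2 ^ n * x $ 2\<rfloor>)"

lemma mem_dyadic_cube_iff: "x \<in> dyadic_cube (n, i, j) \<longleftrightarrow> (n, i, j) = cube_at n x"
proof -
  have *: "of_int k / 2 ^ n \<le> t \<and> t < (of_int k + 1) / 2 ^ n \<longleftrightarrow> k = \<lfloor>2 ^ n * t\<rfloor>"
    for k :: int and t :: real
    using floor_eq_iff[of "2 ^ n * t" k] by (auto simp: field_simps)
  show ?thesis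
    using *[of i "x $ 1"] *[of j "x $ 2"] by (auto simp: cube_at_def)
qed

definition K :: "nat set \<Rightarrow> nat \<Rightarrow> real ^ 2 \<Rightarrow> nat" where
  "K A n x = KC A (cube_code (cube_at n x)) 0"

definition Kcond2 :: "nat set \<Rightarrow> nat \<Rightarrow> nat \<Rightarrow> real ^ 2 \<Rightarrow> real ^ 2 \<Rightarrow> nat" where
  "Kcond2 A n m x y = KC A (cube_code (cube_at n x)) (cube_code (cube_at m y))"

definition Kcond :: "nat set \<Rightarrow> nat \<Rightarrow> real ^ 2 \<Rightarrow> real ^ 2 \<Rightarrow> nat" where
  "Kcond A n x y = Kcond2 A n n x y"

definition eff_dim :: "nat set \<Rightarrow> real ^ 2 \<Rightarrow> ereal" where
  "eff_dim A x = liminf (\<lambda>n. ereal (real (K A n x) / real n))"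

text \<open>A real number is encoded by its integer part (the only even element of the set) and
  the binary digits of its fractional part (\<open>2 * k + 1\<close> is an element iff the digit with
  weight \<open>2\<^sup>-\<^sup>(\<^sup>k\<^sup>+\<^sup>1\<^sup>)\<close> is 1).\<close>

definition real_oracle :: "real \<Rightarrow> nat set" where
  "real_oracle r = oracle_join {int_encode \<lfloor>r\<rfloor>} {k. odd \<lfloor>2 ^ (k + 1) * r\<rfloor>}"

definition point_oracle :: "real ^ 2 \<Rightarrow> nat set" where
  "point_oracle x = oracle_join (real_oracle (x $ 1)) (real_oracle (x $ 2))"

abbreviation with_point :: "nat set \<Rightarrow> real ^ 2 \<Rightarrow> nat set" where
  "with_point A x \<equiv> oracle_join A (point_oracle x)"

definition is_line :: "(real ^ 2) set \<Rightarrow> bool" where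
  "is_line l \<longleftrightarrow> affine l \<and> aff_dim l = 1"

text \<open>The vertical line \<open>u = c\<close> is \<open>{(u, v). u = 0 * v + c}\<close>, so its dual point is \<open>(0, c)\<close>.\<close>

definition dual_point :: "(real ^ 2) set \<Rightarrow> real ^ 2" where
  "dual_point l =
     (if \<exists>q :: real ^ 2. l = {p. p $ 2 = q $ 1 * p $ 1 + q $ 2}
      then (THE q :: real ^ 2. l = {p. p $ 2 = q $ 1 * p $ 1 + q $ 2})
      else (THE q :: real ^ 2. l = {p. p $ 1 = q $ 1 * p $ 2 + q $ 2}))"

text \<open>Open covers have to consist of open sets, and the interiors of the cubes
  \<open>dyadic_cube\<close> never cover a point with a dyadic coordinate. Open covers by dyadic cubes
  are therefore taken to consist of open squares whose side length is a power \<open>2\<^sup>-\<^sup>n\<close> and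
  whose corner is an arbitrary dyadic point \<open>(i / 2\<^sup>m, j / 2\<^sup>m)\<close>.\<close>

fun open_cube :: "nat \<times> nat \<times> int \<times> int \<Rightarrow> (real ^ 2) set" where
  "open_cube (n, m, i, j) =
     {p. of_int i / 2 ^ m < p $ 1 \<and> p $ 1 < of_int i / 2 ^ m + 1 / 2 ^ n \<and>
         of_int j / 2 ^ m < p $ 2 \<and> p $ 2 < of_int j / 2 ^ m + 1 / 2 ^ n}"

fun open_cube_code :: "nat \<times> nat \<times> int \<times> int \<Rightarrow> nat" where
  "open_cube_code (n, m, i, j) =
     prod_encode (n, prod_encode (m, prod_encode (int_encode i, int_encode j)))"

definition effectively_compact :: "nat set \<Rightarrow> (real ^ 2) set \<Rightarrow> bool" where
  "effectively_compact A X \<longleftrightarrow> compact X \<and>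
     computably_enumerable A
       {list_encode (map open_cube_code Qs) | Qs. X \<subseteq> (\<Union>Q \<in> set Qs. open_cube Q)}"

text \<open>On input \<open>(Q, k)\<close> the algorithm returns the numerator of a dyadic rational with
  denominator \<open>2\<^sup>k\<close> within \<open>2\<^sup>-\<^sup>k\<close> of the measure of \<open>Q\<close>.\<close>

definition computable_measure :: "nat set \<Rightarrow> (real ^ 2) measure \<Rightarrow> bool" where
  "computable_measure A \<mu> \<longleftrightarrow>
     (\<exists>f. \<forall>Q k. \<exists>a. eval A f [cube_code Q, k] a \<and>
        \<bar>measure \<mu> (dyadic_cube Q) - real a / 2 ^ k\<bar> \<le> 1 / 2 ^ k)"

definition hausdorff_premeasure :: "real \<Rightarrow> real \<Rightarrow> 'a :: metric_space set \<Rightarrow> ennreal" where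
  "hausdorff_premeasure s \<delta> X =
     (INF U \<in> {U :: nat \<Rightarrow> 'a set. X \<subseteq> (\<Union>i. U i) \<and> (\<forall>i. bounded (U i) \<and> diameter (U i) \<le> \<delta>)}.
        \<Sum>i. ennreal (diameter (U i) powr s))"

definition hausdorff_measure :: "real \<Rightarrow> 'a :: metric_space set \<Rightarrow> ennreal" where
  "hausdorff_measure s X = (SUP \<delta> \<in> {0<..}. hausdorff_premeasure s \<delta> X)"

text \<open>In a Euclidean space the set below contains every \<open>s > DIM('a)\<close>. The exponent
  \<open>s = 0\<close> is excluded since \<open>0 powr 0 = 0\<close>; this does not change the infimum.\<close>

definition hausdorff_dim :: "'a :: euclidean_space set \<Rightarrow> real" where
  "hausdorff_dim X = Inf {s. s > 0 \<and> hausdorff_measure s X = 0}"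

definition measure_support :: "'a :: topological_space measure \<Rightarrow> 'a set" where
  "measure_support \<mu> = {x. \<forall>U. open U \<and> x \<in> U \<longrightarrow> emeasure \<mu> U > 0}"

definition borel_prob_measure :: "'a :: topological_space measure \<Rightarrow> bool" where
  "borel_prob_measure \<mu> \<longleftrightarrow> prob_space \<mu> \<and> sets \<mu> = sets borel"

definition frostman :: "real \<Rightarrow> 'a :: metric_space measure \<Rightarrow> bool" where
  "frostman s \<mu> \<longleftrightarrow> (\<exists>C>0. \<forall>x r. r > 0 \<longrightarrow> measure \<mu> (ball x r) \<le> C * r powr s)"

end

theory Submission
  imports Defs "HOL-Real_Asymp.Real_Asymp"
begin

text \<open>The points are chosen at random with respect to \<open>\<mu> \<times> \<nu>\<close>. Let \<open>T\<close> be the tube of width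
  \<open>O(2\<^sup>-\<^sup>m)\<close> around the line \<open>\<ell>\<close> joining them. Only \<open>O(2\<^sup>k)\<close> dual squares of side length \<open>2\<^sup>-\<^sup>m\<close> have
  \<open>\<mu>(T) \<nu>(T) \<ge> 2\<^sup>-\<^sup>k\<close>, because two separated points determine \<open>\<ell>\<close> up to \<open>O(1)\<close> squares. As the measures are
  computable, such a square can be described by its position in a list, so
  \<open>K\<^sub>m(\<ell>) \<le> - log (\<mu>(T) \<nu>(T)) + O(log m)\<close>. Conversely, Kraft's inequality and the Borel--Cantelli lemma
  show that almost surely \<open>K\<^sub>m(\<ell> | x) \<ge> - log \<nu>(T) - O(log n)\<close> and the same for the complexity of
  \<open>\<ell>\<close> relative to the oracle \<open>x\<close>, while the complexity of \<open>\<ell>\<close> given \<open>y\<close> at any precision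
  \<open>n \<ge> m\<close> is at least \<open>- log \<mu>(T) - O(log n)\<close>. Adding these bounds gives both inequalities, without
  symmetry of information. The line has positive dimension relative to \<open>x\<close> because \<open>\<nu>(T)\<close> decays
  like a power of the width: if a line carries mass of \<open>\<nu>\<close> but not all of \<open>\<mu>\<close>, then one restricts
  \<open>\<nu>\<close> to this line and takes \<open>x\<close> outside; otherwise, after restricting \<open>\<nu>\<close>, all lines are null sets, and
  a multiscale argument applies.\<close>

section \<open>Functions computable relative to an oracle\<close>

text \<open>The bounds fit together because the pair is drawn from a product measure: knowing one
  point, to whatever precision or as an oracle, does not change the law of the other. So the
  conditional probability that the line falls into a given dual square is at most the tube mass of
  the other measure, and the precision of the condition does not matter. The two masses cancel
  against the product in the upper bound. For the oracle \<open>x\<close> the exceptional null set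
  depends on \<open>x\<close>, and there are uncountably many oracles. Hence \<open>x\<close> is
  chosen first, and then almost every \<open>y\<close> is good for this fixed oracle. All this
  happens on sets \<open>I\<close> and \<open>J\<close> of positive mass whose first coordinates are
  a definite distance apart: the lines are then not vertical, their slopes and intercepts are
  bounded, and the count of dual squares applies. Nothing makes \<open>I\<close> and
  \<open>J\<close> computable, so the list behind the upper bound ranges over all pairs of grid
  squares with separated first coordinates, a decidable relation.\<close>

definition computable_fn :: "nat set \<Rightarrow> nat \<Rightarrow> (nat list \<Rightarrow> nat) \<Rightarrow> bool" where
  "computable_fn A k F \<longleftrightarrow> (\<exists>f. \<forall>xs. length xs = k \<longrightarrow> eval A f xs (F xs))"

lemma computable_fn_cong:
  assumes "computable_fn A k F" "\<And>xs. length xs = k \<Longrightarrow> F xs = G xs"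
  shows "computable_fn A k G"
  using assms unfolding computable_fn_def by simp

lemma computable_fn_nth [intro]: "i < k \<Longrightarrow> computable_fn A k (\<lambda>xs. xs ! i)"
  unfolding computable_fn_def by (metis eval.Proj)

lemma computable_fn_comp:
  assumes "computable_fn A n F" "length Gs = n" "\<And>G. G \<in> set Gs \<Longrightarrow> computable_fn A k G"
  shows "computable_fn A k (\<lambda>xs. F (map (\<lambda>G. G xs) Gs))"
proof -
  obtain f where f: "\<And>xs. length xs = n \<Longrightarrow> eval A f xs (F xs)"
    using assms(1) unfolding computable_fn_def by blast
  obtain g where g: "\<And>G xs. G \<in> set Gs \<Longrightarrow> length xs = k \<Longrightarrow> eval A (g G) xs (G xs)"
    using assms(3) unfolding computable_fn_def by metis
  have "eval A (Comp f (map g Gs)) xs (F (map (\<lambda>G. G xs) Gs))" if "length xs = k" for xs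
    using that assms(2)
    by (intro eval.Comp[where ys = "map (\<lambda>G. G xs) Gs"] f)
      (auto simp: list_all2_conv_all_nth intro!: g)
  then show ?thesis unfolding computable_fn_def by blast
qed

lemma computable_fn_comp1:
  assumes "computable_fn A 1 (\<lambda>xs. g (xs ! 0))" "computable_fn A k F"
  shows "computable_fn A k (\<lambda>xs. g (F xs))"
  using computable_fn_comp[OF assms(1), of "[F]"] assms(2) by simp

lemma computable_fn_comp2:
  assumes "computable_fn A 2 (\<lambda>xs. g (xs ! 0) (xs ! 1))" "computable_fn A k F" "computable_fn A k G"
  shows "computable_fn A k (\<lambda>xs. g (F xs) (G xs))"
proof -
  have "computable_fn A k (\<lambda>xs. g (map (\<lambda>G. G xs) [F, G] ! 0) (map (\<lambda>G. G xs) [F, G] ! 1))"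
    by (rule computable_fn_comp[OF assms(1)]) (use assms(2,3) in auto)
  then show ?thesis by simp
qed

lemma computable_fn_comp3:
  assumes "computable_fn A 3 (\<lambda>xs. g (xs ! 0) (xs ! 1) (xs ! 2))"
    "computable_fn A k F" "computable_fn A k G" "computable_fn A k H"
  shows "computable_fn A k (\<lambda>xs. g (F xs) (G xs) (H xs))"
proof -
  have "computable_fn A k (\<lambda>xs. g (map (\<lambda>G. G xs) [F, G, H] ! 0) (map (\<lambda>G. G xs) [F, G, H] ! 1)
      (map (\<lambda>G. G xs) [F, G, H] ! 2))"
    by (rule computable_fn_comp[OF assms(1)]) (use assms(2-4) in auto)
  then show ?thesis by simp
qed

lemma computable_fn_Suc [intro]:
  assumes "computable_fn A k F"
  shows "computable_fn A k (\<lambda>xs. Suc (F xs))"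
proof -
  have "eval A recf.Succ xs (Suc (xs ! 0))" if "length xs = 1" for xs
    using that by (cases xs) (auto intro: eval.Succ)
  then have "computable_fn A 1 (\<lambda>xs. Suc (xs ! 0))" unfolding computable_fn_def by blast
  from computable_fn_comp1[OF this assms] show ?thesis .
qed

lemma computable_fn_const [intro]: "computable_fn A k (\<lambda>xs. c)"
proof (induction c)
  case 0
  show ?case unfolding computable_fn_def by (metis eval.Zero)
qed auto

text \<open>\<open>Prec\<close> takes the number of iterations as its first argument and hands
  counter, previous value and parameters to the step. Composition with \<open>N\<close> followed by
  the \<open>k\<close> projections produces this argument list.\<close>

lemma computable_fn_rec_nat:
  assumes "computable_fn A k Z" "computable_fn A (Suc (Suc k)) S" "computable_fn A k N"
  shows "computable_fn A k (\<lambda>xs. rec_nat (Z xs) (\<lambda>i y. S (i # y # xs)) (N xs))"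
proof -
  obtain z where z: "\<And>xs. length xs = k \<Longrightarrow> eval A z xs (Z xs)"
    using assms(1) unfolding computable_fn_def by blast
  obtain s where s: "\<And>xs. length xs = Suc (Suc k) \<Longrightarrow> eval A s xs (S xs)"
    using assms(2) unfolding computable_fn_def by blast
  have rec: "eval A (Prec z s) (n # xs) (rec_nat (Z xs) (\<lambda>i y. S (i # y # xs)) n)"
    if "length xs = k" for n xs
    by (induction n) (use that in \<open>auto intro!: eval.Prec_0 eval.Prec_Suc z s\<close>)
  have "computable_fn A (Suc k) (\<lambda>ys. rec_nat (Z (tl ys)) (\<lambda>i y. S (i # y # tl ys)) (hd ys))"
    unfolding computable_fn_def
    by (rule exI[of _ "Prec z s"]) (auto simp: length_Suc_conv intro: rec)
  then have "computable_fn A k (\<lambda>xs. (\<lambda>ys. rec_nat (Z (tl ys)) (\<lambda>i y. S (i # y # tl ys)) (hd ys))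
      (map (\<lambda>G. G xs) (N # map (\<lambda>i xs. xs ! i) [0..<k])))"
    by (rule computable_fn_comp) (use assms(3) in auto)
  then show ?thesis
  proof (rule computable_fn_cong)
    fix xs :: "nat list" assume "length xs = k"
    then have "map (\<lambda>i. xs ! i) [0..<k] = xs" using map_nth[of xs] by simp
    then show "rec_nat (Z (tl (map (\<lambda>G. G xs) (N # map (\<lambda>i xs. xs ! i) [0..<k]))))
        (\<lambda>i y. S (i # y # tl (map (\<lambda>G. G xs) (N # map (\<lambda>i xs. xs ! i) [0..<k]))))
        (hd (map (\<lambda>G. G xs) (N # map (\<lambda>i xs. xs ! i) [0..<k]))) =
      rec_nat (Z xs) (\<lambda>i y. S (i # y # xs)) (N xs)"
      by (simp add: comp_def)
  qed
qed

text \<open>\<open>Mu\<close> needs a positive value at every argument below the zero; since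
  \<open>F\<close> is total, only the existence of a zero has to be assumed.\<close>

lemma computable_fn_Least:
  assumes "computable_fn A (Suc k) F" "\<And>xs. length xs = k \<Longrightarrow> \<exists>n. F (n # xs) = 0"
  shows "computable_fn A k (\<lambda>xs. LEAST n. F (n # xs) = 0)"
proof -
  obtain f where f: "\<And>xs. length xs = Suc k \<Longrightarrow> eval A f xs (F xs)"
    using assms(1) unfolding computable_fn_def by blast
  have "eval A (Mu f) xs (LEAST n. F (n # xs) = 0)" if len: "length xs = k" for xs
  proof (rule eval.Mu)
    show "eval A f ((LEAST n. F (n # xs) = 0) # xs) 0"
      using f[of "(LEAST n. F (n # xs) = 0) # xs"] LeastI_ex[OF assms(2)[OF len]] len by simp
    fix m assume "m < (LEAST n. F (n # xs) = 0)"
    then have "F (m # xs) \<noteq> 0" by (rule not_less_Least)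
    then obtain y where "F (m # xs) = Suc y" by (cases "F (m # xs)") auto
    then show "\<exists>y. eval A f (m # xs) (Suc y)"
      using f[of "m # xs"] len by auto
  qed
  then show ?thesis unfolding computable_fn_def by blast
qed

text \<open>Adapts a summand to the argument list of a recursion step, whose second entry is the
  accumulated sum.\<close>

lemma computable_fn_drop_second:
  assumes "computable_fn A (Suc k) F"
  shows "computable_fn A (Suc (Suc k)) (\<lambda>ys. F (ys ! 0 # drop 2 ys))"
proof -
  have "computable_fn A (Suc (Suc k))
    (\<lambda>xs. F (map (\<lambda>G. G xs) ((\<lambda>xs. xs ! 0) # map (\<lambda>i xs. xs ! (i + 2)) [0..<k])))"
    by (rule computable_fn_comp[OF assms]) auto
  then show ?thesis
  proof (rule computable_fn_cong)
    fix xs :: "nat list" assume "length xs = Suc (Suc k)"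
    then have "map (\<lambda>i. xs ! (i + 2)) [0..<k] = drop 2 xs"
      by (intro nth_equalityI) (auto simp: add.commute)
    then show "F (map (\<lambda>G. G xs) ((\<lambda>xs. xs ! 0) # map (\<lambda>i xs. xs ! (i + 2)) [0..<k])) =
        F (xs ! 0 # drop 2 xs)"
      by (simp add: comp_def)
  qed
qed

lemma computable_fn_add [intro]:
  assumes "computable_fn A k F" "computable_fn A k G"
  shows "computable_fn A k (\<lambda>xs. F xs + G xs)"
proof -
  have "computable_fn A k (\<lambda>xs. rec_nat (F xs) (\<lambda>i y. Suc ((i # y # xs) ! 1)) (G xs))"
    by (rule computable_fn_rec_nat[where S = "\<lambda>ys. Suc (ys ! 1)"]) (use assms in auto)
  moreover have "rec_nat a (\<lambda>i y. Suc ((i # y # xs) ! 1)) b = a + b" for a b :: nat and xs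
    by (induction b) auto
  ultimately show ?thesis by simp
qed

lemma computable_fn_sum:
  assumes "computable_fn A (Suc k) F" "computable_fn A k N"
  shows "computable_fn A k (\<lambda>xs. \<Sum>i<N xs. F (i # xs))"
proof -
  have "computable_fn A k (\<lambda>xs. rec_nat 0 (\<lambda>i y. (i # y # xs) ! 1 + F ((i # y # xs) ! 0 # drop 2 (i # y # xs))) (N xs))"
    by (rule computable_fn_rec_nat[where S = "\<lambda>ys. ys ! 1 + F (ys ! 0 # drop 2 ys)"])
      (use assms computable_fn_drop_second in auto)
  moreover have "rec_nat 0 (\<lambda>i y. (i # y # xs) ! 1 + F ((i # y # xs) ! 0 # drop 2 (i # y # xs))) n = (\<Sum>i<n. F (i # xs))" for n xs
    by (induction n) auto
  ultimately show ?thesis by simp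
qed

lemma computable_fn_mult [intro]:
  assumes "computable_fn A k F" "computable_fn A k G"
  shows "computable_fn A k (\<lambda>xs. F xs * G xs)"
proof -
  have "computable_fn A 2 (\<lambda>xs. \<Sum>i<xs ! 1. (i # xs) ! 1)"
    by (rule computable_fn_sum[where F = "\<lambda>ys. ys ! 1"]) auto
  then have "computable_fn A 2 (\<lambda>xs. xs ! 0 * xs ! 1)" by (simp add: mult.commute)
  from computable_fn_comp2[OF this assms] show ?thesis .
qed

lemma computable_fn_diff [intro]:
  assumes "computable_fn A k F" "computable_fn A k G"
  shows "computable_fn A k (\<lambda>xs. F xs - G xs)"
proof -
  have "computable_fn A 1 (\<lambda>xs. rec_nat 0 (\<lambda>i y. (i # y # xs) ! 0) (xs ! 0))"
    by (rule computable_fn_rec_nat[where S = "\<lambda>ys. ys ! 0"]) auto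
  moreover have "rec_nat 0 (\<lambda>i y. (i # y # xs) ! 0) n = n - 1" for n xs
    by (cases n) auto
  ultimately have pred: "computable_fn A 1 (\<lambda>xs. xs ! 0 - 1)" by simp
  have "computable_fn A k (\<lambda>xs. rec_nat (F xs) (\<lambda>i y. (i # y # xs) ! 1 - 1) (G xs))"
    by (rule computable_fn_rec_nat[where S = "\<lambda>ys. ys ! 1 - 1"])
      (intro assms computable_fn_comp1[OF pred] computable_fn_nth; simp)+
  moreover have "rec_nat a (\<lambda>i y. (i # y # xs) ! 1 - 1) b = a - b" for a b :: nat and xs
    by (induction b) auto
  ultimately show ?thesis by simp
qed

lemma computable_fn_le [intro]:
  assumes "computable_fn A k F" "computable_fn A k G"
  shows "computable_fn A k (\<lambda>xs. of_bool (F xs \<le> G xs))"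
proof -
  have "of_bool (F xs \<le> G xs) = 1 - (F xs - G xs)" for xs by auto
  then show ?thesis using assms by (simp add: computable_fn_diff computable_fn_const del: One_nat_def)
qed

lemma computable_fn_conj [intro]:
  assumes "computable_fn A k (\<lambda>xs. of_bool (P xs))" "computable_fn A k (\<lambda>xs. of_bool (Q xs))"
  shows "computable_fn A k (\<lambda>xs. of_bool (P xs \<and> Q xs))"
  using computable_fn_mult[OF assms] by (simp add: of_bool_conj)

lemma computable_fn_not [intro]:
  assumes "computable_fn A k (\<lambda>xs. of_bool (P xs))"
  shows "computable_fn A k (\<lambda>xs. of_bool (\<not> P xs))"
proof -
  have "of_bool (\<not> P xs) = 1 - (of_bool (P xs) :: nat)" for xs by auto
  then show ?thesis using assms by (simp add: computable_fn_diff computable_fn_const del: One_nat_def)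
qed

lemma computable_fn_disj [intro]:
  assumes "computable_fn A k (\<lambda>xs. of_bool (P xs))" "computable_fn A k (\<lambda>xs. of_bool (Q xs))"
  shows "computable_fn A k (\<lambda>xs. of_bool (P xs \<or> Q xs))"
  using computable_fn_not[OF computable_fn_conj[OF computable_fn_not[OF assms(1)] computable_fn_not[OF assms(2)]]]
  by simp

lemma computable_fn_eq [intro]:
  assumes "computable_fn A k F" "computable_fn A k G"
  shows "computable_fn A k (\<lambda>xs. of_bool (F xs = G xs))"
  using computable_fn_conj[OF computable_fn_le[OF assms] computable_fn_le[OF assms(2,1)]]
  by (simp add: eq_iff[symmetric])

lemma computable_fn_if [intro]:
  assumes "computable_fn A k (\<lambda>xs. of_bool (P xs))" "computable_fn A k F" "computable_fn A k G"
  shows "computable_fn A k (\<lambda>xs. if P xs then F xs else G xs)"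
proof -
  have "(if P xs then F xs else G xs) = of_bool (P xs) * F xs + of_bool (\<not> P xs) * G xs" for xs
    by auto
  then show ?thesis using assms by (simp add: computable_fn_add computable_fn_mult computable_fn_not)
qed

lemma computable_fn_power2 [intro]:
  assumes "computable_fn A k F"
  shows "computable_fn A k (\<lambda>xs. 2 ^ F xs)"
proof -
  have "computable_fn A k (\<lambda>xs. rec_nat 1 (\<lambda>i y. 2 * (i # y # xs) ! 1) (F xs))"
    by (rule computable_fn_rec_nat[where S = "\<lambda>ys. 2 * ys ! 1"]) (use assms in auto)
  moreover have "rec_nat 1 (\<lambda>i y. 2 * (i # y # xs) ! 1) n = 2 ^ n" for n and xs :: "nat list"
    by (induction n) auto
  ultimately show ?thesis by simp
qed

text \<open>Exhaustive search written as a sum: among the candidates up to \<open>n\<close> only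
  \<open>n div 2\<close> passes the equality test.\<close>

lemma computable_fn_half [intro]:
  assumes "computable_fn A k F"
  shows "computable_fn A k (\<lambda>xs. F xs div 2)"
proof -
  have "computable_fn A 1 (\<lambda>xs. \<Sum>h<Suc (xs ! 0). (h # xs) ! 0 * of_bool (2 * (h # xs) ! 0 = (h # xs) ! 1 \<or> Suc (2 * (h # xs) ! 0) = (h # xs) ! 1))"
    by (rule computable_fn_sum[where F = "\<lambda>ys. ys ! 0 * of_bool (2 * ys ! 0 = ys ! 1 \<or> Suc (2 * ys ! 0) = ys ! 1)"])
      (intro computable_fn_mult computable_fn_disj computable_fn_eq computable_fn_Suc computable_fn_const computable_fn_nth; simp)+
  moreover have "(\<Sum>h<Suc n. h * of_bool (2 * h = n \<or> Suc (2 * h) = n)) = n div 2" for n :: nat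
  proof -
    have "(\<Sum>h<Suc n. h * of_bool (2 * h = n \<or> Suc (2 * h) = n)) = (\<Sum>h<Suc n. if h = n div 2 then h else 0)"
      by (intro sum.cong) auto
    then show ?thesis by simp
  qed
  ultimately have "computable_fn A 1 (\<lambda>xs. xs ! 0 div 2)" by simp
  from computable_fn_comp1[OF this assms] show ?thesis .
qed

lemma computable_fn_prod_encode [intro]:
  assumes "computable_fn A k F" "computable_fn A k G"
  shows "computable_fn A k (\<lambda>xs. prod_encode (F xs, G xs))"
proof -
  have "computable_fn A k (\<lambda>xs. (F xs + G xs) * Suc (F xs + G xs) div 2 + F xs)"
    by (intro computable_fn_add computable_fn_half computable_fn_mult computable_fn_Suc assms)
  then show ?thesis by (simp only: prod_encode_def triangle_def prod.case)
qed

text \<open>Inverts the pairing function by exhaustive search. A pair never exceeds its code in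
  either component, so exactly one term of the double sum survives.\<close>

lemma sum_prod_encode_eq:
  "(\<Sum>a<Suc n. \<Sum>b<Suc n. h a b * of_bool (prod_encode (a, b) = n)) = (case prod_decode n of (a, b) \<Rightarrow> h a b)"
  for h :: "nat \<Rightarrow> nat \<Rightarrow> nat"
proof -
  obtain a0 b0 where n: "prod_decode n = (a0, b0)" by fastforce
  then have n': "n = prod_encode (a0, b0)" by (metis prod_decode_inverse)
  have "a0 < Suc n" "b0 < Suc n" 
    using le_prod_encode_1[of a0 b0] le_prod_encode_2[of b0 a0] unfolding n' by simp_all
  have "(\<Sum>b<Suc n. h a b * of_bool (prod_encode (a, b) = n)) = (if a = a0 then h a b0 else 0)" for a
  proof -
    have "(\<Sum>b<Suc n. h a b * of_bool (prod_encode (a, b) = n)) = (\<Sum>b<Suc n. if b = b0 then (if a = a0 then h a b else 0) else 0)"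
      unfolding n' by (intro sum.cong) auto
    then show ?thesis using \<open>b0 < Suc n\<close> by (subst (asm) sum.delta) simp_all
  qed
  then have "(\<Sum>a<Suc n. \<Sum>b<Suc n. h a b * of_bool (prod_encode (a, b) = n)) = (\<Sum>a<Suc n. if a = a0 then h a b0 else 0)"
    by (intro sum.cong) auto
  also have "\<dots> = h a0 b0" using \<open>a0 < Suc n\<close> by (subst sum.delta) simp_all
  finally show ?thesis by (simp add: n)
qed

lemma computable_fn_prod_decode:
  assumes h: "computable_fn A 2 (\<lambda>xs. h (xs ! 0) (xs ! 1))" and F: "computable_fn A k F"
  shows "computable_fn A k (\<lambda>xs. case prod_decode (F xs) of (a, b) \<Rightarrow> h a b)"
proof -
  have 1: "computable_fn A 2 (\<lambda>xs. \<Sum>b<Suc (xs ! 1). h ((b # xs) ! 1) ((b # xs) ! 0) * of_bool (prod_encode ((b # xs) ! 1, (b # xs) ! 0) = (b # xs) ! 2))"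
    by (rule computable_fn_sum[where F = "\<lambda>ys. h (ys ! 1) (ys ! 0) * of_bool (prod_encode (ys ! 1, ys ! 0) = ys ! 2)"])
      (intro computable_fn_mult computable_fn_prod_encode computable_fn_eq computable_fn_Suc computable_fn_const computable_fn_nth computable_fn_comp2[OF h]; simp)+
  have 2: "computable_fn A 1 (\<lambda>xs. \<Sum>a<Suc (xs ! 0). (\<lambda>xs. \<Sum>b<Suc (xs ! 1). h ((b # xs) ! 1) ((b # xs) ! 0) * of_bool (prod_encode ((b # xs) ! 1, (b # xs) ! 0) = (b # xs) ! 2)) (a # xs))"
    by (rule computable_fn_sum) (use 1 in \<open>auto simp: numeral_2_eq_2\<close>)
  have "computable_fn A 1 (\<lambda>xs. \<Sum>a<Suc (xs ! 0). \<Sum>b<Suc (xs ! 0). h a b * of_bool (prod_encode (a, b) = xs ! 0))"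
    using 2 by (simp del: sum.lessThan_Suc)
  then have "computable_fn A 1 (\<lambda>xs. case prod_decode (xs ! 0) of (a, b) \<Rightarrow> h a b)"
    unfolding sum_prod_encode_eq .
  from computable_fn_comp1[OF this F] show ?thesis .
qed

lemma computable_fn_fst [intro]:
  assumes "computable_fn A k F"
  shows "computable_fn A k (\<lambda>xs. fst (prod_decode (F xs)))"
proof -
  have "computable_fn A 2 (\<lambda>xs. xs ! 0)" by (rule computable_fn_nth) simp
  from computable_fn_prod_decode[of A "\<lambda>a b. a", OF this assms] show ?thesis
    by (simp add: case_prod_unfold)
qed

lemma computable_fn_snd [intro]:
  assumes "computable_fn A k F"
  shows "computable_fn A k (\<lambda>xs. snd (prod_decode (F xs)))"
proof -
  have "computable_fn A 2 (\<lambda>xs. xs ! 1)" by (rule computable_fn_nth) simp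
  from computable_fn_prod_decode[of A "\<lambda>a b. b", OF this assms] show ?thesis
    by (simp add: case_prod_unfold)
qed

section \<open>A machine with self-delimiting parameters\<close>

text \<open>\<open>list_encode\<close> sends the empty list to 0 and a nonempty one to the successor
  of a pair, so \<open>b - 1\<close> exposes head and tail. Since
  \<open>prod_decode 0 = (0, 0)\<close>, the code 0 is its own tail and reading past the end gives
  0.\<close>

definition code_hd :: "nat \<Rightarrow> nat" where
  "code_hd b = fst (prod_decode (b - 1))"

definition code_drop :: "nat \<Rightarrow> nat \<Rightarrow> nat" where
  "code_drop b i = rec_nat b (\<lambda>_ y. snd (prod_decode (y - 1))) i"

definition code_nth :: "nat \<Rightarrow> nat \<Rightarrow> nat" where
  "code_nth b i = code_hd (code_drop b i)"

definition code_length :: "nat \<Rightarrow> nat" where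
  "code_length b = (LEAST i. code_drop b i = 0)"

text \<open>The search ends even if only ones have been read so far, because positions past the end
  count as 0.\<close>

definition code_ones :: "nat \<Rightarrow> nat" where
  "code_ones b = (LEAST i. code_nth b i = 0)"

definition code_num :: "nat \<Rightarrow> nat \<Rightarrow> nat \<Rightarrow> nat" where
  "code_num b s l = (\<Sum>i<l. code_nth b (s + i) * 2 ^ i)"

lemma prod_decode_0 [simp]: "prod_decode 0 = (0, 0)"
  by (simp add: prod_decode_def prod_decode_aux.simps)

lemma code_drop_list_encode: "code_drop (list_encode xs) i = list_encode (drop i xs)"
proof (induction i)
  case (Suc i)
  have "snd (prod_decode (list_encode ys - 1)) = list_encode (tl ys)" for ys
    by (cases ys) simp_all
  then show ?case using Suc by (simp add: code_drop_def drop_Suc tl_drop)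
qed (simp add: code_drop_def)

lemma code_nth_list_encode:
  "code_nth (list_encode xs) i = (if i < length xs then xs ! i else 0)"
proof (cases "i < length xs")
  case True
  then show ?thesis
    by (simp add: code_nth_def code_drop_list_encode code_hd_def Cons_nth_drop_Suc[symmetric])
qed (simp add: code_nth_def code_drop_list_encode code_hd_def)

lemma list_encode_eq_0_iff [simp]: "list_encode xs = 0 \<longleftrightarrow> xs = []"
  by (cases xs) simp_all

lemma code_drop_eventually_0: "\<exists>i. code_drop b i = 0"
proof -
  have "code_drop (list_encode (list_decode b)) (length (list_decode b)) = 0"
    unfolding code_drop_list_encode by simp
  then show ?thesis by auto
qed

lemma code_nth_eventually_0: "\<exists>i. code_nth b i = 0"
proof -
  have "code_nth (list_encode (list_decode b)) (length (list_decode b)) = 0"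
    unfolding code_nth_list_encode by simp
  then show ?thesis by auto
qed

lemma code_length_list_encode: "code_length (list_encode xs) = length xs"
  unfolding code_length_def code_drop_list_encode by (rule Least_equality) auto

lemma computable_fn_code_hd [intro]:
  "computable_fn A k F \<Longrightarrow> computable_fn A k (\<lambda>xs. code_hd (F xs))"
  unfolding code_hd_def by (intro computable_fn_fst computable_fn_diff computable_fn_const)

lemma computable_fn_code_drop [intro]:
  assumes "computable_fn A k F" "computable_fn A k G"
  shows "computable_fn A k (\<lambda>xs. code_drop (F xs) (G xs))"
proof -
  have "computable_fn A k (\<lambda>xs. rec_nat (F xs) (\<lambda>i y. snd (prod_decode ((i # y # xs) ! 1 - 1))) (G xs))"
    by (rule computable_fn_rec_nat[where S = "\<lambda>ys. snd (prod_decode (ys ! 1 - 1))"])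
      (intro assms computable_fn_snd computable_fn_diff computable_fn_const computable_fn_nth; simp)+
  then show ?thesis by (simp add: code_drop_def)
qed

lemma computable_fn_code_nth [intro]:
  "computable_fn A k F \<Longrightarrow> computable_fn A k G \<Longrightarrow> computable_fn A k (\<lambda>xs. code_nth (F xs) (G xs))"
  unfolding code_nth_def by (intro computable_fn_code_hd computable_fn_code_drop)

lemma computable_fn_code_length [intro]:
  assumes "computable_fn A k F"
  shows "computable_fn A k (\<lambda>xs. code_length (F xs))"
proof -
  have "computable_fn A 1 (\<lambda>xs. LEAST i. code_drop ((i # xs) ! 1) ((i # xs) ! 0) = 0)"
    by (rule computable_fn_Least[where F = "\<lambda>ys. code_drop (ys ! 1) (ys ! 0)"])
      (intro computable_fn_code_drop computable_fn_nth | simp add: code_drop_eventually_0)+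
  then have "computable_fn A 1 (\<lambda>xs. code_length (xs ! 0))" by (simp add: code_length_def)
  from computable_fn_comp1[OF this assms] show ?thesis .
qed

lemma computable_fn_code_ones [intro]:
  assumes "computable_fn A k F"
  shows "computable_fn A k (\<lambda>xs. code_ones (F xs))"
proof -
  have "computable_fn A 1 (\<lambda>xs. LEAST i. code_nth ((i # xs) ! 1) ((i # xs) ! 0) = 0)"
    by (rule computable_fn_Least[where F = "\<lambda>ys. code_nth (ys ! 1) (ys ! 0)"])
      (intro computable_fn_code_nth computable_fn_nth | simp add: code_nth_eventually_0)+
  then have "computable_fn A 1 (\<lambda>xs. code_ones (xs ! 0))" by (simp add: code_ones_def)
  from computable_fn_comp1[OF this assms] show ?thesis .
qed

lemma computable_fn_code_num [intro]:
  assumes "computable_fn A k F" "computable_fn A k G" "computable_fn A k H"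
  shows "computable_fn A k (\<lambda>xs. code_num (F xs) (G xs) (H xs))"
proof -
  have "computable_fn A 3 (\<lambda>xs. \<Sum>i<xs ! 2. code_nth ((i # xs) ! 1) ((i # xs) ! 2 + (i # xs) ! 0) * 2 ^ ((i # xs) ! 0))"
    by (rule computable_fn_sum[where F = "\<lambda>ys. code_nth (ys ! 1) (ys ! 2 + ys ! 0) * 2 ^ (ys ! 0)"])
      (intro computable_fn_mult computable_fn_code_nth computable_fn_add computable_fn_power2 computable_fn_nth; simp)+
  then have "computable_fn A 3 (\<lambda>xs. code_num (xs ! 0) (xs ! 1) (xs ! 2))"
    by (simp add: code_num_def numeral_2_eq_2)
  from computable_fn_comp3[OF this assms] show ?thesis .
qed

text \<open>A program is \<open>1\<^sup>L 0 v w\<close>, where \<open>v\<close> consists of \<open>L\<close> binary digits of \<open>prod_encode (m, k)\<close>,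
  least significant digit first, and \<open>w\<close> of \<open>k\<close> binary digits of \<open>t\<close>; its output is \<open>G m k t\<close>.\<close>

definition machine :: "(nat \<Rightarrow> nat \<Rightarrow> nat \<Rightarrow> nat) \<Rightarrow> nat \<Rightarrow> nat" where
  "machine G b =
     (let L = code_ones b; r = code_num b (Suc L) L; k = snd (prod_decode r) in
      if code_length b = 2 * L + 1 + k
      then Suc (G (fst (prod_decode r)) k (code_num b (2 * L + 1) k)) else 0)"

lemma computable_fn_machine:
  assumes "computable_fn A 3 (\<lambda>xs. G (xs ! 0) (xs ! 1) (xs ! 2))"
  shows "computable_fn A 2 (\<lambda>xs. machine G (xs ! 0))"
  unfolding machine_def Let_def
  by (intro computable_fn_if computable_fn_eq computable_fn_Suc computable_fn_comp3[OF assms]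
      computable_fn_fst computable_fn_snd computable_fn_code_num computable_fn_code_ones
      computable_fn_code_length computable_fn_add computable_fn_mult computable_fn_const
      computable_fn_nth) simp_all

definition binary :: "nat \<Rightarrow> nat \<Rightarrow> bool list" where
  "binary l n = map (bit n) [0..<l]"

lemma sum_binary: "n < 2 ^ l \<Longrightarrow> (\<Sum>i<l. of_bool (binary l n ! i) * 2 ^ i) = n"
proof -
  assume "n < 2 ^ l"
  then have "n = take_bit l n" by (simp add: take_bit_nat_eq_self)
  also have "\<dots> = (\<Sum>i<l. of_bool (binary l n ! i) * 2 ^ i)"
    unfolding take_bit_sum binary_def
    by (intro sum.cong) (auto simp: push_bit_eq_mult atLeast0LessThan)
  finally show ?thesis by simp
qed

lemma code_num_bits_code:
  assumes "length u = s" "n < 2 ^ l"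
  shows "code_num (bits_code (u @ binary l n @ v)) s l = n"
proof -
  have "code_num (bits_code (u @ binary l n @ v)) s l = (\<Sum>i<l. of_bool (binary l n ! i) * 2 ^ i)"
    unfolding code_num_def bits_code_def code_nth_list_encode using assms(1)
    by (intro sum.cong) (auto simp: nth_append binary_def)
  then show ?thesis using sum_binary[OF assms(2)] by simp
qed

lemma code_ones_bits_code: "code_ones (bits_code (replicate L True @ False # q)) = L"
  unfolding code_ones_def bits_code_def code_nth_list_encode
proof (rule Least_equality)
  fix i assume "(if i < length (map of_bool (replicate L True @ False # q)) then
    map of_bool (replicate L True @ False # q) ! i else 0) = (0::nat)"
  then show "L \<le> i" by (cases "i < L") (auto simp: nth_append)
qed (simp add: nth_append)

lemma code_ones_replicate: "code_ones (bits_code (replicate L True)) = L"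
  unfolding code_ones_def bits_code_def code_nth_list_encode
  by (rule Least_equality) (auto split: if_splits)

lemma code_length_bits_code: "code_length (bits_code q) = length q"
  by (simp add: bits_code_def code_length_list_encode)

text \<open>The places where reading can be interrupted: in the unary block, in the header digits,
  or in the payload.\<close>

lemma strict_prefix_program:
  assumes "strict_prefix q (replicate L True @ False # v @ w)" "length v = L"
  obtains i where "q = replicate i True"
    | q' where "q = replicate L True @ False # q'" "length q' < L"
    | w' where "q = replicate L True @ False # v @ w'" "length w' < length w"
proof -
  obtain z where z: "replicate L True @ False # v @ w = q @ z" "z \<noteq> []"
    using assms(1) by (auto simp: strict_prefix_def prefix_def)
  from z(1) consider us where "replicate L True = q @ us" | us where "q = replicate L True @ us" "False # v @ w = us @ z"
    by (auto simp: append_eq_append_conv2)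
  then show thesis
  proof cases
    case 1
    then have "q = replicate (length q) True"
      by (metis append_eq_append_conv_if replicate_length_same take_replicate append_eq_conv_conj length_take length_replicate)
    then show thesis by (rule that(1))
  next
    case 2
    show thesis
    proof (cases us)
      case Nil
      then show thesis using 2 that(1) by simp
    next
      case (Cons a us')
      then have us': "q = replicate L True @ False # us'" "v @ w = us' @ z" using 2 by auto
      show thesis
      proof (cases "length us' < L")
        case True
        then show thesis using us' that(2) by blast
      next
        case False
        then obtain w' where "us' = v @ w'" "w = w' @ z"
          using us'(2) assms(2) by (auto simp: append_eq_append_conv2)
        then show thesis using us' z(2) that(3) by (metis length_append length_greater_0_conv less_add_same_cancel1)
      qed
    qed
  qed
qed

lemma produces_machine:
  assumes f: "\<And>xs. length xs = 2 \<Longrightarrow> eval A f xs (machine G (xs ! 0))"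
    and r: "prod_encode (m, k) < 2 ^ L" and t: "t < 2 ^ k"
  shows "produces A f (replicate L True @ False # binary L (prod_encode (m, k)) @ binary k t) y (G m k t)"
proof -
  let ?v = "binary L (prod_encode (m, k))" and ?w = "binary k t"
  let ?u = "replicate L True @ [False]"
  have lv: "length ?v = L" "length ?w = k" by (simp_all add: binary_def)
  have num1: "code_num (bits_code (replicate L True @ False # ?v @ w)) (Suc L) L = prod_encode (m, k)" for w
    using code_num_bits_code[of ?u "Suc L" "prod_encode (m, k)" L w] r by simp
  have num2: "code_num (bits_code (replicate L True @ False # ?v @ ?w)) (Suc (2 * L)) k = t"
    using code_num_bits_code[of "?u @ ?v" "Suc (2 * L)" t k "[]"] t lv by simp
  have "machine G (bits_code (replicate L True @ False # ?v @ ?w)) = Suc (G m k t)"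
    using lv num1[of ?w] num2 by (simp add: machine_def code_ones_bits_code code_length_bits_code)
  then have "eval A f [bits_code (replicate L True @ False # ?v @ ?w), y] (Suc (G m k t))"
    using f[of "[bits_code (replicate L True @ False # ?v @ ?w), y]"] by simp
  moreover have "eval A f [bits_code q, y] 0"
    if "strict_prefix q (replicate L True @ False # ?v @ ?w)" for q
  proof -
    \<comment> \<open>In the unary block and in the header the tape is too short for every value of
      \<open>k\<close>, so it is harmless that an incomplete header decodes to a meaningless
      \<open>k\<close>. In the payload the header is complete and \<open>k\<close> is
      correct.\<close>
    have "machine G (bits_code q) = 0"
      using that lv(1)
    proof (cases rule: strict_prefix_program)
      case (1 i)
      then show ?thesis by (simp add: machine_def code_ones_replicate code_length_bits_code)
    next
      case (2 q')
      then show ?thesis by (simp add: machine_def code_ones_bits_code code_length_bits_code)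
    next
      case (3 w')
      then show ?thesis using lv num1[of w']
        by (simp add: machine_def code_ones_bits_code code_length_bits_code)
    qed
    then show ?thesis using f[of "[bits_code q, y]"] by simp
  qed
  ultimately show ?thesis unfolding produces_def by blast
qed

lemma KC_le_length: "universal A p y x \<Longrightarrow> KC A x y \<le> length p"
  unfolding KC_def by (rule Least_le) blast

lemma KC_le_machine:
  assumes "computable_fn A 3 (\<lambda>xs. G (xs ! 0) (xs ! 1) (xs ! 2))"
  obtains c where "\<And>m k t L y. prod_encode (m, k) < 2 ^ L \<Longrightarrow> t < 2 ^ k \<Longrightarrow> KC A (G m k t) y \<le> k + 2 * L + c"
proof -
  obtain f where f: "\<And>xs. length xs = 2 \<Longrightarrow> eval A f xs (machine G (xs ! 0))"
    using computable_fn_machine[OF assms] unfolding computable_fn_def by blast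
  \<comment> \<open>Unary machine index with separator: \<open>code f + 1\<close> bits; unary header
    length with separator: \<open>L + 1\<close>; header digits: \<open>L\<close>; payload:
    \<open>k\<close>.\<close>
  have "KC A (G m k t) y \<le> k + 2 * L + (code f + 2)"
    if "prod_encode (m, k) < 2 ^ L" "t < 2 ^ k" for m k t L y
  proof -
    let ?p = "replicate L True @ False # binary L (prod_encode (m, k)) @ binary k t"
    have "universal A (replicate (code f) True @ False # ?p) y (G m k t)"
      using produces_machine[OF f that] unfolding universal_def by blast
    from KC_le_length[OF this] show ?thesis by (simp add: binary_def)
  qed
  then show thesis by (rule that)
qed

lemma computable_fn_index:
  assumes D: "computable_fn A 3 (\<lambda>xs. of_bool (D (xs ! 0) (xs ! 1) (xs ! 2)))"
    and b: "computable_fn A 1 (\<lambda>xs. b (xs ! 0))"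
  shows "computable_fn A 3 (\<lambda>xs. \<Sum>q<b (xs ! 0). q * of_bool (D (xs ! 0) (xs ! 1) q \<and>
     (\<Sum>q'<q. of_bool (D (xs ! 0) (xs ! 1) q')) = xs ! 2))"
proof -
  have 1: "computable_fn A 3 (\<lambda>xs. \<Sum>q'<xs ! 2. of_bool (D ((q' # xs) ! 1) ((q' # xs) ! 2) ((q' # xs) ! 0)))"
    by (rule computable_fn_sum[where F = "\<lambda>ys. of_bool (D (ys ! 1) (ys ! 2) (ys ! 0))"])
      (intro computable_fn_nth computable_fn_comp3[OF D]; simp)+
  define E where "E m k q = (\<Sum>q'<q. of_bool (D m k q') :: nat)" for m k q
  have E: "computable_fn A 3 (\<lambda>xs. E (xs ! 0) (xs ! 1) (xs ! 2))"
    using 1 by (simp add: E_def numeral_2_eq_2)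
  have "computable_fn A 3 (\<lambda>xs. \<Sum>q<b (xs ! 0). (\<lambda>ys. ys ! 0 * of_bool (D (ys ! 1) (ys ! 2) (ys ! 0) \<and>
     E (ys ! 1) (ys ! 2) (ys ! 0) = ys ! 3)) (q # xs))"
    by (rule computable_fn_sum)
      (intro computable_fn_nth computable_fn_comp3[OF D] computable_fn_comp3[OF E] computable_fn_mult
        computable_fn_conj computable_fn_eq computable_fn_comp1[OF b]; simp)+
  then show ?thesis by (simp add: E_def numeral_2_eq_2 numeral_3_eq_3)
qed

text \<open>A member of a decidable set with at most 2^k elements is recovered from its rank in
  increasing order, which fits into \<open>k\<close> bits; \<open>m\<close> and \<open>k\<close> go
  into the self-delimiting header.\<close>

lemma KC_le_decidable:
  assumes D: "computable_fn A 3 (\<lambda>xs. of_bool (D (xs ! 0) (xs ! 1) (xs ! 2)))"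
    and b: "computable_fn A 1 (\<lambda>xs. b (xs ! 0))"
    and card: "\<And>m k. card {q. q < b m \<and> D m k q} \<le> 2 ^ k"
  obtains c where "\<And>m k q L y. prod_encode (m, k) < 2 ^ L \<Longrightarrow> q < b m \<Longrightarrow> D m k q \<Longrightarrow>
    KC A (prod_encode (m, q)) y \<le> k + 2 * L + c"
proof -
  \<comment> \<open>The element of rank \<open>t\<close>, again found by a sum: the rank is the
    number of smaller members.\<close>
  define I where "I m k t = (\<Sum>q<b m. q * of_bool (D m k q \<and> (\<Sum>q'<q. of_bool (D m k q')) = t))" for m k t :: nat
  have "computable_fn A 3 (\<lambda>xs. prod_encode (xs ! 0, I (xs ! 0) (xs ! 1) (xs ! 2)))"
    unfolding I_def by (intro computable_fn_prod_encode computable_fn_nth computable_fn_index D b) simp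
  then obtain c where c: "\<And>m k t L y. prod_encode (m, k) < 2 ^ L \<Longrightarrow> t < 2 ^ k \<Longrightarrow>
      KC A (prod_encode (m, I m k t)) y \<le> k + 2 * L + c"
    by (rule KC_le_machine[where G = "\<lambda>m k t. prod_encode (m, I m k t)"]) blast
  have "KC A (prod_encode (m, q)) y \<le> k + 2 * L + c"
    if "prod_encode (m, k) < 2 ^ L" "q < b m" "D m k q" for m k q L y
  proof -
    define N where "N q = (\<Sum>q'<q. of_bool (D m k q') :: nat)" for q
    have N: "N q = card {q'. q' < q \<and> D m k q'}" for q
      unfolding N_def by (simp add: Collect_conj_eq lessThan_def)
    have N_less: "N q1 < N q2" if "q1 < q2" "D m k q1" for q1 q2
      unfolding N by (rule psubset_card_mono) (use that in auto)
    have uniq: "q' = q" if "D m k q'" "N q' = N q" for q'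
      using N_less[of q' q] N_less[of q q'] that \<open>D m k q\<close> by (metis less_irrefl nat_neq_iff)
    have "I m k (N q) = (\<Sum>q'<b m. if q' = q then q else 0)"
      unfolding I_def N_def[symmetric] using uniq \<open>D m k q\<close> by (intro sum.cong) auto
    also have "\<dots> = q" using \<open>q < b m\<close> by (subst sum.delta) simp_all
    finally have I: "I m k (N q) = q" .
    have "N q < N (b m)" using that by (intro N_less)
    also have "\<dots> \<le> 2 ^ k" unfolding N by (rule card)
    finally show ?thesis using c[of m k L "N q" y] that(1) I by simp
  qed
  then show thesis by (rule that)
qed

section \<open>Kraft's inequality\<close>

text \<open>The unary prefix of a universal program must determine the machine; otherwise programs
  of different machines could interfere in Kraft's inequality.\<close>

lemma code_inject: "code f = code g \<Longrightarrow> f = g"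
proof (induction f arbitrary: g rule: code.induct)
  case (5 f gs)
  then obtain f' gs' where g: "g = Comp f' gs'"
    by (cases g) (auto simp: prod_encode_eq)
  with "5.prems" have "code f = code f'" "map code gs = map code gs'"
    by (auto simp: prod_encode_eq list_encode_eq)
  moreover from this(2) have "gs = gs'"
    using "5.IH"(2) by (auto simp: list_eq_iff_nth_eq map_equality_iff)
  ultimately show ?case using g "5.IH"(1) by simp
next
  case (6 f h)
  then show ?case by (cases g) (auto simp: prod_encode_eq)
next
  case (7 f)
  then show ?case by (cases g) (auto simp: prod_encode_eq)
qed (case_tac g; simp add: prod_encode_eq; fail)+

lemma prefix_unary_iff:
  "prefix (replicate m True @ False # q) (replicate n True @ False # q') \<longleftrightarrow> m = n \<and> prefix q q'"
proof (induction m arbitrary: n)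
  case 0
  show ?case by (cases n) auto
next
  case (Suc m)
  then show ?case by (cases n) auto
qed

text \<open>Unary indices ended by a 0 form a prefix code, so comparable programs address the same
  machine, and its programs for a fixed condition are prefix-free.\<close>

lemma universal_prefix_free:
  assumes "universal A p y x" "universal A p' y x'" "prefix p p'"
  shows "x = x'"
proof -
  obtain f q f' q' where "p = replicate (code f) True @ False # q" "produces A f q y x"
    "p' = replicate (code f') True @ False # q'" "produces A f' q' y x'"
    using assms(1,2) unfolding universal_def by blast
  then show ?thesis
    using assms(3) produces_prefix_free by (metis prefix_unary_iff code_inject)
qed

lemma kraft_inequality:
  fixes P :: "bool list set"
  assumes "finite P" and pf: "\<And>p q. p \<in> P \<Longrightarrow> q \<in> P \<Longrightarrow> prefix p q \<Longrightarrow> p = q"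
  shows "(\<Sum>p\<in>P. (1 / 2 :: real) ^ length p) \<le> 1"
proof -
  obtain N where N: "\<And>p. p \<in> P \<Longrightarrow> length p \<le> N"
    using finite_maxlen[OF assms(1)] less_imp_le by metis
  \<comment> \<open>All extensions of \<open>p\<close> to the common length \<open>N\<close>.
    Extensions of different programs are disjoint, and there are only 2^N strings of that
    length.\<close>
  define E where "E p = (\<lambda>s. p @ s) ` {s :: bool list. length s = N - length p}" for p
  have lists: "finite {s :: bool list. length s = n}" "card {s :: bool list. length s = n} = 2 ^ n" for n
    using finite_lists_length_eq[of "UNIV :: bool set" n] card_lists_length_eq[of "UNIV :: bool set" n]
    by simp_all
  have card_E: "card (E p) = 2 ^ (N - length p)" for p
    unfolding E_def using lists by (simp add: card_image inj_on_def)
  have "E p \<inter> E q = {}" if "p \<in> P" "q \<in> P" "p \<noteq> q" for p q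
  proof (rule ccontr)
    assume "E p \<inter> E q \<noteq> {}"
    then obtain s t where "p @ s = q @ t" unfolding E_def by blast
    then have "prefix p q \<or> prefix q p"
      by (metis prefixI prefix_same_cases)
    then show False using pf that by blast
  qed
  then have "card (\<Union> (E ` P)) = (\<Sum>p\<in>P. card (E p))"
    using assms(1) lists unfolding E_def by (intro card_UN_disjoint) auto
  moreover have "card (\<Union> (E ` P)) \<le> card {s :: bool list. length s = N}"
    using lists N by (intro card_mono) (auto simp: E_def)
  ultimately have "(\<Sum>p\<in>P. 2 ^ (N - length p)) \<le> (2 ^ N :: nat)"
    by (simp add: card_E lists)
  then have "real (\<Sum>p\<in>P. 2 ^ (N - length p)) \<le> real (2 ^ N)"
    by (rule of_nat_mono)
  then have "(\<Sum>p\<in>P. 2 ^ (N - length p)) / 2 ^ N \<le> (1 :: real)"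
    by simp
  also have "(\<Sum>p\<in>P. 2 ^ (N - length p)) / 2 ^ N = (\<Sum>p\<in>P. (1 / 2 :: real) ^ length p)"
    unfolding sum_divide_distrib using N by (intro sum.cong) (auto simp: power_diff field_simps)
  finally show ?thesis .
qed

lemma KC_program: "\<exists>p. length p = KC A x y \<and> universal A p y x"
  unfolding KC_def using ex_universal_program by (rule_tac LeastI_ex) blast

lemma sum_KC_le_1:
  assumes "finite S"
  shows "(\<Sum>x\<in>S. (1 / 2 :: real) ^ KC A x y) \<le> 1"
proof -
  obtain p where p: "\<And>x. length (p x) = KC A x y" "\<And>x. universal A (p x) y x"
    using choice[of "\<lambda>x p. length p = KC A x y \<and> universal A p y x"] KC_program by blast
  have "inj p" using p(2) universal_prefix_free by (metis injI prefix_order.refl)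
  have "(\<Sum>x\<in>S. (1 / 2 :: real) ^ KC A x y) = (\<Sum>q\<in>p ` S. (1 / 2 :: real) ^ length q)"
    using \<open>inj p\<close> by (subst sum.reindex) (auto simp: p(1) inj_on_def)
  also have "\<dots> \<le> 1"
  proof (rule kraft_inequality)
    fix u v assume "u \<in> p ` S" "v \<in> p ` S" "prefix u v"
    then show "u = v" using p(2) universal_prefix_free by blast
  qed (use assms in simp)
  finally show ?thesis .
qed

lemma suminf_KC_le_1: "(\<Sum>x. ennreal ((1 / 2) ^ KC A x y)) \<le> 1"
proof (rule suminf_le_const[OF summableI])
  fix n
  have "(\<Sum>x<n. ennreal ((1 / 2) ^ KC A x y)) = ennreal (\<Sum>x<n. (1 / 2) ^ KC A x y)"
    by (rule sum_ennreal) simp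
  also have "\<dots> \<le> 1" using sum_KC_le_1[of "{..<n}" A y] by (simp add: ennreal_le_1)
  finally show "(\<Sum>x<n. ennreal ((1 / 2) ^ KC A x y)) \<le> 1" .
qed

text \<open>The expected value of \<open>2\<^sup>-\<^sup>K \<^sup>(\<^sup>Z \<^sup>| \<^sup>Y\<^sup>) / P (Z | Y)\<close> is at most 1 by Kraft's inequality; this is
  Markov's inequality for it. Here \<open>\<phi> q c\<close> bounds the conditional probability of \<open>Z = q\<close> given \<open>Y = c\<close>
  and \<open>\<psi> c\<close> is the probability of \<open>Y = c\<close>.\<close>

lemma emeasure_low_complexity:
  fixes Z Y :: "'a \<Rightarrow> nat" and \<phi> :: "nat \<Rightarrow> nat \<Rightarrow> real" and \<psi> :: "nat \<Rightarrow> real"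
  assumes Z [measurable]: "Z \<in> measurable M (count_space UNIV)"
    and Y [measurable]: "Y \<in> measurable M (count_space UNIV)"
    and \<Omega> [measurable]: "\<Omega> \<in> sets M"
    and bound: "\<And>q c. emeasure M {\<omega> \<in> \<Omega>. Z \<omega> = q \<and> Y \<omega> = c} \<le> ennreal (\<phi> q c * \<psi> c)"
    and \<psi>: "\<And>c. 0 \<le> \<psi> c" "(\<Sum>c. ennreal (\<psi> c)) \<le> 1"
    and "0 \<le> \<epsilon>"
  shows "{\<omega> \<in> \<Omega>. \<phi> (Z \<omega>) (Y \<omega>) * 2 ^ KC A (Z \<omega>) (Y \<omega>) < \<epsilon>} \<in> sets M" (is "?L \<in> _")
    and "emeasure M {\<omega> \<in> \<Omega>. \<phi> (Z \<omega>) (Y \<omega>) * 2 ^ KC A (Z \<omega>) (Y \<omega>) < \<epsilon>} \<le> ennreal \<epsilon>"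
proof -
  \<comment> \<open>On a joint fibre of \<open>Z\<close> and \<open>Y\<close> the inequality
    defining the event is constant, so each fibre is either bad as a whole or contributes
    nothing.\<close>
  define B where "B c q = (if \<phi> q c * 2 ^ KC A q c < \<epsilon> then {\<omega> \<in> \<Omega>. Z \<omega> = q \<and> Y \<omega> = c} else {})" for c q
  have [measurable]: "B c q \<in> sets M" for c q
  proof -
    have "{\<omega> \<in> \<Omega>. Z \<omega> = q \<and> Y \<omega> = c} = \<Omega> \<inter> {\<omega> \<in> space M. Z \<omega> = q \<and> Y \<omega> = c}"
      using sets.sets_into_space[OF \<Omega>] by auto
    then show ?thesis
      unfolding B_def by (cases "\<phi> q c * 2 ^ KC A q c < \<epsilon>") simp_all
  qed
  have B: "emeasure M (B c q) \<le> ennreal (\<epsilon> * \<psi> c) * ennreal ((1 / 2) ^ KC A q c)" for c q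
  proof (cases "\<phi> q c * 2 ^ KC A q c < \<epsilon>")
    case True
    then have "\<phi> q c \<le> \<epsilon> * (1 / 2) ^ KC A q c" by (simp add: field_simps power_divide)
    from mult_right_mono[OF this \<psi>(1)[of c]]
    have "\<phi> q c * \<psi> c \<le> \<epsilon> * \<psi> c * (1 / 2) ^ KC A q c"
      by (simp only: mult_ac)
    then have "ennreal (\<phi> q c * \<psi> c) \<le> ennreal (\<epsilon> * \<psi> c) * ennreal ((1 / 2) ^ KC A q c)"
      using \<psi>(1) \<open>0 \<le> \<epsilon>\<close> by (subst ennreal_mult[symmetric]) (auto intro: ennreal_leI)
    then show ?thesis using True order.trans[OF bound[of q c]] by (simp add: B_def)
  qed (simp add: B_def)
  have L: "?L = (\<Union>c. \<Union>q. B c q)"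
    by (auto simp: B_def)
  show "?L \<in> sets M" unfolding L by measurable
  have "emeasure M ?L \<le> (\<Sum>c. emeasure M (\<Union>q. B c q))"
    unfolding L by (rule emeasure_subadditive_countably) auto
  also have "\<dots> \<le> (\<Sum>c. \<Sum>q. emeasure M (B c q))"
    by (intro suminf_le summableI emeasure_subadditive_countably) auto
  also have "\<dots> \<le> (\<Sum>c. \<Sum>q. ennreal (\<epsilon> * \<psi> c) * ennreal ((1 / 2) ^ KC A q c))"
    by (intro suminf_le summableI B)
  also have "\<dots> = (\<Sum>c. ennreal (\<epsilon> * \<psi> c) * (\<Sum>q. ennreal ((1 / 2) ^ KC A q c)))"
    by simp
  also have "\<dots> \<le> (\<Sum>c. ennreal (\<epsilon> * \<psi> c) * 1)"
    by (intro suminf_le summableI mult_left_mono suminf_KC_le_1) simp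
  also have "\<dots> = ennreal \<epsilon> * (\<Sum>c. ennreal (\<psi> c))"
    using \<open>0 \<le> \<epsilon>\<close> \<psi>(1) by (simp add: ennreal_mult)
  also have "\<dots> \<le> ennreal \<epsilon> * 1"
    by (rule mult_left_mono[OF \<psi>(2)]) simp
  finally show "emeasure M ?L \<le> ennreal \<epsilon>" by simp
qed

section \<open>Tubes on the dyadic grid\<close>

text \<open>Programs output natural numbers only, whereas the tube inequality involves signed
  corners; differences of naturals suffice for ring operations and comparisons.\<close>

definition computable_int :: "nat set \<Rightarrow> nat \<Rightarrow> (nat list \<Rightarrow> int) \<Rightarrow> bool" where
  "computable_int A k F \<longleftrightarrow> (\<exists>P N. computable_fn A k P \<and> computable_fn A k N \<and>
     (\<forall>xs. F xs = int (P xs) - int (N xs)))"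

lemma computable_int_of_nat: "computable_fn A k F \<Longrightarrow> computable_int A k (\<lambda>xs. int (F xs))"
  unfolding computable_int_def by (rule exI[of _ F], rule exI[of _ "\<lambda>_. 0"]) auto

lemma computable_int_uminus: "computable_int A k F \<Longrightarrow> computable_int A k (\<lambda>xs. - F xs)"
  unfolding computable_int_def by (metis minus_diff_eq)

lemma computable_int_add:
  assumes "computable_int A k F" "computable_int A k G"
  shows "computable_int A k (\<lambda>xs. F xs + G xs)"
proof -
  obtain P N P' N' where "computable_fn A k P" "computable_fn A k N" "\<And>xs. F xs = int (P xs) - int (N xs)"
    "computable_fn A k P'" "computable_fn A k N'" "\<And>xs. G xs = int (P' xs) - int (N' xs)"
    using assms unfolding computable_int_def by blast
  then show ?thesis unfolding computable_int_def
    by (intro exI[of _ "\<lambda>xs. P xs + P' xs"] exI[of _ "\<lambda>xs. N xs + N' xs"]) auto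
qed

lemma computable_int_diff:
  "computable_int A k F \<Longrightarrow> computable_int A k G \<Longrightarrow> computable_int A k (\<lambda>xs. F xs - G xs)"
  using computable_int_add[of A k F "\<lambda>xs. - G xs"] computable_int_uminus by simp

lemma computable_int_mult:
  assumes "computable_int A k F" "computable_int A k G"
  shows "computable_int A k (\<lambda>xs. F xs * G xs)"
proof -
  obtain P N P' N' where *: "computable_fn A k P" "computable_fn A k N" "\<And>xs. F xs = int (P xs) - int (N xs)"
    "computable_fn A k P'" "computable_fn A k N'" "\<And>xs. G xs = int (P' xs) - int (N' xs)"
    using assms unfolding computable_int_def by blast
  have eq: "F xs * G xs = int (P xs * P' xs + N xs * N' xs) - int (P xs * N' xs + N xs * P' xs)" for xs
    unfolding *(3,6) by (simp add: algebra_simps)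
  show ?thesis unfolding computable_int_def
    by (rule exI[of _ "\<lambda>xs. P xs * P' xs + N xs * N' xs"], rule exI[of _ "\<lambda>xs. P xs * N' xs + N xs * P' xs"])
      (intro conjI allI computable_fn_add computable_fn_mult * eq)
qed

lemma int_decode_eq: "int_decode n = (if even n then int (n div 2) else - int (n div 2) - 1)"
  by (simp add: int_decode_def sum_decode_def)

lemma computable_int_decode:
  assumes "computable_fn A k F"
  shows "computable_int A k (\<lambda>xs. int_decode (F xs))"
proof -
  have "computable_fn A k (\<lambda>xs. if F xs = 2 * (F xs div 2) then F xs div 2 else 0)"
    "computable_fn A k (\<lambda>xs. if F xs = 2 * (F xs div 2) then 0 else Suc (F xs div 2))"
    by (intro computable_fn_if computable_fn_eq computable_fn_mult computable_fn_half computable_fn_const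
        computable_fn_Suc assms)+
  moreover have "int_decode (F xs) = int (if F xs = 2 * (F xs div 2) then F xs div 2 else 0) -
      int (if F xs = 2 * (F xs div 2) then 0 else Suc (F xs div 2))" for xs
  proof -
    have "n = 2 * (n div 2) \<longleftrightarrow> even n" for n :: nat by presburger
    then show ?thesis unfolding int_decode_eq by simp
  qed
  ultimately show ?thesis unfolding computable_int_def by blast
qed

lemma computable_fn_int_le:
  assumes "computable_int A k F" "computable_int A k G"
  shows "computable_fn A k (\<lambda>xs. of_bool (F xs \<le> G xs))"
proof -
  obtain P N P' N' where *: "computable_fn A k P" "computable_fn A k N" "\<And>xs. F xs = int (P xs) - int (N xs)"
    "computable_fn A k P'" "computable_fn A k N'" "\<And>xs. G xs = int (P' xs) - int (N' xs)"
    using assms unfolding computable_int_def by blast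
  have "computable_fn A k (\<lambda>xs. of_bool (P xs + N' xs \<le> P' xs + N xs))"
    by (intro computable_fn_le computable_fn_add *)
  moreover have "F xs \<le> G xs \<longleftrightarrow> P xs + N' xs \<le> P' xs + N xs" for xs
    by (simp add: *(3,6)) linarith
  ultimately show ?thesis by simp
qed

definition coord1 :: "nat \<Rightarrow> int" where "coord1 e = int_decode (fst (prod_decode e))"
definition coord2 :: "nat \<Rightarrow> int" where "coord2 e = int_decode (snd (prod_decode e))"
definition grid_index :: "nat \<Rightarrow> real ^ 2 \<Rightarrow> nat" where
  "grid_index m z = prod_encode (int_encode \<lfloor>2 ^ m * z $ 1\<rfloor>, int_encode \<lfloor>2 ^ m * z $ 2\<rfloor>)"

lemma coord_grid_index [simp]:
  "coord1 (grid_index m z) = \<lfloor>2 ^ m * z $ 1\<rfloor>" "coord2 (grid_index m z) = \<lfloor>2 ^ m * z $ 2\<rfloor>"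
  by (simp_all add: coord1_def coord2_def grid_index_def)

lemma coord_eqI: "coord1 e = coord1 e' \<Longrightarrow> coord2 e = coord2 e' \<Longrightarrow> e = e'"
  unfolding coord1_def coord2_def
  by (metis int_decode_inverse prod_decode_inverse prod.collapse)

lemma cube_code_cube_at: "cube_code (cube_at m z) = prod_encode (m, grid_index m z)"
  by (simp add: cube_at_def grid_index_def)

lemma cube_code_coords: "cube_code (m, coord1 e, coord2 e) = prod_encode (m, e)"
  by (simp add: coord1_def coord2_def)

lemma dyadic_cube_coords: "dyadic_cube (m, coord1 e, coord2 e) = {z. grid_index m z = e}"
  unfolding set_eq_iff mem_dyadic_cube_iff by (auto simp: cube_at_def intro!: coord_eqI)

text \<open>The square with index \<open>e\<close> at scale \<open>m\<close> is compared with the line whose dual square at scale \<open>m\<close>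
  has index \<open>q\<close>. The inequality is \<open>\<bar>v - a u - b\<bar> \<le> C / 2\<^sup>m\<close> for the lower left corners
  \<open>(u, v)\<close> and \<open>(a, b)\<close> of these squares, multiplied by \<open>4\<^sup>m\<close>.\<close>

definition in_tube :: "nat \<Rightarrow> nat \<Rightarrow> nat \<Rightarrow> nat \<Rightarrow> bool" where
  "in_tube C m q e \<longleftrightarrow> \<bar>coord2 e * 2 ^ m - coord1 q * coord1 e - coord2 q * 2 ^ m\<bar> \<le> int C * 2 ^ m"

definition tube :: "nat \<Rightarrow> nat \<Rightarrow> nat \<Rightarrow> (real ^ 2) set" where
  "tube C m q = {z. in_tube C m q (grid_index m z)}"

text \<open>Corner abscissas at distance at least \<open>1 / R\<close>, cleared of denominators so
  that the test is decidable.\<close>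

definition separated :: "nat \<Rightarrow> nat \<Rightarrow> nat \<Rightarrow> nat \<Rightarrow> bool" where
  "separated R m e e' \<longleftrightarrow> 2 ^ m \<le> int R * \<bar>coord1 e - coord1 e'\<bar>"

lemma computable_int_coord:
  assumes "computable_fn A k F"
  shows "computable_int A k (\<lambda>xs. coord1 (F xs))" "computable_int A k (\<lambda>xs. coord2 (F xs))"
  unfolding coord1_def coord2_def
  by (intro computable_int_decode computable_fn_fst computable_fn_snd assms)+

lemma computable_int_power2:
  assumes "computable_fn A k F"
  shows "computable_int A k (\<lambda>xs. 2 ^ F xs)"
  using computable_int_of_nat[OF computable_fn_power2[OF assms]] by simp

lemma computable_fn_in_tube:
  assumes "computable_fn A k M" "computable_fn A k Q" "computable_fn A k E"
  shows "computable_fn A k (\<lambda>xs. of_bool (in_tube C (M xs) (Q xs) (E xs)))"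
  unfolding in_tube_def abs_le_iff
  by (intro computable_fn_conj computable_fn_int_le computable_int_uminus computable_int_diff
      computable_int_mult computable_int_coord computable_int_power2 computable_int_of_nat
      computable_fn_const assms)

lemma computable_fn_separated:
  assumes "computable_fn A k M" "computable_fn A k E" "computable_fn A k E'"
  shows "computable_fn A k (\<lambda>xs. of_bool (separated R (M xs) (E xs) (E' xs)))"
proof -
  have "separated R m e e' \<longleftrightarrow> 2 ^ m \<le> int R * (coord1 e - coord1 e') \<or> 2 ^ m \<le> int R * (coord1 e' - coord1 e)" for m e e'
  proof (cases "coord1 e \<le> coord1 e'")
    case True
    then have "int R * (coord1 e - coord1 e') \<le> 0" by (simp add: mult_nonneg_nonpos)
    moreover have "(0::int) < 2 ^ m" by simp
    ultimately have "\<not> 2 ^ m \<le> int R * (coord1 e - coord1 e')" by linarith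
    with True show ?thesis by (simp add: separated_def)
  next
    case False
    then have "int R * (coord1 e' - coord1 e) \<le> 0" by (simp add: mult_nonneg_nonpos)
    moreover have "(0::int) < 2 ^ m" by simp
    ultimately have "\<not> 2 ^ m \<le> int R * (coord1 e' - coord1 e)" by linarith
    with False show ?thesis by (simp add: separated_def)
  qed
  then show ?thesis
    by (simp only:) (intro computable_fn_disj computable_fn_int_le computable_int_diff
      computable_int_mult computable_int_coord computable_int_power2 computable_int_of_nat
      computable_fn_const assms)
qed

lemma card_int_le:
  fixes S :: "int set"
  assumes "\<And>i j. i \<in> S \<Longrightarrow> j \<in> S \<Longrightarrow> \<bar>i - j\<bar> \<le> int n"
  shows "finite S \<and> card S \<le> 2 * n + 1"
proof (cases "S = {}")
  case False
  then obtain i where "i \<in> S" by blast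
  then have "S \<subseteq> {i - int n..i + int n}" using assms by fastforce
  then show ?thesis using card_mono[of "{i - int n..i + int n}" S] finite_subset by fastforce
qed simp

text \<open>Subtracting the two tube inequalities eliminates the intercept, and the separation
  confines the slope to \<open>8 * C * R + 1\<close> integers. For a given slope, the inequality at
  \<open>e\<close> alone leaves \<open>4 * C + 1\<close> intercepts.\<close>

lemma card_lines_through:
  assumes sep: "separated R m e e'"
  shows "finite {q. in_tube C m q e \<and> in_tube C m q e'}"
    and "card {q. in_tube C m q e \<and> in_tube C m q e'} \<le> (8 * C * R + 1) * (4 * C + 1)"
proof -
  let ?S = "{q. in_tube C m q e \<and> in_tube C m q e'}"
  let ?p = "coord1 e" and ?p' = "coord1 e'"
  have abs_diff: "\<bar>x - y\<bar> \<le> 2 * c" if "\<bar>a - x\<bar> \<le> c" "\<bar>a - y\<bar> \<le> c" for a x y c :: int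
    using that by linarith
  have "\<bar>coord1 q - coord1 q'\<bar> \<le> int (4 * C * R)" if "q \<in> ?S" "q' \<in> ?S" for q q'
  proof -
    have "\<bar>(coord2 e - coord2 e') * 2 ^ m - coord1 s * (?p - ?p')\<bar> \<le> 2 * (int C * 2 ^ m)" if "s \<in> ?S" for s
    proof -
      from that have "\<bar>(coord2 e * 2 ^ m - coord1 s * ?p - coord2 s * 2 ^ m) -
          (coord2 e' * 2 ^ m - coord1 s * ?p' - coord2 s * 2 ^ m)\<bar> \<le> 2 * (int C * 2 ^ m)"
        unfolding in_tube_def mem_Collect_eq by linarith
      then show ?thesis by (simp only: algebra_simps)
    qed
    from abs_diff[OF this[OF that(1)] this[OF that(2)]]
    have "\<bar>(coord1 q - coord1 q') * (?p - ?p')\<bar> \<le> 4 * int C * 2 ^ m"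
      by (simp add: algebra_simps)
    also have "\<dots> \<le> 4 * int C * (int R * \<bar>?p - ?p'\<bar>)"
      using sep unfolding separated_def by (intro mult_left_mono) auto
    finally have "\<bar>coord1 q - coord1 q'\<bar> * \<bar>?p - ?p'\<bar> \<le> int (4 * C * R) * \<bar>?p - ?p'\<bar>"
      by (simp add: abs_mult mult_ac)
    moreover have "(0::int) < 2 ^ m" by simp
    then have "?p \<noteq> ?p'" using sep unfolding separated_def by auto
    ultimately show ?thesis by simp
  qed
  then have 1: "finite (coord1 ` ?S) \<and> card (coord1 ` ?S) \<le> 2 * (4 * C * R) + 1"
    by (intro card_int_le) blast
  have 2: "finite (coord2 ` {q \<in> ?S. coord1 q = i}) \<and> card (coord2 ` {q \<in> ?S. coord1 q = i}) \<le> 2 * (2 * C) + 1" for i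
  proof (rule card_int_le, elim imageE CollectE conjE)
    fix j j' q q' assume *: "j = coord2 q" "j' = coord2 q'" "in_tube C m q e" "in_tube C m q' e"
      "coord1 q = i" "coord1 q' = i"
    from *(3,4) have "\<bar>coord2 q * 2 ^ m - coord2 q' * 2 ^ m\<bar> \<le> 2 * (int C * 2 ^ m)"
      unfolding in_tube_def *(5,6) by (rule abs_diff)
    then have "\<bar>coord2 q - coord2 q'\<bar> * 2 ^ m \<le> int (2 * C) * 2 ^ m"
      by (simp add: abs_mult flip: left_diff_distrib)
    then show "\<bar>j - j'\<bar> \<le> int (2 * C)" using *(1,2) by simp
  qed
  have "(\<lambda>q. (coord1 q, coord2 q)) ` ?S \<subseteq> (SIGMA i:coord1 ` ?S. coord2 ` {q \<in> ?S. coord1 q = i})" (is "?I \<subseteq> ?T")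
    by auto
  moreover have fin: "finite ?T" using 1 2 by (intro finite_SigmaI) auto
  moreover have "card ?T \<le> (8 * C * R + 1) * (4 * C + 1)"
  proof -
    have "card ?T = (\<Sum>i\<in>coord1 ` ?S. card (coord2 ` {q \<in> ?S. coord1 q = i}))"
      using 1 2 by (intro card_SigmaI) blast+
    also have "\<dots> \<le> (\<Sum>i\<in>coord1 ` ?S. 2 * (2 * C) + 1)"
      using 2 by (intro sum_mono) blast
    also have "\<dots> \<le> (2 * (4 * C * R) + 1) * (2 * (2 * C) + 1)"
      using 1 by (simp only: sum_constant of_nat_id) (intro mult_right_mono, auto)
    finally show ?thesis by (simp add: mult.assoc)
  qed
  moreover have inj: "inj_on (\<lambda>q. (coord1 q, coord2 q)) ?S"
    by (auto intro: inj_onI coord_eqI)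
  ultimately show "finite ?S" "card ?S \<le> (8 * C * R + 1) * (4 * C + 1)"
    using finite_imageD[OF finite_subset[OF \<open>?I \<subseteq> ?T\<close> fin] inj] card_image[OF inj] card_mono[OF fin \<open>?I \<subseteq> ?T\<close>]
    by simp_all
qed

section \<open>Upper bounds for the complexity of lines\<close>

text \<open>With rounded masses \<open>f\<close> and \<open>g\<close> this is an integer upper
  estimate of 16^m times the product of the tube masses of two separated sets. \<open>Suc\<close>
  absorbs the rounding, and the separation test stands in for membership in the two sets.\<close>

definition weight :: "(nat \<Rightarrow> nat \<Rightarrow> nat) \<Rightarrow> (nat \<Rightarrow> nat \<Rightarrow> nat) \<Rightarrow> nat \<Rightarrow> nat \<Rightarrow> nat \<Rightarrow> nat \<Rightarrow> nat \<Rightarrow> nat" where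
  "weight f g C R B m q = (\<Sum>e<B * 4 ^ m. \<Sum>e'<B * 4 ^ m.
     of_bool (in_tube C m q e \<and> in_tube C m q e' \<and> separated R m e e') * (Suc (f m e) * Suc (g m e')))"

lemma computable_fn_bound: "computable_fn A k F \<Longrightarrow> computable_fn A k (\<lambda>xs. B * 4 ^ F xs)"
proof -
  assume "computable_fn A k F"
  then have "computable_fn A k (\<lambda>xs. B * (2 ^ F xs * 2 ^ F xs))"
    by (intro computable_fn_mult computable_fn_const computable_fn_power2)
  moreover have "2 ^ n * 2 ^ n = (4 :: nat) ^ n" for n by (simp flip: power_mult_distrib)
  ultimately show ?thesis by simp
qed

lemma computable_fn_weight:
  assumes f: "computable_fn A 2 (\<lambda>xs. f (xs ! 0) (xs ! 1))" and g: "computable_fn A 2 (\<lambda>xs. g (xs ! 0) (xs ! 1))"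
  shows "computable_fn A 2 (\<lambda>xs. weight f g C R B (xs ! 0) (xs ! 1))"
proof -
  have "computable_fn A 3 (\<lambda>xs. \<Sum>e'<B * 4 ^ (xs ! 1). (\<lambda>ys. of_bool (in_tube C (ys ! 2) (ys ! 3) (ys ! 1) \<and>
      in_tube C (ys ! 2) (ys ! 3) (ys ! 0) \<and> separated R (ys ! 2) (ys ! 1) (ys ! 0)) *
      (Suc (f (ys ! 2) (ys ! 1)) * Suc (g (ys ! 2) (ys ! 0)))) (e' # xs))"
    by (rule computable_fn_sum)
      (intro computable_fn_mult computable_fn_conj computable_fn_in_tube computable_fn_separated
        computable_fn_Suc computable_fn_comp2[OF f] computable_fn_comp2[OF g] computable_fn_nth
        computable_fn_bound; simp)+
  then have inner: "computable_fn A 3 (\<lambda>xs. \<Sum>e'<B * 4 ^ (xs ! 1). of_bool (in_tube C (xs ! 1) (xs ! 2) (xs ! 0) \<and>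
      in_tube C (xs ! 1) (xs ! 2) e' \<and> separated R (xs ! 1) (xs ! 0) e') *
      (Suc (f (xs ! 1) (xs ! 0)) * Suc (g (xs ! 1) e')))"
    by (simp add: numeral_2_eq_2 numeral_3_eq_3)
  have "computable_fn A 2 (\<lambda>xs. \<Sum>e<B * 4 ^ (xs ! 0). (\<lambda>xs. \<Sum>e'<B * 4 ^ (xs ! 1). of_bool (in_tube C (xs ! 1) (xs ! 2) (xs ! 0) \<and>
      in_tube C (xs ! 1) (xs ! 2) e' \<and> separated R (xs ! 1) (xs ! 0) e') *
      (Suc (f (xs ! 1) (xs ! 0)) * Suc (g (xs ! 1) e'))) (e # xs))"
    by (rule computable_fn_sum) (use inner in \<open>simp add: numeral_2_eq_2 numeral_3_eq_3\<close>,
      intro computable_fn_bound computable_fn_nth, simp)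
  then show ?thesis unfolding weight_def by (simp add: numeral_2_eq_2)
qed

text \<open>Double counting: a separated pair of squares contributes to at most \<open>?N\<close> of
  the indices \<open>q\<close>, so the total is bounded by \<open>?N\<close> times the product of
  the total masses.\<close>

lemma sum_weight_le:
  assumes "(\<Sum>e<B * 4 ^ m. Suc (f m e)) \<le> V" "(\<Sum>e<B * 4 ^ m. Suc (g m e)) \<le> V"
  shows "(\<Sum>q<b. weight f g C R B m q) \<le> (8 * C * R + 1) * (4 * C + 1) * V ^ 2"
proof -
  let ?N = "(8 * C * R + 1) * (4 * C + 1)" and ?E = "{..<B * 4 ^ m}"
  let ?t = "\<lambda>q e e'. of_bool (in_tube C m q e \<and> in_tube C m q e' \<and> separated R m e e') :: nat"
  let ?w = "\<lambda>e e'. Suc (f m e) * Suc (g m e')"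
  have count: "(\<Sum>q<b. ?t q e e') \<le> ?N" for e e'
  proof (cases "separated R m e e'")
    case True
    have "(\<Sum>q<b. ?t q e e') = card ({..<b} \<inter> {q. in_tube C m q e \<and> in_tube C m q e'})"
      using True by simp
    also have "\<dots> \<le> card {q. in_tube C m q e \<and> in_tube C m q e'}"
      using card_lines_through(1)[OF True] by (intro card_mono) auto
    also have "\<dots> \<le> ?N" by (rule card_lines_through(2)[OF True])
    finally show ?thesis .
  qed simp
  have "(\<Sum>q<b. weight f g C R B m q) = (\<Sum>e\<in>?E. \<Sum>q<b. \<Sum>e'\<in>?E. ?t q e e' * ?w e e')"
    unfolding weight_def by (rule sum.swap)
  also have "\<dots> = (\<Sum>e\<in>?E. \<Sum>e'\<in>?E. \<Sum>q<b. ?t q e e' * ?w e e')"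
    by (rule sum.cong[OF refl]) (rule sum.swap)
  also have "\<dots> = (\<Sum>e\<in>?E. \<Sum>e'\<in>?E. (\<Sum>q<b. ?t q e e') * ?w e e')"
    by (simp only: sum_distrib_right)
  also have "\<dots> \<le> (\<Sum>e\<in>?E. \<Sum>e'\<in>?E. ?N * ?w e e')"
    by (intro sum_mono mult_right_mono count) simp
  also have "\<dots> = ?N * ((\<Sum>e\<in>?E. Suc (f m e)) * (\<Sum>e\<in>?E. Suc (g m e)))"
    by (simp only: sum_distrib_left[symmetric] sum_product)
  also have "\<dots> \<le> ?N * (V * V)"
    by (intro mult_left_mono mult_mono assms) auto
  finally show ?thesis by (simp add: power2_eq_square)
qed

text \<open>At most 2^k indices can carry a share 2^-k of the total weight, so an index of weight
  \<open>w\<close> needs about the logarithm of (total / \<open>w\<close>) bits. The fourth power of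
  \<open>m + 1\<close> pays for the self-delimiting description of \<open>m\<close> and
  \<open>k\<close>.\<close>

lemma KC_weight_le:
  assumes f: "computable_fn A 2 (\<lambda>xs. f (xs ! 0) (xs ! 1))" and g: "computable_fn A 2 (\<lambda>xs. g (xs ! 0) (xs ! 1))"
    and V: "\<And>m. (\<Sum>e<B * 4 ^ m. Suc (f m e)) \<le> V * 4 ^ m" "\<And>m. (\<Sum>e<B * 4 ^ m. Suc (g m e)) \<le> V * 4 ^ m"
  shows "\<exists>c>0. \<forall>m q. q < B * 4 ^ m \<longrightarrow>
    2 ^ KC A (prod_encode (m, q)) 0 * real (weight f g C R B m q) \<le> c * (real m + 1) ^ 4 * 16 ^ m"
proof -
  \<comment> \<open>The summand 1 keeps \<open>N\<close> positive, which is needed when it is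
    cancelled in \<open>card\<close>.\<close>
  define N where "N = (8 * C * R + 1) * (4 * C + 1) * V ^ 2 + 1"
  define D where "D m k q \<longleftrightarrow> N * 4 ^ (2 * m) \<le> weight f g C R B m q * 2 ^ k" for m k q
  have sum_le: "(\<Sum>q<b. weight f g C R B m q) \<le> N * 4 ^ (2 * m)" for b m
  proof -
    have "(\<Sum>q<b. weight f g C R B m q) \<le> (8 * C * R + 1) * (4 * C + 1) * (V * 4 ^ m) ^ 2"
      by (rule sum_weight_le[OF V])
    also have "\<dots> \<le> N * 4 ^ (2 * m)"
      by (simp add: N_def power_mult_distrib power_mult power2_eq_square algebra_simps)
    finally show ?thesis .
  qed
  have card: "card {q. q < B * 4 ^ m \<and> D m k q} \<le> 2 ^ k" for m k
  proof -
    have "card {q. q < B * 4 ^ m \<and> D m k q} * (N * 4 ^ (2 * m)) \<le> (\<Sum>q\<in>{q. q < B * 4 ^ m \<and> D m k q}. weight f g C R B m q * 2 ^ k)"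
      using sum_bounded_below[of "{q. q < B * 4 ^ m \<and> D m k q}" "N * 4 ^ (2 * m)" "\<lambda>q. weight f g C R B m q * 2 ^ k"]
      by (simp add: D_def)
    also have "\<dots> \<le> (\<Sum>q<B * 4 ^ m. weight f g C R B m q * 2 ^ k)"
      by (intro sum_mono2) auto
    also have "\<dots> = (\<Sum>q<B * 4 ^ m. weight f g C R B m q) * 2 ^ k" by (simp add: sum_distrib_right)
    also have "\<dots> \<le> N * 4 ^ (2 * m) * 2 ^ k" by (intro mult_right_mono sum_le) simp
    finally show ?thesis by (simp add: N_def)
  qed
  have "computable_fn A 3 (\<lambda>xs. of_bool (D (xs ! 0) (xs ! 1) (xs ! 2)))"
    unfolding D_def
    by (intro computable_fn_le computable_fn_mult computable_fn_comp2[OF computable_fn_weight[OF f g]]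
        computable_fn_power2 computable_fn_bound computable_fn_nth computable_fn_const) simp_all
  moreover have "computable_fn A 1 (\<lambda>xs. B * 4 ^ (xs ! 0))"
    by (intro computable_fn_bound computable_fn_nth) simp
  ultimately obtain c where c: "\<And>m k q L y. prod_encode (m, k) < 2 ^ L \<Longrightarrow> q < B * 4 ^ m \<Longrightarrow> D m k q \<Longrightarrow>
    KC A (prod_encode (m, q)) y \<le> k + 2 * L + c"
    using card by (rule KC_le_decidable[where D = D and b = "\<lambda>m. B * 4 ^ m"]) blast
  have main: "2 ^ KC A (prod_encode (m, q)) 0 * weight f g C R B m q \<le> 2 ^ c * (16 * (5 * m + N + 1) ^ 4) * (2 * N * 4 ^ (2 * m))"
    if q: "q < B * 4 ^ m" for m q
  proof (cases "weight f g C R B m q = 0")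
    case False
    let ?w = "weight f g C R B m q"
    \<comment> \<open>The least admissible \<open>k\<close> is at most \<open>4 * m + N\<close>,
      because a nonzero weight is at least 1 and \<open>N \<le> 2 ^ N\<close>. Minimality bounds
      \<open>2 ^ k * ?w\<close> by twice the total.\<close>
    define k where "k = (LEAST k. D m k q)"
    have "N \<le> 2 ^ N" by simp
    then have "N * 4 ^ (2 * m) \<le> 2 ^ N * 4 ^ (2 * m)" by (rule mult_right_mono) simp
    also have "\<dots> = 2 ^ (4 * m + N)" by (simp add: power_add power_mult)
    also have "\<dots> \<le> ?w * 2 ^ (4 * m + N)" using False by simp
    finally have "D m (4 * m + N) q" unfolding D_def .
    then have D: "D m k q" and k_le: "k \<le> 4 * m + N"
      unfolding k_def by (auto intro: LeastI Least_le)
    have k_w: "2 ^ k * ?w \<le> 2 * N * 4 ^ (2 * m)"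
    proof (cases k)
      case 0
      have "?w \<le> (\<Sum>q<Suc q. weight f g C R B m q)" by simp
      also note sum_le
      finally show ?thesis by (simp add: 0)
    next
      case (Suc k')
      then have "\<not> D m k' q" unfolding k_def by (intro not_less_Least) simp
      then show ?thesis by (simp add: D_def Suc algebra_simps)
    qed
    \<comment> \<open>\<open>2 ^ l\<close> is \<open>m + k + 1\<close> up to a factor 2. The pair is
      below the square of \<open>2 ^ l\<close>, so the header has \<open>2 * l\<close> digits and
      costs about \<open>4 * l\<close> bits; this is the source of the fourth power.\<close>
    obtain l where l: "m + k + 1 < 2 ^ l" "2 ^ l \<le> 2 * (m + k + 1)"
    proof -
      define l where "l = (LEAST l. m + k + 1 < 2 ^ l)"
      have "m + k + 1 < 2 ^ (m + k + 1)" by (rule less_exp)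
      then have "m + k + 1 < 2 ^ l" unfolding l_def by (rule LeastI)
      moreover have "2 ^ l \<le> 2 * (m + k + 1)"
      proof (cases l)
        case (Suc l')
        then have "\<not> m + k + 1 < 2 ^ l'" unfolding l_def by (intro not_less_Least) simp
        then show ?thesis by (simp add: Suc)
      qed simp
      ultimately show thesis by (rule that)
    qed
    have "prod_encode (m, k) \<le> (m + k + 1) * (m + k + 1)"
      by (simp add: prod_encode_def triangle_def algebra_simps)
    also have "\<dots> < 2 ^ l * 2 ^ l" by (intro mult_strict_mono l) auto
    finally have "prod_encode (m, k) < 2 ^ (2 * l)" by (simp add: power_add mult_2)
    from c[OF this q D, of 0] have "2 ^ KC A (prod_encode (m, q)) 0 \<le> (2 :: nat) ^ (k + 4 * l + c)"
      by (intro power_increasing) auto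
    then have "2 ^ KC A (prod_encode (m, q)) 0 * ?w \<le> 2 ^ (k + 4 * l + c) * ?w" by (rule mult_right_mono) simp
    also have "\<dots> = 2 ^ c * (2 ^ l) ^ 4 * (2 ^ k * ?w)"
      by (simp add: power_add power_mult mult_ac flip: power_mult)
    also have "\<dots> \<le> 2 ^ c * (2 * (5 * m + N + 1)) ^ 4 * (2 * N * 4 ^ (2 * m))"
      using l(2) k_le by (intro mult_mono power_mono k_w) auto
    also have "\<dots> = 2 ^ c * (16 * (5 * m + N + 1) ^ 4) * (2 * N * 4 ^ (2 * m))"
      by (simp only: power_mult_distrib) simp
    finally show ?thesis .
  qed simp
  let ?c = "2 ^ c * 16 * (2 * real N) * (5 + real N) ^ 4"
  show ?thesis
  proof (intro exI[of _ ?c] conjI allI impI)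
    have "0 < N" by (simp add: N_def)
    then show "0 < ?c" by (intro mult_pos_pos zero_less_power add_pos_pos) simp_all
    fix m q assume q: "q < B * 4 ^ m"
    have "5 * real m + real N + 1 \<le> (5 + real N) * (real m + 1)" by (simp add: algebra_simps)
    then have *: "(5 * real m + real N + 1) ^ 4 \<le> ((5 + real N) * (real m + 1)) ^ 4" by (intro power_mono) auto
    have "2 ^ KC A (prod_encode (m, q)) 0 * real (weight f g C R B m q) =
        real (2 ^ KC A (prod_encode (m, q)) 0 * weight f g C R B m q)" by simp
    also have "\<dots> \<le> real (2 ^ c * (16 * (5 * m + N + 1) ^ 4) * (2 * N * 4 ^ (2 * m)))"
      by (rule of_nat_mono[OF main[OF q]])
    also have "\<dots> = 2 ^ c * 16 * (2 * real N) * (5 * real m + real N + 1) ^ 4 * 16 ^ m"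
      by (simp add: power_mult add_ac)
    also have "\<dots> \<le> 2 ^ c * 16 * (2 * real N) * ((5 + real N) * (real m + 1)) ^ 4 * 16 ^ m"
      by (intro mult_right_mono mult_left_mono *) auto
    finally show "2 ^ KC A (prod_encode (m, q)) 0 * real (weight f g C R B m q) \<le> ?c * (real m + 1) ^ 4 * 16 ^ m"
      by (simp only: power_mult_distrib mult.assoc)
  qed
qed

text \<open>The precision \<open>4\<^sup>-\<^sup>m\<close> is sufficient: only \<open>O(4\<^sup>m)\<close> squares matter, so the rounding errors
  increase the total mass by \<open>O(1)\<close>.\<close>

definition grid_approximation :: "nat set \<Rightarrow> (nat \<Rightarrow> nat \<Rightarrow> nat) \<Rightarrow> (real ^ 2) measure \<Rightarrow> bool" where
  "grid_approximation A f \<mu> \<longleftrightarrow> computable_fn A 2 (\<lambda>xs. f (xs ! 0) (xs ! 1)) \<and>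
     (\<forall>m e. \<bar>4 ^ m * measure \<mu> {z. grid_index m z = e} - real (f m e)\<bar> \<le> 1)"

lemma ex_grid_approximation:
  assumes "computable_measure A \<mu>"
  shows "\<exists>f. grid_approximation A f \<mu>"
proof -
  obtain r where "\<And>Q k. \<exists>a. eval A r [cube_code Q, k] a \<and> \<bar>measure \<mu> (dyadic_cube Q) - real a / 2 ^ k\<bar> \<le> 1 / 2 ^ k"
    using assms unfolding computable_measure_def by blast
  from this[of "(m, coord1 e, coord2 e)" k for m e k]
  have "\<exists>a. eval A r [prod_encode (m, e), k] a \<and> \<bar>measure \<mu> {z. grid_index m z = e} - real a / 2 ^ k\<bar> \<le> 1 / 2 ^ k" for m e k
    unfolding cube_code_coords dyadic_cube_coords .
  then obtain a where a: "\<And>m e k. eval A r [prod_encode (m, e), k] (a m e k)"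
    "\<And>m e k. \<bar>measure \<mu> {z. grid_index m z = e} - real (a m e k) / 2 ^ k\<bar> \<le> 1 / 2 ^ k"
    by metis
  have "computable_fn A 2 (\<lambda>xs. case prod_decode (xs ! 0) of (m, e) \<Rightarrow> a m e (xs ! 1))"
    unfolding computable_fn_def
  proof (intro exI[of _ r] allI impI)
    fix xs :: "nat list" assume "length xs = 2"
    then obtain c k where xs: "xs = [c, k]" by (auto simp: numeral_2_eq_2 length_Suc_conv)
    obtain m e where "c = prod_encode (m, e)" by (metis prod_decode_inverse surj_pair)
    then show "eval A r xs (case prod_decode (xs ! 0) of (m, e) \<Rightarrow> a m e (xs ! 1))"
      by (simp add: xs a(1))
  qed
  then have *: "computable_fn A 2 (\<lambda>xs. (\<lambda>c k. case prod_decode c of (m, e) \<Rightarrow> a m e k) (xs ! 0) (xs ! 1))" .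
  \<comment> \<open>Precision parameter \<open>2 * m\<close>, that is, error at most 4^-m.\<close>
  have "computable_fn A 2 (\<lambda>xs. (\<lambda>c k. case prod_decode c of (m, e) \<Rightarrow> a m e k) (prod_encode (xs ! 0, xs ! 1)) (2 * xs ! 0))"
    by (rule computable_fn_comp2[OF *]) (intro computable_fn_prod_encode computable_fn_mult computable_fn_const computable_fn_nth; simp)+
  then have "computable_fn A 2 (\<lambda>xs. a (xs ! 0) (xs ! 1) (2 * xs ! 0))" by simp
  moreover have "\<bar>4 ^ m * measure \<mu> {z. grid_index m z = e} - real (a m e (2 * m))\<bar> \<le> 1" for m e
  proof -
    have "4 ^ m * \<bar>measure \<mu> {z. grid_index m z = e} - real (a m e (2 * m)) / 4 ^ m\<bar> \<le> 4 ^ m * (1 / 4 ^ m)"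
      using a(2)[of m e "2 * m"] by (intro mult_left_mono) (simp_all add: power_mult)
    also have "4 ^ m * \<bar>measure \<mu> {z. grid_index m z = e} - real (a m e (2 * m)) / 4 ^ m\<bar> =
        \<bar>4 ^ m * (measure \<mu> {z. grid_index m z = e} - real (a m e (2 * m)) / 4 ^ m)\<bar>"
      by (simp add: abs_mult)
    finally show ?thesis by (simp add: right_diff_distrib)
  qed
  ultimately have "grid_approximation A (\<lambda>m e. a m e (2 * m)) \<mu>"
    unfolding grid_approximation_def by blast
  then show ?thesis by blast
qed

lemma
  assumes "grid_approximation A f \<mu>"
  shows grid_approximation_computable: "computable_fn A 2 (\<lambda>xs. f (xs ! 0) (xs ! 1))"
    and grid_approximation_le: "4 ^ m * measure \<mu> {z. grid_index m z = e} \<le> real (f m e) + 1"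
    and grid_approximation_ge: "real (f m e) \<le> 4 ^ m * measure \<mu> {z. grid_index m z = e} + 1"
proof -
  show "computable_fn A 2 (\<lambda>xs. f (xs ! 0) (xs ! 1))"
    using assms by (simp only: grid_approximation_def)
  have "\<bar>4 ^ m * measure \<mu> {z. grid_index m z = e} - real (f m e)\<bar> \<le> 1"
    using assms unfolding grid_approximation_def by simp
  then show "4 ^ m * measure \<mu> {z. grid_index m z = e} \<le> real (f m e) + 1"
    "real (f m e) \<le> 4 ^ m * measure \<mu> {z. grid_index m z = e} + 1" by linarith+
qed

section \<open>Number of relevant grid squares and total rounding error\<close>

lemma int_encode_le: "int (int_encode i) \<le> 2 * \<bar>i\<bar> + 1"
  by (auto simp: int_encode_def sum_encode_def)

text \<open>In a square of half-side \<open>R\<close> each coordinate code is at most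
  \<open>(2 * R + 3) * 2 ^ m\<close>, and the code of a pair is at most the square of one plus the
  sum of its entries.\<close>

definition grid_bound :: "nat \<Rightarrow> nat" where "grid_bound R = (4 * R + 8)\<^sup>2"

lemma grid_index_less:
  assumes "\<bar>z $ 1\<bar> \<le> real R" "\<bar>z $ 2\<bar> \<le> real R"
  shows "grid_index m z < grid_bound R * 4 ^ m"
proof -
  have *: "int_encode \<lfloor>2 ^ m * t\<rfloor> \<le> (2 * R + 3) * 2 ^ m" if "\<bar>t\<bar> \<le> real R" for t :: real
  proof -
    have "\<bar>2 ^ m * t\<bar> \<le> 2 ^ m * real R" using that by (simp add: abs_mult)
    then have "2 ^ m * t \<le> 2 ^ m * real R" "- (2 ^ m * real R) \<le> 2 ^ m * t"
      by linarith+
    then have "real_of_int \<lfloor>2 ^ m * t\<rfloor> \<le> 2 ^ m * real R + 1" "- (2 ^ m * real R + 1) \<le> real_of_int \<lfloor>2 ^ m * t\<rfloor>"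
      by linarith+
    then have "\<bar>real_of_int \<lfloor>2 ^ m * t\<rfloor>\<bar> \<le> 2 ^ m * real R + 1" by linarith
    then have "real_of_int \<bar>\<lfloor>2 ^ m * t\<rfloor>\<bar> \<le> real_of_int (2 ^ m * int R + 1)" by simp
    then have "\<bar>\<lfloor>2 ^ m * t\<rfloor>\<bar> \<le> 2 ^ m * int R + 1" by (simp only: of_int_le_iff)
    then have "int (int_encode \<lfloor>2 ^ m * t\<rfloor>) \<le> 2 * (2 ^ m * int R + 1) + 1"
      by (rule order.trans[OF int_encode_le add_right_mono[OF mult_left_mono]]) simp
    also have "\<dots> \<le> int ((2 * R + 3) * 2 ^ m)" by (simp add: algebra_simps)
    finally show ?thesis by linarith
  qed
  let ?a = "int_encode \<lfloor>2 ^ m * z $ 1\<rfloor>" and ?b = "int_encode \<lfloor>2 ^ m * z $ 2\<rfloor>"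
  have "grid_index m z \<le> (?a + ?b + 1) * (?a + ?b + 1)"
    by (simp add: grid_index_def prod_encode_def triangle_def algebra_simps)
  also have "?a + ?b + 1 < (4 * R + 8) * 2 ^ m"
  proof -
    have "(2 * R + 3) * 2 ^ m = 2 * (R * 2 ^ m) + 3 * 2 ^ m" "(4 * R + 8) * 2 ^ m = 4 * (R * 2 ^ m) + 8 * 2 ^ m"
      by (simp_all add: algebra_simps)
    then show ?thesis
      using *[OF assms(1)] *[OF assms(2)] one_le_power[of "2 :: nat" m] by linarith
  qed
  then have "(?a + ?b + 1) * (?a + ?b + 1) < ((4 * R + 8) * 2 ^ m) * ((4 * R + 8) * 2 ^ m)"
    by (intro mult_strict_mono) auto
  also have "\<dots> = grid_bound R * 4 ^ m"
    by (simp add: grid_bound_def power2_eq_square flip: power_mult_distrib)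
  finally show ?thesis .
qed

lemma measurable_vec_nth [measurable]: "(\<lambda>z :: real ^ 'n. z $ i) \<in> borel_measurable borel"
  by (intro borel_measurable_continuous_onI continuous_intros)

lemma measurable_grid_index [measurable]: "grid_index m \<in> measurable borel (count_space UNIV)"
  unfolding grid_index_def by measurable

lemma tube_borel [measurable]: "tube C m q \<in> sets borel"
  unfolding tube_def by measurable

lemma grid_square_borel [measurable]: "{z. grid_index m z = e} \<in> sets borel"
  by measurable

lemma prob_grid_sum_le_1:
  assumes "prob_space \<mu>" "sets \<mu> = sets borel" "finite E"
  shows "(\<Sum>e\<in>E. measure \<mu> {z. grid_index m z = e}) \<le> 1"
proof -
  interpret prob_space \<mu> by fact
  have sets: "(\<lambda>e. {z. grid_index m z = e}) ` E \<subseteq> sets \<mu>"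
    unfolding assms(2) using grid_square_borel by blast
  have "disjoint_family_on (\<lambda>e. {z. grid_index m z = e}) E"
    unfolding disjoint_family_on_def by blast
  from finite_measure_finite_Union[OF assms(3) sets this] show ?thesis
    using prob_le_1 by metis
qed

text \<open>The true mass contributes at most 4^m. Each of the \<open>B * 4 ^ m\<close> squares adds
  1 for rounding and 1 for \<open>Suc\<close>.\<close>

lemma approximation_sum_le:
  assumes "prob_space \<mu>" "sets \<mu> = sets borel"
    and f: "\<And>m e. real (f m e) \<le> 4 ^ m * measure \<mu> {z. grid_index m z = e} + 1"
  shows "(\<Sum>e<B * 4 ^ m. Suc (f m e)) \<le> (1 + 2 * B) * 4 ^ m"
proof -
  have "real (\<Sum>e<B * 4 ^ m. Suc (f m e)) \<le> (\<Sum>e<B * 4 ^ m. 4 ^ m * measure \<mu> {z. grid_index m z = e} + 2)"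
    unfolding of_nat_sum using f[of m] by (intro sum_mono) (simp add: algebra_simps)
  also have "\<dots> = 4 ^ m * (\<Sum>e<B * 4 ^ m. measure \<mu> {z. grid_index m z = e}) + 2 * (real B * 4 ^ m)"
    by (simp add: sum.distrib sum_distrib_left)
  also have "\<dots> \<le> 4 ^ m * 1 + 2 * (real B * 4 ^ m)"
    using prob_grid_sum_le_1[OF assms(1,2)] by (intro add_right_mono mult_left_mono) auto
  also have "\<dots> = real ((1 + 2 * B) * 4 ^ m)" by (simp add: algebra_simps)
  finally show ?thesis by (simp only: of_nat_le_iff)
qed

lemma measure_le_grid_sum:
  assumes "prob_space \<mu>" "sets \<mu> = sets borel" "grid_approximation A f \<mu>" "finite (grid_index m ` S)"
  shows "4 ^ m * measure \<mu> S \<le> (\<Sum>e\<in>grid_index m ` S. real (Suc (f m e)))"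
proof -
  interpret prob_space \<mu> by fact
  let ?E = "grid_index m ` S"
  have squares: "{z. grid_index m z = e} \<in> sets \<mu>" for e
    unfolding assms(2) by (rule grid_square_borel)
  have "measure \<mu> S \<le> measure \<mu> (\<Union>e\<in>?E. {z. grid_index m z = e})"
    by (rule finite_measure_mono[OF _ sets.finite_UN[OF assms(4) squares]]) auto
  also have "\<dots> \<le> (\<Sum>e\<in>?E. measure \<mu> {z. grid_index m z = e})"
    by (rule finite_measure_subadditive_finite[OF assms(4)]) (use squares in blast)
  finally have "4 ^ m * measure \<mu> S \<le> 4 ^ m * (\<Sum>e\<in>?E. measure \<mu> {z. grid_index m z = e})"
    by (rule mult_left_mono) simp
  also have "\<dots> = (\<Sum>e\<in>?E. 4 ^ m * measure \<mu> {z. grid_index m z = e})"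
    by (rule sum_distrib_left)
  also have "\<dots> \<le> (\<Sum>e\<in>?E. real (Suc (f m e)))"
    using grid_approximation_le[OF assms(3), of m] by (intro sum_mono) (simp add: add.commute)
  finally show ?thesis .
qed

text \<open>Upper bound for the complexity of a dual square by minus the logarithm of its two tube
  masses, in multiplicative form. The squares met by \<open>I\<close> and by \<open>J\<close> in the
  tube are pairwise separated, so \<open>weight\<close> dominates the product of the masses.\<close>

lemma KC_tube_le:
  fixes I J :: "(real ^ 2) set"
  assumes \<mu>: "prob_space \<mu>" "sets \<mu> = sets borel" "computable_measure A \<mu>"
    and \<nu>: "prob_space \<nu>" "sets \<nu> = sets borel" "computable_measure A \<nu>"
    and I [measurable]: "I \<in> sets borel" and J [measurable]: "J \<in> sets borel"
    and bounded: "\<And>z i. z \<in> I \<union> J \<Longrightarrow> \<bar>z $ i\<bar> \<le> real R"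
    and sep: "\<And>x y. x \<in> I \<Longrightarrow> y \<in> J \<Longrightarrow> 2 \<le> real S * \<bar>x $ 1 - y $ 1\<bar>"
  shows "\<exists>c>0. \<forall>m q. S \<le> 2 ^ m \<longrightarrow> q < grid_bound R * 4 ^ m \<longrightarrow>
      2 ^ KC A (prod_encode (m, q)) 0 * (measure \<mu> (I \<inter> tube C m q) * measure \<nu> (J \<inter> tube C m q)) \<le> c * (real m + 1) ^ 4"
proof -
  interpret \<mu>: prob_space \<mu> by fact
  interpret \<nu>: prob_space \<nu> by fact
  let ?B = "grid_bound R"
  obtain f where f: "grid_approximation A f \<mu>"
    using ex_grid_approximation[OF \<mu>(3)] ..
  obtain g where g: "grid_approximation A g \<nu>"
    using ex_grid_approximation[OF \<nu>(3)] ..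
  have "\<exists>c>0. \<forall>m q. q < ?B * 4 ^ m \<longrightarrow>
      2 ^ KC A (prod_encode (m, q)) 0 * real (weight f g C S ?B m q) \<le> c * (real m + 1) ^ 4 * 16 ^ m"
    by (rule KC_weight_le[OF grid_approximation_computable[OF f] grid_approximation_computable[OF g]
        approximation_sum_le[OF \<mu>(1,2) grid_approximation_ge[OF f]]
        approximation_sum_le[OF \<nu>(1,2) grid_approximation_ge[OF g]]])
  then obtain c where c: "0 < c \<and> (\<forall>m q. q < ?B * 4 ^ m \<longrightarrow>
      2 ^ KC A (prod_encode (m, q)) 0 * real (weight f g C S ?B m q) \<le> c * (real m + 1) ^ 4 * 16 ^ m)" ..
  have weight_ge: "16 ^ m * (measure \<mu> (I \<inter> tube C m q) * measure \<nu> (J \<inter> tube C m q)) \<le> real (weight f g C S ?B m q)"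
    if "S \<le> 2 ^ m" for m q
  proof -
    define E where "E = grid_index m ` (I \<inter> tube C m q)"
    define F where "F = grid_index m ` (J \<inter> tube C m q)"
    have sub: "E \<subseteq> {..<?B * 4 ^ m}" "F \<subseteq> {..<?B * 4 ^ m}"
      unfolding E_def F_def by (auto intro!: grid_index_less bounded)
    then have fin: "finite E" "finite F" by (auto intro: finite_subset)
    have 1: "4 ^ m * measure \<mu> (I \<inter> tube C m q) \<le> (\<Sum>e\<in>E. real (Suc (f m e)))"
      unfolding E_def by (rule measure_le_grid_sum[OF \<mu>(1,2) f fin(1)[unfolded E_def]])
    have 2: "4 ^ m * measure \<nu> (J \<inter> tube C m q) \<le> (\<Sum>e\<in>F. real (Suc (g m e)))"
      unfolding F_def by (rule measure_le_grid_sum[OF \<nu>(1,2) g fin(2)[unfolded F_def]])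
    have ok: "in_tube C m q e \<and> in_tube C m q e' \<and> separated S m e e'" if "e \<in> E" "e' \<in> F" for e e'
    proof -
      obtain x y where xy: "x \<in> I" "in_tube C m q e" "e = grid_index m x" "y \<in> J" "in_tube C m q e'" "e' = grid_index m y"
        using \<open>e \<in> E\<close> \<open>e' \<in> F\<close> by (auto simp: E_def F_def tube_def)
      have "\<bar>2 ^ m * x $ 1 - 2 ^ m * y $ 1\<bar> = 2 ^ m * \<bar>x $ 1 - y $ 1\<bar>"
        by (simp add: abs_mult flip: right_diff_distrib)
      moreover have "\<bar>2 ^ m * x $ 1 - 2 ^ m * y $ 1\<bar> \<le> \<bar>real_of_int (\<lfloor>2 ^ m * x $ 1\<rfloor> - \<lfloor>2 ^ m * y $ 1\<rfloor>)\<bar> + 1"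
        by linarith
      ultimately have *: "2 ^ m * \<bar>x $ 1 - y $ 1\<bar> - 1 \<le> real_of_int \<bar>coord1 e - coord1 e'\<bar>"
        unfolding xy(3,6) by simp
      \<comment> \<open>The 2 in the separation hypothesis leaves room for rounding: passing to
        corners costs at most 1 in the scaled distance, hence at most \<open>S \<le> 2 ^ m\<close>
        after multiplication by \<open>S\<close>.\<close>
      have "2 ^ m * 2 \<le> 2 ^ m * (real S * \<bar>x $ 1 - y $ 1\<bar>)" using sep[OF xy(1,4)] by (intro mult_left_mono) auto
      then have "2 ^ m * 2 - real S \<le> real S * (2 ^ m * \<bar>x $ 1 - y $ 1\<bar> - 1)"
        by (simp add: algebra_simps)
      also have "\<dots> \<le> real S * real_of_int \<bar>coord1 e - coord1 e'\<bar>" by (intro mult_left_mono *) simp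
      finally have "2 ^ m * 2 - real S \<le> real_of_int (int S * \<bar>coord1 e - coord1 e'\<bar>)" by simp
      moreover have "real S \<le> 2 ^ m" using \<open>S \<le> 2 ^ m\<close> by (metis of_nat_le_iff of_nat_numeral of_nat_power)
      ultimately have "2 ^ m \<le> real_of_int (int S * \<bar>coord1 e - coord1 e'\<bar>)" by linarith
      then have "real_of_int (2 ^ m) \<le> real_of_int (int S * \<bar>coord1 e - coord1 e'\<bar>)"
        by (simp only: of_int_power of_int_numeral)
      then show ?thesis using xy unfolding separated_def by (simp only: of_int_le_iff)
    qed
    have "16 ^ m * (measure \<mu> (I \<inter> tube C m q) * measure \<nu> (J \<inter> tube C m q)) =
        (4 ^ m * measure \<mu> (I \<inter> tube C m q)) * (4 ^ m * measure \<nu> (J \<inter> tube C m q))"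
      by (simp add: algebra_simps flip: power_mult_distrib)
    also have "\<dots> \<le> (\<Sum>e\<in>E. real (Suc (f m e))) * (\<Sum>e\<in>F. real (Suc (g m e)))"
      by (intro mult_mono 1 2) (auto intro!: sum_nonneg)
    also have "\<dots> = real (\<Sum>e\<in>E. \<Sum>e'\<in>F. Suc (f m e) * Suc (g m e'))"
      by (simp only: sum_product of_nat_sum of_nat_mult)
    also have "(\<Sum>e\<in>E. \<Sum>e'\<in>F. Suc (f m e) * Suc (g m e')) =
        (\<Sum>e\<in>E. \<Sum>e'\<in>F. of_bool (in_tube C m q e \<and> in_tube C m q e' \<and> separated S m e e') * (Suc (f m e) * Suc (g m e')))"
      using ok by (intro sum.cong) auto
    also have "\<dots> \<le> (\<Sum>e\<in>E. \<Sum>e'<?B * 4 ^ m. of_bool (in_tube C m q e \<and> in_tube C m q e' \<and> separated S m e e') * (Suc (f m e) * Suc (g m e')))"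
      using sub by (intro sum_mono sum_mono2) auto
    also have "\<dots> \<le> weight f g C S ?B m q"
      unfolding weight_def using sub by (intro sum_mono2) auto
    finally show ?thesis by simp
  qed
  show ?thesis
  proof (intro exI[of _ c] conjI allI impI conjunct1[OF c])
    fix m q assume S: "S \<le> 2 ^ m" and q: "q < ?B * 4 ^ m"
    let ?p = "measure \<mu> (I \<inter> tube C m q) * measure \<nu> (J \<inter> tube C m q)"
    have "16 ^ m * (2 ^ KC A (prod_encode (m, q)) 0 * ?p) = 2 ^ KC A (prod_encode (m, q)) 0 * (16 ^ m * ?p)"
      by (simp only: mult_ac)
    also have "\<dots> \<le> 2 ^ KC A (prod_encode (m, q)) 0 * real (weight f g C S ?B m q)"
      by (intro mult_left_mono weight_ge S) simp
    also have "\<dots> \<le> 16 ^ m * (c * (real m + 1) ^ 4)"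
      using conjunct2[OF c, rule_format, OF q] by (simp only: mult_ac)
    finally show "2 ^ KC A (prod_encode (m, q)) 0 * ?p \<le> c * (real m + 1) ^ 4"
      by (subst (asm) mult_le_cancel_left_pos) simp_all
  qed
qed

section \<open>Thin strips\<close>

definition slope :: "real ^ 2 \<Rightarrow> real ^ 2 \<Rightarrow> real" where
  "slope x y = (y $ 2 - x $ 2) / (y $ 1 - x $ 1)"

definition intercept :: "real ^ 2 \<Rightarrow> real ^ 2 \<Rightarrow> real" where
  "intercept x y = x $ 2 - slope x y * x $ 1"

definition strip :: "real \<Rightarrow> real \<Rightarrow> real \<Rightarrow> (real ^ 2) set" where
  "strip a b \<delta> = {z. \<bar>z $ 2 - a * z $ 1 - b\<bar> \<le> \<delta>}"

lemma measurable_slope [measurable]: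
  "(\<lambda>p. slope (fst p) (snd p)) \<in> borel_measurable (borel \<Otimes>\<^sub>M borel)"
  unfolding slope_def by measurable

lemma measurable_intercept [measurable]:
  "(\<lambda>p. intercept (fst p) (snd p)) \<in> borel_measurable (borel \<Otimes>\<^sub>M borel)"
  unfolding intercept_def by measurable

lemma strip_borel [measurable]: "strip a b \<delta> \<in> sets borel"
  unfolding strip_def by measurable

lemma strip_mono: "\<delta> \<le> \<delta>' \<Longrightarrow> strip a b \<delta> \<subseteq> strip a b \<delta>'"
  unfolding strip_def by auto

lemma slope_mult: "y $ 1 \<noteq> x $ 1 \<Longrightarrow> slope x y * (y $ 1 - x $ 1) = y $ 2 - x $ 2"
  by (simp add: slope_def)

lemma dist_vec2_le: "dist z z' \<le> \<bar>z $ 1 - z' $ 1\<bar> + \<bar>z $ 2 - z' $ 2\<bar>" for z z' :: "real ^ 2"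
  using norm_le_l1_cart[of "z - z'"] by (simp add: dist_norm sum_2)

text \<open>On the intersection the affine function \<open>(a - a') * u + (b - b')\<close> is at
  most \<open>2 * \<delta>\<close> in absolute value, which confines \<open>u\<close> to an interval
  of length \<open>O(\<delta> / \<theta>)\<close> once the slopes differ by a multiple of
  \<open>\<theta>\<close>. The bound on \<open>a\<close> then controls the second
  coordinate.\<close>

lemma dist_strip_inter:
  assumes z: "z \<in> strip a b \<delta>" "z \<in> strip a' b' \<delta>" and z': "z' \<in> strip a b \<delta>" "z' \<in> strip a' b' \<delta>"
    and R: "1 \<le> R" "\<bar>z $ 1\<bar> \<le> R" and a: "\<bar>a\<bar> \<le> L"
    and apart: "\<theta> \<le> \<bar>a - a'\<bar> \<or> \<theta> \<le> \<bar>b - b'\<bar>" and "0 < \<delta>" "4 * \<delta> < \<theta>" "\<theta> \<le> 1"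
  shows "dist z z' < (3 + 8 * R + 8 * L * R) * \<delta> / \<theta>"
proof -
  have "0 < \<theta>" using assms by linarith
  have diff: "\<bar>(a - a') * w $ 1 + (b - b')\<bar> \<le> 2 * \<delta>" if "w \<in> strip a b \<delta>" "w \<in> strip a' b' \<delta>" for w
  proof -
    have "(a - a') * w $ 1 + (b - b') = (w $ 2 - a' * w $ 1 - b') - (w $ 2 - a * w $ 1 - b)"
      by (simp add: algebra_simps)
    then show ?thesis using that unfolding strip_def by simp
  qed
  \<comment> \<open>If only the intercepts differed, the strips could not meet at the abscissa of
    \<open>z\<close>: with slopes this close and \<open>4 * \<delta> < \<theta>\<close>, they are
    still disjoint where \<open>\<bar>u\<bar> \<le> R\<close>.\<close>
  have aa': "\<theta> \<le> 2 * R * \<bar>a - a'\<bar>"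
  proof (rule ccontr)
    assume *: "\<not> ?thesis"
    have "\<bar>a - a'\<bar> \<le> 2 * R * \<bar>a - a'\<bar>" using R(1) mult_right_mono[of 1 "2 * R" "\<bar>a - a'\<bar>"] by simp
    then have "\<theta> \<le> \<bar>b - b'\<bar>" using apart * by linarith
    moreover have "\<bar>(a - a') * z $ 1\<bar> \<le> \<bar>a - a'\<bar> * R"
      using R(2) by (simp add: abs_mult mult_left_mono)
    moreover have "\<bar>b - b'\<bar> \<le> \<bar>(a - a') * z $ 1\<bar> + 2 * \<delta>" using diff[OF z] by linarith
    ultimately show False using * \<open>4 * \<delta> < \<theta>\<close> by (simp add: algebra_simps)
  qed
  have "(a - a') * (z $ 1 - z' $ 1) = ((a - a') * z $ 1 + (b - b')) - ((a - a') * z' $ 1 + (b - b'))"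
    by (simp add: algebra_simps)
  then have *: "\<bar>(a - a') * (z $ 1 - z' $ 1)\<bar> \<le> 4 * \<delta>" using diff[OF z] diff[OF z'] by linarith
  have "\<theta> * \<bar>z $ 1 - z' $ 1\<bar> \<le> (2 * R * \<bar>a - a'\<bar>) * \<bar>z $ 1 - z' $ 1\<bar>"
    by (intro mult_right_mono aa') simp
  also have "\<dots> = 2 * R * \<bar>(a - a') * (z $ 1 - z' $ 1)\<bar>" by (simp add: abs_mult)
  also have "\<dots> \<le> 2 * R * (4 * \<delta>)" using R(1) by (intro mult_left_mono *) auto
  finally have 1: "\<bar>z $ 1 - z' $ 1\<bar> \<le> 8 * R * \<delta> / \<theta>" using \<open>0 < \<theta>\<close> by (simp add: field_simps)
  have "\<bar>z $ 2 - z' $ 2\<bar> \<le> 2 * \<delta> + \<bar>a * (z $ 1 - z' $ 1)\<bar>"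
    using z(1) z'(1) unfolding strip_def by (simp add: right_diff_distrib)
  also have "\<bar>a * (z $ 1 - z' $ 1)\<bar> \<le> L * (8 * R * \<delta> / \<theta>)"
    unfolding abs_mult using a 1 by (intro mult_mono) auto
  finally have 2: "\<bar>z $ 2 - z' $ 2\<bar> \<le> 2 * \<delta> + L * (8 * R * \<delta> / \<theta>)" by simp
  have "\<delta> \<le> \<delta> / \<theta>" using \<open>0 < \<theta>\<close> \<open>\<theta> \<le> 1\<close> \<open>0 < \<delta>\<close> by (simp add: field_simps)
  then have "dist z z' \<le> 8 * R * \<delta> / \<theta> + 2 * (\<delta> / \<theta>) + L * (8 * R * \<delta> / \<theta>)"
    using dist_vec2_le[of z z'] 1 2 by linarith
  also have "\<dots> < (3 + 8 * R + 8 * L * R) * \<delta> / \<theta>"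
    using \<open>0 < \<theta>\<close> \<open>0 < \<delta>\<close> by (simp add: field_simps)
  finally show ?thesis .
qed

lemma (in finite_measure) bonferroni_lower:
  assumes "finite F" "\<And>i. i \<in> F \<Longrightarrow> A i \<in> sets M" "\<And>i. i \<in> F \<Longrightarrow> h \<le> measure M (A i)"
    "\<And>i j. i \<in> F \<Longrightarrow> j \<in> F \<Longrightarrow> i \<noteq> j \<Longrightarrow> measure M (A i \<inter> A j) \<le> \<epsilon>" "0 \<le> \<epsilon>"
  shows "real (card F) * h - real (card F) ^ 2 * \<epsilon> \<le> measure M (\<Union>i\<in>F. A i)"
  using assms
proof (induction F)
  case (insert k F)
  let ?U = "\<Union>i\<in>F. A i" and ?n = "real (card F)"
  have [measurable]: "?U \<in> sets M" "A k \<in> sets M" using insert by auto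
  have "measure M (A k \<inter> ?U) \<le> (\<Sum>i\<in>F. measure M (A k \<inter> A i))"
    unfolding Int_UN_distrib using insert by (intro finite_measure_subadditive_finite) auto
  also have "\<dots> \<le> (\<Sum>i\<in>F. \<epsilon>)" using insert by (intro sum_mono) auto
  finally have "measure M (A k \<inter> ?U) \<le> ?n * \<epsilon>" by simp
  moreover have "measure M (A k \<union> ?U) = measure M (A k) + measure M ?U - measure M (A k \<inter> ?U)"
    using measure_Un3[of "A k" M ?U] fmeasurable_eq_sets by simp
  moreover have "?n * h - ?n ^ 2 * \<epsilon> \<le> measure M ?U" using insert by auto
  moreover have "h \<le> measure M (A k)" using insert by auto
  moreover have "(?n + 1) * h - (?n + 1) ^ 2 * \<epsilon> \<le> ?n * h - ?n ^ 2 * \<epsilon> + h - ?n * \<epsilon>"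
  proof -
    have "0 \<le> ?n * \<epsilon>" using \<open>0 \<le> \<epsilon>\<close> by simp
    then show ?thesis using \<open>0 \<le> \<epsilon>\<close> by (simp add: power2_eq_square algebra_simps)
  qed
  ultimately show ?case using insert(1,2) by (simp add: add.commute)
qed simp

text \<open>Otherwise there are \<open>n\<close> of the sets with
  \<open>2 \<le> n * h \<le> 3\<close>, and by Bonferroni their union has measure at least
  \<open>2 - 9 / 10\<close>, which exceeds 1.\<close>

lemma (in prob_space) card_almost_disjoint_le:
  assumes "finite F" "\<And>i. i \<in> F \<Longrightarrow> A i \<in> sets M" "\<And>i. i \<in> F \<Longrightarrow> h \<le> measure M (A i)"
    "\<And>i j. i \<in> F \<Longrightarrow> j \<in> F \<Longrightarrow> i \<noteq> j \<Longrightarrow> measure M (A i \<inter> A j) \<le> h ^ 2 / 10" "0 < h" "h \<le> 1"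
  shows "real (card F) \<le> 3 / h"
proof (rule ccontr)
  assume less: "\<not> ?thesis"
  define n where "n = nat \<lceil>2 / h\<rceil>"
  have n: "2 / h \<le> real n" "real n \<le> 2 / h + 1"
    using \<open>0 < h\<close> unfolding n_def by (auto simp: of_nat_ceiling)
  have "1 \<le> 1 / h" using \<open>0 < h\<close> \<open>h \<le> 1\<close> by simp
  then have n3: "real n \<le> 3 / h" using n(2) by (simp add: add_divide_distrib[symmetric] field_simps)
  then have "n \<le> card F" using less by linarith
  then obtain G where G: "G \<subseteq> F" "card G = n" "finite G"
    by (meson obtain_subset_with_card_n)
  have "real n * h - real n ^ 2 * (h ^ 2 / 10) \<le> measure M (\<Union>i\<in>G. A i)"
    unfolding G(2)[symmetric] by (rule bonferroni_lower) (use G(1,3) assms(2-4) in \<open>blast+, simp\<close>)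
  also have "\<dots> \<le> 1" by simp
  finally have "real n * h \<le> 1 + (real n * h) ^ 2 / 10" by (simp add: power_mult_distrib)
  moreover have "2 \<le> real n * h" "real n * h \<le> 3" using n(1) n3 \<open>0 < h\<close> by (simp_all add: field_simps)
  then have "(real n * h) ^ 2 \<le> 3 ^ 2" by (intro power_mono) auto
  ultimately show False using \<open>2 \<le> real n * h\<close> by simp
qed

text \<open>A separated subset of greatest cardinality exists by the bound \<open>N\<close>, and a
  point not close to any of its members could be added.\<close>

lemma maximal_separated_family:
  fixes H :: "(real \<times> real) set"
  assumes "\<And>F. finite F \<Longrightarrow> F \<subseteq> H \<Longrightarrow>
      (\<And>p q. p \<in> F \<Longrightarrow> q \<in> F \<Longrightarrow> p \<noteq> q \<Longrightarrow> \<theta> \<le> \<bar>fst p - fst q\<bar> \<or> \<theta> \<le> \<bar>snd p - snd q\<bar>) \<Longrightarrow>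
      real (card F) \<le> N"
    and "0 < \<theta>"
  obtains F where "finite F" "F \<subseteq> H" "real (card F) \<le> N"
    "\<And>p. p \<in> H \<Longrightarrow> \<exists>q\<in>F. \<bar>fst p - fst q\<bar> < \<theta> \<and> \<bar>snd p - snd q\<bar> < \<theta>"
proof -
  define P where "P F \<longleftrightarrow> finite F \<and> F \<subseteq> H \<and>
    (\<forall>p\<in>F. \<forall>q\<in>F. p \<noteq> q \<longrightarrow> \<theta> \<le> \<bar>fst p - fst q\<bar> \<or> \<theta> \<le> \<bar>snd p - snd q\<bar>)" for F
  have bound: "real (card F) \<le> N" if "P F" for F
    using that assms(1)[of F] unfolding P_def by blast
  have "P {}" by (simp add: P_def)
  moreover have "\<forall>F. P F \<longrightarrow> card F \<le> nat \<lceil>N\<rceil>"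
  proof (intro allI impI)
    fix F assume "P F"
    then have "real (card F) \<le> real (nat \<lceil>N\<rceil>)"
      using bound real_nat_ceiling_ge[of N] by (meson order.trans)
    then show "card F \<le> nat \<lceil>N\<rceil>" by simp
  qed
  ultimately obtain F where F: "P F" "\<And>G. P G \<Longrightarrow> card G \<le> card F"
    using ex_has_greatest_nat[of P "{}" card "Suc (nat \<lceil>N\<rceil>)"] by (auto simp: less_Suc_eq_le)
  show thesis
  proof (rule that)
    show "finite F" "F \<subseteq> H" "real (card F) \<le> N" using F(1) bound by (auto simp: P_def)
    fix p assume "p \<in> H"
    show "\<exists>q\<in>F. \<bar>fst p - fst q\<bar> < \<theta> \<and> \<bar>snd p - snd q\<bar> < \<theta>"
    proof (rule ccontr)
      assume no: "\<not> ?thesis"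
      then have "p \<notin> F" using \<open>0 < \<theta>\<close> by auto
      have "\<theta> \<le> \<bar>fst p - fst q\<bar> \<or> \<theta> \<le> \<bar>snd p - snd q\<bar>" if "q \<in> F" for q
        using no that by (meson not_le)
      then have "P (insert p F)"
        using F(1) \<open>p \<in> H\<close> unfolding P_def by (auto simp: abs_minus_commute)
      from F(2)[OF this] show False using F(1) \<open>p \<notin> F\<close> by (simp add: P_def)
    qed
  qed
qed

text \<open>The diameter bound is strict so that an open ball around any point of \<open>S\<close>
  contains \<open>S\<close>.\<close>

lemma frostman_measure_le:
  fixes \<nu> :: "(real ^ 2) measure" and cF s r :: real
  assumes "finite_measure \<nu>" "sets \<nu> = sets borel"
    and frost: "\<And>x r. 0 < r \<Longrightarrow> measure \<nu> (ball x r) \<le> cF * r powr s"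
    and "0 < r" "0 \<le> cF" "\<And>z z'. z \<in> S \<Longrightarrow> z' \<in> S \<Longrightarrow> dist z z' < r"
  shows "measure \<nu> S \<le> cF * r powr s"
proof (cases "S = {}")
  case False
  interpret finite_measure \<nu> by fact
  obtain z where "z \<in> S" using False by blast
  then have "S \<subseteq> ball z r" using assms(6) by auto
  then have "measure \<nu> S \<le> measure \<nu> (ball z r)"
    by (rule finite_measure_mono) (simp add: assms(2))
  also have "\<dots> \<le> cF * r powr s" using \<open>0 < r\<close> by (rule frost)
  finally show ?thesis .
qed (use \<open>0 \<le> cF\<close> in simp)

text \<open>One parameter \<open>R\<close> bounds the sets and the inverse of the separation, and
  both measures share the exponent and the constant. Separation of the first coordinates gives
  bounded slopes.\<close>

locale separated_frostman =
  fixes \<mu> \<nu> :: "(real ^ 2) measure" and I J :: "(real ^ 2) set" and s cF R :: real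
  assumes prob_\<mu>: "prob_space \<mu>" and sets_\<mu>: "sets \<mu> = sets borel"
    and prob_\<nu>: "prob_space \<nu>" and sets_\<nu>: "sets \<nu> = sets borel"
    and I_borel: "I \<in> sets borel" and J_borel: "J \<in> sets borel"
    and R: "1 \<le> R" and cF: "0 < cF" and s: "0 < s"
    and bounded: "\<And>z i. z \<in> I \<union> J \<Longrightarrow> \<bar>z $ i\<bar> \<le> R"
    and apart: "\<And>x y. x \<in> I \<Longrightarrow> y \<in> J \<Longrightarrow> 1 \<le> R * \<bar>x $ 1 - y $ 1\<bar>"
    and frost_\<mu>: "\<And>x r. 0 < r \<Longrightarrow> measure \<mu> (ball x r) \<le> cF * r powr s"
    and frost_\<nu>: "\<And>x r. 0 < r \<Longrightarrow> measure \<nu> (ball x r) \<le> cF * r powr s"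
begin

sublocale \<mu>: prob_space \<mu> by (rule prob_\<mu>)
sublocale \<nu>: prob_space \<nu> by (rule prob_\<nu>)
sublocale pair_prob_space \<mu> \<nu> ..

declare sets_\<mu> [measurable_cong] sets_\<nu> [measurable_cong]
declare I_borel [measurable] J_borel [measurable]

text \<open>Only \<open>\<nu>\<close> enters: its decay with the width yields the positive dimension
  of the line relative to \<open>x\<close>.\<close>

definition line_measure :: "real \<Rightarrow> real ^ 2 \<Rightarrow> real ^ 2 \<Rightarrow> real" where
  "line_measure \<delta> x y = measure \<nu> (J \<inter> strip (slope x y) (intercept x y) \<delta>)"

text \<open>The constant of \<open>dist_strip_inter\<close> for slopes up to
  \<open>3 * R ^ 3\<close>.\<close>

definition C :: real where "C = 3 + 8 * R + 8 * (3 * R ^ 3) * R"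

lemma C_ge_1: "1 \<le> C"
  using R by (simp add: C_def add_increasing2)

lemma coord_neq: "x \<in> I \<Longrightarrow> y \<in> J \<Longrightarrow> x $ 1 \<noteq> y $ 1"
  using apart by fastforce

lemma slope_le:
  assumes "x \<in> I" "y \<in> J"
  shows "\<bar>slope x y\<bar> \<le> 2 * R\<^sup>2" "\<bar>slope x y\<bar> \<le> 3 * R ^ 3" "\<bar>intercept x y\<bar> \<le> 3 * R ^ 3"
proof -
  have ne: "0 < \<bar>y $ 1 - x $ 1\<bar>" using coord_neq[OF assms] by simp
  have "\<bar>slope x y\<bar> * \<bar>y $ 1 - x $ 1\<bar> = \<bar>y $ 2 - x $ 2\<bar>"
    using slope_mult[of y x] coord_neq[OF assms] by (simp flip: abs_mult)
  also have "\<dots> \<le> 2 * R" using bounded[of x 2] bounded[of y 2] assms by auto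
  also have "\<dots> \<le> 2 * R * (R * \<bar>y $ 1 - x $ 1\<bar>)"
    using mult_left_mono[OF apart[OF assms], of "2 * R"] R by (simp add: abs_minus_commute)
  finally have "\<bar>slope x y\<bar> * \<bar>y $ 1 - x $ 1\<bar> \<le> (2 * R\<^sup>2) * \<bar>y $ 1 - x $ 1\<bar>"
    by (simp add: power2_eq_square mult_ac)
  then show 1: "\<bar>slope x y\<bar> \<le> 2 * R\<^sup>2" using ne by simp
  have R3: "R\<^sup>2 \<le> R ^ 3" "R \<le> R ^ 3" using R by (auto intro: power_increasing self_le_power)
  then show "\<bar>slope x y\<bar> \<le> 3 * R ^ 3" using 1 by (smt (verit) R one_le_power)
  have "\<bar>intercept x y\<bar> \<le> \<bar>x $ 2\<bar> + \<bar>slope x y\<bar> * \<bar>x $ 1\<bar>"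
    unfolding intercept_def by (simp flip: abs_mult)
  also have "\<dots> \<le> R + 2 * R\<^sup>2 * R"
    using 1 bounded[of x] assms by (intro add_mono mult_mono) auto
  also have "\<dots> \<le> 3 * R ^ 3" using R3 by (simp add: power2_eq_square power3_eq_cube)
  finally show "\<bar>intercept x y\<bar> \<le> 3 * R ^ 3" .
qed

lemma line_measure_le_1: "line_measure \<delta> x y \<le> 1"
  unfolding line_measure_def by simp

lemma line_measure_mono: "\<delta> \<le> \<delta>' \<Longrightarrow> line_measure \<delta> x y \<le> line_measure \<delta>' x y"
  unfolding line_measure_def by (intro \<nu>.finite_measure_mono) (use strip_mono in \<open>blast, measurable\<close>)

lemma measurable_line_measure [measurable]:
  "(\<lambda>p. line_measure \<delta> (fst p) (snd p)) \<in> borel_measurable (\<mu> \<Otimes>\<^sub>M \<nu>)"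
proof -
  define Q where "Q = {q \<in> space ((\<mu> \<Otimes>\<^sub>M \<nu>) \<Otimes>\<^sub>M \<nu>). snd q \<in> J \<and>
    \<bar>snd q $ 2 - slope (fst (fst q)) (snd (fst q)) * snd q $ 1 - intercept (fst (fst q)) (snd (fst q))\<bar> \<le> \<delta>}"
  have "Q \<in> sets ((\<mu> \<Otimes>\<^sub>M \<nu>) \<Otimes>\<^sub>M \<nu>)"
    unfolding Q_def slope_def intercept_def by measurable
  then have "(\<lambda>p. emeasure \<nu> (Pair p -` Q)) \<in> borel_measurable (\<mu> \<Otimes>\<^sub>M \<nu>)"
    by (rule \<nu>.measurable_emeasure_Pair)
  then have "(\<lambda>p. measure \<nu> (Pair p -` Q)) \<in> borel_measurable (\<mu> \<Otimes>\<^sub>M \<nu>)"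
    unfolding measure_def by measurable
  moreover have "Pair p -` Q = J \<inter> strip (slope (fst p) (snd p)) (intercept (fst p) (snd p)) \<delta>" for p
    using sets_eq_imp_space_eq[OF sets_\<mu>] sets_eq_imp_space_eq[OF sets_\<nu>]
    by (auto simp: Q_def strip_def space_pair_measure)
  ultimately show ?thesis unfolding line_measure_def by simp
qed

text \<open>Two strips of width \<open>\<tau>\<^sup>3\<close> at distance \<open>\<tau>\<^sup>2\<close> meet in a set of diameter \<open>O(\<tau>)\<close>, so there are few
  heavy ones up to distance \<open>\<tau>\<^sup>2\<close>. Strips of width \<open>\<tau>\<^sup>2\<close> whose slopes differ by \<open>\<tau>\<close> again meet in a
  set of diameter \<open>O(\<tau>)\<close>. So only few points lie on two heavy lines of really different slopes.\<close>

lemma heavy_slopes_close: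
  assumes \<tau>: "0 < \<tau>" "\<tau> \<le> 1 / 4" "8 * R * \<tau> < 1" "8 * (1 + R) * \<tau> < 1"
    "cF * (2 * R * C) powr s * \<tau> powr (s / 2) \<le> 1 / 10"
  obtains E where "E \<in> sets borel" "measure \<mu> E \<le> 9 * cF * (2 * (1 + R) * C) powr s * \<tau> powr (s / 2)"
    "\<And>x y y'. x \<in> I - E \<Longrightarrow> y \<in> J \<Longrightarrow> y' \<in> J \<Longrightarrow> \<tau> powr (s / 4) < line_measure (2 * R * \<tau> ^ 3) x y \<Longrightarrow>
      \<tau> powr (s / 4) < line_measure (2 * R * \<tau> ^ 3) x y' \<Longrightarrow> \<bar>slope x y - slope x y'\<bar> < \<tau>"
proof -
  let ?h = "\<tau> powr (s / 4)" and ?\<delta> = "2 * R * \<tau> ^ 3"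
  define H where "H = {(slope x y, intercept x y) | x y. x \<in> I \<and> y \<in> J \<and> ?h < line_measure ?\<delta> x y}"
  define A where "A p = J \<inter> strip (fst p) (snd p) ?\<delta>" for p
  have h: "0 < ?h" "?h \<le> 1" using \<tau> s by (auto intro: powr_le1)
  have h2: "?h ^ 2 = \<tau> powr (s / 2)" using \<tau> by (simp add: power2_eq_square flip: powr_add)
  have H_le: "\<bar>fst p\<bar> \<le> 3 * R ^ 3" if "p \<in> H" for p
    using that slope_le unfolding H_def by auto
  have A_heavy: "?h \<le> measure \<nu> (A p)" if "p \<in> H" for p
    using that unfolding H_def A_def line_measure_def by auto
  have powr2: "\<tau> powr s = \<tau> powr (s / 2) * \<tau> powr (s / 2)" using \<tau> by (simp flip: powr_add)
  \<comment> \<open>Intersections have diameter below \<open>2 * R * C * \<tau>\<close>, hence mass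
    \<open>O(\<tau> powr s)\<close>. The exponent of \<open>?h\<close> is \<open>s / 4\<close>, so
    this beats \<open>?h ^ 2 / 10\<close> by a factor \<open>\<tau> powr (s / 2)\<close>.\<close>
  have few: "real (card F) \<le> 3 / ?h" if F: "finite F" "F \<subseteq> H"
    and sep: "\<And>p q. p \<in> F \<Longrightarrow> q \<in> F \<Longrightarrow> p \<noteq> q \<Longrightarrow> \<tau>\<^sup>2 \<le> \<bar>fst p - fst q\<bar> \<or> \<tau>\<^sup>2 \<le> \<bar>snd p - snd q\<bar>" for F
  proof (rule \<nu>.card_almost_disjoint_le[OF F(1), of A])
    show "A p \<in> sets \<nu>" for p unfolding A_def by measurable
    fix p q assume pq: "p \<in> F" "q \<in> F" "p \<noteq> q"
    have dist: "dist z z' < C * ?\<delta> / \<tau>\<^sup>2" if "z \<in> A p \<inter> A q" "z' \<in> A p \<inter> A q" for z z'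
      unfolding C_def
    proof (rule dist_strip_inter)
      show "z \<in> strip (fst p) (snd p) ?\<delta>" "z \<in> strip (fst q) (snd q) ?\<delta>"
        "z' \<in> strip (fst p) (snd p) ?\<delta>" "z' \<in> strip (fst q) (snd q) ?\<delta>" "\<bar>z $ 1\<bar> \<le> R"
        using \<open>z \<in> A p \<inter> A q\<close> \<open>z' \<in> A p \<inter> A q\<close> bounded by (auto simp: A_def)
      have "4 * ?\<delta> = (8 * R * \<tau>) * \<tau>\<^sup>2" by (simp add: power2_eq_square power3_eq_cube)
      also have "\<dots> < 1 * \<tau>\<^sup>2" using \<tau> by (intro mult_strict_right_mono) auto
      finally show "4 * ?\<delta> < \<tau>\<^sup>2" by simp
      show "\<tau>\<^sup>2 \<le> 1" using \<tau> by (intro power_le_one) auto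
      show "\<bar>fst p\<bar> \<le> 3 * R ^ 3" using pq F(2) H_le by blast
    qed (use R \<tau> sep[OF pq] in auto)
    have "C * ?\<delta> / \<tau>\<^sup>2 = (2 * R * C) * \<tau>" using \<tau> by (simp add: power2_eq_square power3_eq_cube)
    with dist have "dist z z' < (2 * R * C) * \<tau>" if "z \<in> A p \<inter> A q" "z' \<in> A p \<inter> A q" for z z'
      using that by metis
    then have "measure \<nu> (A p \<inter> A q) \<le> cF * ((2 * R * C) * \<tau>) powr s"
      using R C_ge_1 cF \<tau> by (intro frostman_measure_le[OF \<nu>.finite_measure_axioms sets_\<nu> frost_\<nu>]) auto
    also have "\<dots> = (cF * (2 * R * C) powr s * \<tau> powr (s / 2)) * \<tau> powr (s / 2)"
      using R C_ge_1 \<tau> by (simp add: powr_mult powr2)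
    also have "\<dots> \<le> 1 / 10 * \<tau> powr (s / 2)" by (intro mult_right_mono \<tau>) simp
    finally show "measure \<nu> (A p \<inter> A q) \<le> ?h ^ 2 / 10" unfolding h2 by simp
  qed (use A_heavy F(2) h in auto)
  obtain F where F: "finite F" "F \<subseteq> H" "real (card F) \<le> 3 / ?h"
    "\<And>p. p \<in> H \<Longrightarrow> \<exists>q\<in>F. \<bar>fst p - fst q\<bar> < \<tau>\<^sup>2 \<and> \<bar>snd p - snd q\<bar> < \<tau>\<^sup>2"
    by (rule maximal_separated_family[of H "\<tau>\<^sup>2" "3 / ?h", OF few]) (use \<tau> in auto)
  \<comment> \<open>Replacing slope and intercept by those of a representative within
    \<open>\<tau>^2\<close> moves the line by at most \<open>?w\<close> where
    \<open>\<bar>u\<bar> \<le> R\<close>. Two replacements change a difference of slopes by at most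
    \<open>2 * \<tau>^2 \<le> \<tau> / 2\<close>, so slopes \<open>\<tau>\<close> apart stay
    \<open>\<tau> / 2\<close> apart.\<close>
  let ?w = "(1 + R) * \<tau>\<^sup>2"
  define D where "D pq = (if \<tau> / 2 \<le> \<bar>fst (fst pq) - fst (snd pq)\<bar>
    then {x. \<bar>x $ 1\<bar> \<le> R} \<inter> strip (fst (fst pq)) (snd (fst pq)) ?w \<inter> strip (fst (snd pq)) (snd (snd pq)) ?w else {})"
    for pq
  define E where "E = (\<Union>pq\<in>F \<times> F. D pq)"
  have D_borel: "D pq \<in> sets borel" for pq
  proof -
    have "{x :: real ^ 2. \<bar>x $ 1\<bar> \<le> R} \<in> sets borel" by measurable
    then show ?thesis unfolding D_def by auto
  qed
  show thesis
  proof (rule that)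
    show "E \<in> sets borel" unfolding E_def using F(1) D_borel by (intro sets.finite_UN) auto
    have D_small: "measure \<mu> (D pq) \<le> cF * (2 * (1 + R) * C) powr s * \<tau> powr s" if "pq \<in> F \<times> F" for pq
    proof (cases "\<tau> / 2 \<le> \<bar>fst (fst pq) - fst (snd pq)\<bar>")
      case True
      have dist: "dist z z' < C * ?w / (\<tau> / 2)" if "z \<in> D pq" "z' \<in> D pq" for z z'
        unfolding C_def
      proof (rule dist_strip_inter)
        show "z \<in> strip (fst (fst pq)) (snd (fst pq)) ?w" "z \<in> strip (fst (snd pq)) (snd (snd pq)) ?w"
          "z' \<in> strip (fst (fst pq)) (snd (fst pq)) ?w" "z' \<in> strip (fst (snd pq)) (snd (snd pq)) ?w" "\<bar>z $ 1\<bar> \<le> R"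
          using that True by (auto simp: D_def)
        have "4 * ?w = (8 * (1 + R) * \<tau>) * (\<tau> / 2)" by (simp add: power2_eq_square)
        also have "\<dots> < 1 * (\<tau> / 2)" using \<tau> by (intro mult_strict_right_mono) auto
        finally show "4 * ?w < \<tau> / 2" by simp
        show "\<bar>fst (fst pq)\<bar> \<le> 3 * R ^ 3" using \<open>pq \<in> F \<times> F\<close> F(2) H_le by auto
      qed (use R \<tau> True in auto)
      have "C * ?w / (\<tau> / 2) = (2 * (1 + R) * C) * \<tau>" using \<tau> by (simp add: power2_eq_square)
      with dist have "dist z z' < (2 * (1 + R) * C) * \<tau>" if "z \<in> D pq" "z' \<in> D pq" for z z'
        using that by metis
      then have "measure \<mu> (D pq) \<le> cF * ((2 * (1 + R) * C) * \<tau>) powr s"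
        using R C_ge_1 cF \<tau> by (intro frostman_measure_le[OF \<mu>.finite_measure_axioms sets_\<mu> frost_\<mu>]) auto
      also have "\<dots> = cF * (2 * (1 + R) * C) powr s * \<tau> powr s"
        using R C_ge_1 \<tau> by (simp add: powr_mult)
      finally show ?thesis .
    qed (use cF in \<open>simp add: D_def\<close>)
    \<comment> \<open>At most \<open>9 * \<tau> powr - (s / 2)\<close> pairs of representatives,
      each with an intersection of mass \<open>O(\<tau> powr s)\<close>.\<close>
    have "measure \<mu> E \<le> (\<Sum>pq\<in>F \<times> F. measure \<mu> (D pq))"
      unfolding E_def using F(1) D_borel sets_\<mu> by (intro \<mu>.finite_measure_subadditive_finite) auto
    also have "\<dots> \<le> real (card F) * real (card F) * (cF * (2 * (1 + R) * C) powr s * \<tau> powr s)"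
      using sum_bounded_above[of "F \<times> F" "\<lambda>pq. measure \<mu> (D pq)", OF D_small] by (simp add: card_cartesian_product)
    also have "\<dots> \<le> (3 / ?h) * (3 / ?h) * (cF * (2 * (1 + R) * C) powr s * \<tau> powr s)"
      using F(3) cF h by (intro mult_right_mono mult_mono) auto
    also have "\<dots> = 9 * cF * (2 * (1 + R) * C) powr s * (\<tau> powr s / (?h ^ 2))"
      by (simp add: power2_eq_square)
    also have "\<tau> powr s / (?h ^ 2) = \<tau> powr (s / 2)" unfolding h2 using powr2 \<tau> by simp
    finally show "measure \<mu> E \<le> 9 * cF * (2 * (1 + R) * C) powr s * \<tau> powr (s / 2)" .
    fix x y y' assume x: "x \<in> I - E" and y: "y \<in> J" "?h < line_measure ?\<delta> x y" and y': "y' \<in> J" "?h < line_measure ?\<delta> x y'"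
    show "\<bar>slope x y - slope x y'\<bar> < \<tau>"
    proof (rule ccontr)
      assume far: "\<not> ?thesis"
      have near: "\<exists>q\<in>F. \<bar>slope x v - fst q\<bar> < \<tau>\<^sup>2 \<and> x \<in> strip (fst q) (snd q) ?w"
        if v: "v \<in> J" "?h < line_measure ?\<delta> x v" for v
      proof -
        have "(slope x v, intercept x v) \<in> H" using x v unfolding H_def by blast
        from F(4)[OF this] obtain q where q: "q \<in> F" "\<bar>slope x v - fst q\<bar> < \<tau>\<^sup>2" "\<bar>intercept x v - snd q\<bar> < \<tau>\<^sup>2"
          by auto
        have "x $ 2 - fst q * x $ 1 - snd q = (slope x v - fst q) * x $ 1 + (intercept x v - snd q)"
          by (simp add: intercept_def algebra_simps)
        moreover have "\<bar>(slope x v - fst q) * x $ 1\<bar> \<le> \<tau>\<^sup>2 * R"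
          unfolding abs_mult using q(2) bounded[of x 1] x by (intro mult_mono) auto
        ultimately have "x \<in> strip (fst q) (snd q) ?w"
          using q(3) unfolding strip_def by (simp add: algebra_simps)
        then show ?thesis using q by blast
      qed
      obtain p where p: "p \<in> F" "\<bar>slope x y - fst p\<bar> < \<tau>\<^sup>2" "x \<in> strip (fst p) (snd p) ?w"
        using near[OF y] by blast
      obtain q where q: "q \<in> F" "\<bar>slope x y' - fst q\<bar> < \<tau>\<^sup>2" "x \<in> strip (fst q) (snd q) ?w"
        using near[OF y'] by blast
      have "\<tau>\<^sup>2 \<le> \<tau> / 4" using \<tau> mult_right_mono[of \<tau> "1 / 4" \<tau>] by (simp add: power2_eq_square)
      then have "\<tau> / 2 \<le> \<bar>fst p - fst q\<bar>" using p(2) q(2) far by linarith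
      then have "x \<in> D (p, q)" using p q x bounded[of x 1] by (auto simp: D_def)
      then show False using p(1) q(1) x unfolding E_def by blast
    qed
  qed
qed


text \<open>The factor \<open>2 * R\<close> converts slopes into heights: turning a line about
  \<open>x\<close> by a change \<open>\<delta>\<close> of slope moves it by at most
  \<open>2 * R * \<delta>\<close> over the points of \<open>J\<close>.\<close>

definition bad :: "real \<Rightarrow> real \<Rightarrow> ((real ^ 2) \<times> (real ^ 2)) set" where
  "bad \<delta> h = {p \<in> space (\<mu> \<Otimes>\<^sub>M \<nu>). fst p \<in> I \<and> snd p \<in> J \<and> h < line_measure (2 * R * \<delta>) (fst p) (snd p)}"

lemma bad_measurable [measurable]: "bad \<delta> h \<in> sets (\<mu> \<Otimes>\<^sub>M \<nu>)"
  unfolding bad_def by measurable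

definition C' :: real where "C' = 9 * cF * (2 * (1 + R) * C) powr s"

lemma C'_nonneg: "0 \<le> C'"
  using cF by (simp add: C'_def)

definition small :: "real \<Rightarrow> bool" where
  "small \<tau> \<longleftrightarrow> 0 < \<tau> \<and> \<tau> \<le> 1 / 4 \<and> 8 * R * \<tau> < 1 \<and> 8 * (1 + R) * \<tau> < 1 \<and>
    cF * (2 * R * C) powr s * \<tau> powr (s / 2) \<le> 1 / 10"

lemma small_mono:
  assumes "small \<tau>'" "0 < \<tau>" "\<tau> \<le> \<tau>'"
  shows "small \<tau>"
proof -
  have "8 * R * \<tau> \<le> 8 * R * \<tau>'" "8 * (1 + R) * \<tau> \<le> 8 * (1 + R) * \<tau>'"
    "cF * (2 * R * C) powr s * \<tau> powr (s / 2) \<le> cF * (2 * R * C) powr s * \<tau>' powr (s / 2)"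
    using assms R cF s by (auto intro!: mult_left_mono powr_mono2)
  then show ?thesis using assms unfolding small_def by linarith
qed

text \<open>Fix \<open>x\<close> outside the exceptional set \<open>E\<close> and one
  \<open>y\<close> in its section. All other points of the section see \<open>x\<close> under nearly
  the same slope, so they lie in the strip of half-width \<open>2 * R * \<tau>\<close> belonging to
  \<open>y\<close>. Its mass is at most \<open>a\<close>, as \<open>(x, y)\<close> is not bad at
  scale \<open>\<tau>\<close>. The second summand bounds the mass of \<open>E\<close>.\<close>

lemma bad_step:
  assumes \<tau>: "small \<tau>" and a: "0 \<le> a"
  shows "P.prob (bad (\<tau> ^ 3) (\<tau> powr (s / 4)) - bad \<tau> a) \<le> a + C' * \<tau> powr (s / 2)"
proof -
  let ?B = "bad (\<tau> ^ 3) (\<tau> powr (s / 4)) - bad \<tau> a"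
  have \<tau>': "0 < \<tau>" "\<tau> \<le> 1 / 4" "8 * R * \<tau> < 1" "8 * (1 + R) * \<tau> < 1"
    "cF * (2 * R * C) powr s * \<tau> powr (s / 2) \<le> 1 / 10"
    using \<tau> unfolding small_def by auto
  obtain E where E [measurable]: "E \<in> sets borel" and E_le: "measure \<mu> E \<le> C' * \<tau> powr (s / 2)"
    and close: "\<And>x y y'. x \<in> I - E \<Longrightarrow> y \<in> J \<Longrightarrow> y' \<in> J \<Longrightarrow> \<tau> powr (s / 4) < line_measure (2 * R * \<tau> ^ 3) x y \<Longrightarrow>
      \<tau> powr (s / 4) < line_measure (2 * R * \<tau> ^ 3) x y' \<Longrightarrow> \<bar>slope x y - slope x y'\<bar> < \<tau>"
    using heavy_slopes_close[OF \<tau>'] unfolding C'_def by metis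
  have sections: "emeasure \<nu> (Pair x -` ?B) \<le> ennreal a + indicator E x" for x
  proof (cases "x \<in> E \<or> Pair x -` ?B = {}")
    case True
    then show ?thesis
      using \<nu>.emeasure_le_1[of "Pair x -` ?B"] by (auto intro: add_increasing)
  next
    case False
    then obtain y where y: "(x, y) \<in> ?B" by auto
    have sub: "Pair x -` ?B \<subseteq> J \<inter> strip (slope x y) (intercept x y) (2 * R * \<tau>)"
    proof
      fix z assume "z \<in> Pair x -` ?B"
      with y False have xyz: "x \<in> I" "y \<in> J" "z \<in> J" "\<bar>slope x z - slope x y\<bar> < \<tau>"
        unfolding bad_def by (auto intro!: close)
      have "z $ 2 - slope x y * z $ 1 - intercept x y = (slope x z - slope x y) * (z $ 1 - x $ 1)"
        using slope_mult[of z x] coord_neq[OF xyz(1,3)] by (simp add: intercept_def algebra_simps)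
      also have "\<bar>\<dots>\<bar> \<le> \<tau> * (2 * R)"
        unfolding abs_mult using xyz bounded[of z 1] bounded[of x 1] by (intro mult_mono) auto
      finally show "z \<in> J \<inter> strip (slope x y) (intercept x y) (2 * R * \<tau>)"
        using xyz by (simp add: strip_def mult_ac)
    qed
    have "measure \<nu> (Pair x -` ?B) \<le> line_measure (2 * R * \<tau>) x y"
      unfolding line_measure_def by (rule \<nu>.finite_measure_mono[OF sub]) measurable
    also have "\<dots> \<le> a" using y unfolding bad_def by auto
    finally show ?thesis by (simp add: \<nu>.emeasure_eq_measure ennreal_leI add_increasing2)
  qed
  have "emeasure (\<mu> \<Otimes>\<^sub>M \<nu>) ?B = (\<integral>\<^sup>+ x. emeasure \<nu> (Pair x -` ?B) \<partial>\<mu>)"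
    by (rule \<nu>.emeasure_pair_measure_alt) measurable
  also have "\<dots> \<le> (\<integral>\<^sup>+ x. ennreal a + indicator E x \<partial>\<mu>)"
    by (intro nn_integral_mono sections)
  also have "\<dots> = ennreal a + emeasure \<mu> E"
    by (subst nn_integral_add) (auto simp: \<mu>.emeasure_space_1)
  also have "\<dots> \<le> ennreal (a + C' * \<tau> powr (s / 2))"
    using E_le a by (simp add: \<mu>.emeasure_eq_measure C'_nonneg ennreal_leI flip: ennreal_plus)
  finally have "ennreal (P.prob ?B) \<le> ennreal (a + C' * \<tau> powr (s / 2))"
    unfolding P.emeasure_eq_measure .
  then show ?thesis
    by (subst (asm) ennreal_le_iff) (use a C'_nonneg in auto)
qed

lemma bad_mono: "\<delta> \<le> \<delta>' \<Longrightarrow> bad \<delta> h \<subseteq> bad \<delta>' h"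
proof
  fix p assume "\<delta> \<le> \<delta>'" "p \<in> bad \<delta> h"
  then have "2 * R * \<delta> \<le> 2 * R * \<delta>'" using R by simp
  then have "line_measure (2 * R * \<delta>) (fst p) (snd p) \<le> line_measure (2 * R * \<delta>') (fst p) (snd p)"
    by (rule line_measure_mono)
  then show "p \<in> bad \<delta>' h" using \<open>p \<in> bad \<delta> h\<close> unfolding bad_def by auto
qed

lemma line_measure_tendsto:
  "(\<lambda>n. line_measure (2 * R * inverse (real (Suc n))) x y) \<longlonglongrightarrow> line_measure 0 x y"
proof -
  let ?S = "\<lambda>\<delta>. J \<inter> strip (slope x y) (intercept x y) \<delta>"
  have lim: "(\<lambda>n. 2 * R * inverse (real (Suc n))) \<longlonglongrightarrow> 0"
    using tendsto_mult_left[OF LIMSEQ_inverse_real_of_nat, of "2 * R"] by simp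
  have "(\<lambda>n. measure \<nu> (?S (2 * R * inverse (real (Suc n))))) \<longlonglongrightarrow> measure \<nu> (\<Inter>n. ?S (2 * R * inverse (real (Suc n))))"
  proof (rule \<nu>.finite_Lim_measure_decseq)
    show "range (\<lambda>n. ?S (2 * R * inverse (real (Suc n)))) \<subseteq> \<nu>.events" by auto
    have "2 * R * inverse (real (Suc n)) \<le> 2 * R * inverse (real (Suc m))" if "m \<le> n" for m n
      using that R by (intro mult_left_mono le_imp_inverse_le) auto
    then show "decseq (\<lambda>n. ?S (2 * R * inverse (real (Suc n))))"
      using strip_mono unfolding decseq_def by (metis Int_mono order_refl)
  qed
  moreover have "(\<Inter>n. ?S (2 * R * inverse (real (Suc n)))) = ?S 0"
  proof
    show "?S 0 \<subseteq> (\<Inter>n. ?S (2 * R * inverse (real (Suc n))))"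
      using R strip_mono[of 0] by (intro INT_greatest Int_mono) auto
    show "(\<Inter>n. ?S (2 * R * inverse (real (Suc n)))) \<subseteq> ?S 0"
    proof
      fix z assume z: "z \<in> (\<Inter>n. ?S (2 * R * inverse (real (Suc n))))"
      then have "\<bar>z $ 2 - slope x y * z $ 1 - intercept x y\<bar> \<le> 2 * R * inverse (real (Suc n))" for n
        by (auto simp: strip_def)
      then have "\<bar>z $ 2 - slope x y * z $ 1 - intercept x y\<bar> \<le> 0"
        by (intro LIMSEQ_le_const[OF lim]) auto
      then show "z \<in> ?S 0" using z by (auto simp: strip_def)
    qed
  qed
  ultimately show ?thesis by (simp add: line_measure_def)
qed

lemma bad_tendsto_0:
  assumes null: "\<And>x y. x \<in> I \<Longrightarrow> y \<in> J \<Longrightarrow> line_measure 0 x y = 0" and "0 < \<epsilon>"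
  shows "(\<lambda>n. P.prob (bad (inverse (real (Suc n))) \<epsilon>)) \<longlonglongrightarrow> 0"
proof -
  have "(\<lambda>n. P.prob (bad (inverse (real (Suc n))) \<epsilon>)) \<longlonglongrightarrow> P.prob (\<Inter>n. bad (inverse (real (Suc n))) \<epsilon>)"
  proof (rule P.finite_Lim_measure_decseq)
    show "decseq (\<lambda>n. bad (inverse (real (Suc n))) \<epsilon>)"
      unfolding decseq_def by (intro allI impI bad_mono le_imp_inverse_le) auto
  qed auto
  moreover have "(\<Inter>n. bad (inverse (real (Suc n))) \<epsilon>) = {}"
  proof (rule ccontr)
    assume "\<not> ?thesis"
    then obtain p where p: "\<And>n. p \<in> bad (inverse (real (Suc n))) \<epsilon>" by auto
    then have "\<epsilon> \<le> line_measure (2 * R * inverse (real (Suc n))) (fst p) (snd p)" for n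
      unfolding bad_def by (auto intro: less_imp_le)
    then have "\<epsilon> \<le> line_measure 0 (fst p) (snd p)"
      by (intro LIMSEQ_le_const[OF line_measure_tendsto]) auto
    then show False using null[of "fst p" "snd p"] p[of 0] \<open>0 < \<epsilon>\<close> unfolding bad_def by auto
  qed
  ultimately show ?thesis by simp
qed

lemma sum_power_le: "0 \<le> \<rho> \<Longrightarrow> \<rho> \<le> 1 / 2 \<Longrightarrow> (\<Sum>k<n. \<rho> ^ Suc k) \<le> 2 * \<rho>" for \<rho> :: real
proof -
  assume \<rho>: "0 \<le> \<rho>" "\<rho> \<le> 1 / 2"
  have "(\<Sum>k<n. \<rho> ^ Suc k) \<le> 2 * \<rho> - 2 * \<rho> ^ Suc n"
  proof (induction n)
    case (Suc n)
    have "2 * \<rho> ^ Suc (Suc n) = (2 * \<rho>) * \<rho> ^ Suc n" by simp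
    also have "\<dots> \<le> 1 * \<rho> ^ Suc n" using \<rho> by (intro mult_right_mono) auto
    finally show ?case using Suc by simp
  qed simp
  moreover have "0 \<le> \<rho> ^ Suc n" using \<rho>(1) by simp
  ultimately show ?thesis by linarith
qed

text \<open>Starting scale of the iteration: the probability of \<open>bad\<close> tends to 0 by
  continuity from above, and the remaining conditions involve positive powers of the scale.\<close>

lemma ex_scale:
  assumes null: "\<And>x y. x \<in> I \<Longrightarrow> y \<in> J \<Longrightarrow> line_measure 0 x y = 0" and "0 < \<epsilon>"
  obtains \<tau> where "small \<tau>" "P.prob (bad \<tau> \<epsilon>) < \<epsilon>" "\<tau> powr (s / 4) \<le> 1 / 2" "(1 + C') * (2 * \<tau> powr (s / 4)) < \<epsilon>"
proof -
  define t where "t n = inverse (real (Suc n))" for n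
  have t: "t \<longlonglongrightarrow> 0" unfolding t_def by (rule LIMSEQ_inverse_real_of_nat)
  have pos: "0 < t n" for n by (simp add: t_def)
  have lin: "(\<lambda>n. c * t n) \<longlonglongrightarrow> 0" for c using tendsto_mult_left[OF t, of c] by simp
  have pow: "(\<lambda>n. c * t n powr e) \<longlonglongrightarrow> 0" if "0 < e" for c e
  proof -
    have "(\<lambda>n. t n powr e) \<longlonglongrightarrow> 0"
      using tendsto_zero_powrI[OF t tendsto_const _ that] pos by (simp add: less_imp_le)
    from tendsto_mult_left[OF this, of c] show ?thesis by simp
  qed
  have ev: "eventually (\<lambda>n. t n < 1 / 4) sequentially"
    "eventually (\<lambda>n. 8 * R * t n < 1) sequentially"
    "eventually (\<lambda>n. 8 * (1 + R) * t n < 1) sequentially"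
    "eventually (\<lambda>n. cF * (2 * R * C) powr s * t n powr (s / 2) < 1 / 10) sequentially"
    "eventually (\<lambda>n. P.prob (bad (t n) \<epsilon>) < \<epsilon>) sequentially"
    "eventually (\<lambda>n. 1 * t n powr (s / 4) < 1 / 2) sequentially"
    using pow[of "s / 4" 1] t lin pow s \<open>0 < \<epsilon>\<close> bad_tendsto_0[OF null \<open>0 < \<epsilon>\<close>] unfolding t_def[symmetric]
    by (auto intro!: order_tendstoD(2)[where y = 0])
  have ev7: "eventually (\<lambda>n. (1 + C') * (2 * t n powr (s / 4)) < \<epsilon>) sequentially"
    using order_tendstoD(2)[OF pow[of "s / 4" "(1 + C') * 2"] \<open>0 < \<epsilon>\<close>] s by (simp only: mult.assoc)
  from eventually_conj[OF ev(1) eventually_conj[OF ev(2) eventually_conj[OF ev(3) eventually_conj[OF ev(4)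
        eventually_conj[OF ev(5) eventually_conj[OF ev(6) ev7]]]]]]
  obtain n where "t n < 1 / 4" "8 * R * t n < 1" "8 * (1 + R) * t n < 1"
    "cF * (2 * R * C) powr s * t n powr (s / 2) < 1 / 10" "P.prob (bad (t n) \<epsilon>) < \<epsilon>"
    "1 * t n powr (s / 4) < 1 / 2" "(1 + C') * (2 * t n powr (s / 4)) < \<epsilon>"
    unfolding eventually_sequentially by blast
  then show thesis using pos[of n] by (intro that[of "t n"]) (simp_all add: small_def less_imp_le)
qed


text \<open>Passing from scale \<open>\<tau>\<close> to scale \<open>\<tau>\<^sup>3\<close> loses only as much mass as a strip of width \<open>\<tau>\<close> could
  carry, so along the scales \<open>\<tau>, \<tau>\<^sup>3, \<tau>\<^sup>9, \<dots>\<close> the losses are summable and dominated by the first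
  one. That one is small since lines are null sets.\<close>

lemma thin_strips:
  assumes pos: "0 < P.prob (I \<times> J)"
    and null: "\<And>x y. x \<in> I \<Longrightarrow> y \<in> J \<Longrightarrow> line_measure 0 x y = 0"
  obtains G \<eta> where "G \<in> sets (\<mu> \<Otimes>\<^sub>M \<nu>)" "G \<subseteq> I \<times> J" "0 < P.prob G" "0 < \<eta>"
    "\<And>x y. (x, y) \<in> G \<Longrightarrow> \<exists>c. \<forall>\<delta>. 0 < \<delta> \<longrightarrow> \<delta> \<le> 1 \<longrightarrow> line_measure \<delta> x y \<le> c * \<delta> powr \<eta>"
proof -
  \<comment> \<open>Three losses of at most \<open>\<epsilon>\<close> each, from the initial bad
    set, from the threshold \<open>h 0\<close> and from the geometric tail, leave part of
    \<open>I \<times> J\<close>.\<close>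
  define \<epsilon> where "\<epsilon> = P.prob (I \<times> J) / 4"
  have "0 < \<epsilon>" using pos by (simp add: \<epsilon>_def)
  obtain \<tau> where \<tau>: "small \<tau>" "P.prob (bad \<tau> \<epsilon>) < \<epsilon>" "\<tau> powr (s / 4) \<le> 1 / 2" "(1 + C') * (2 * \<tau> powr (s / 4)) < \<epsilon>"
    using ex_scale[OF null \<open>0 < \<epsilon>\<close>] by metis
  have \<tau>01: "0 < \<tau>" "\<tau> \<le> 1" using \<tau>(1) by (auto simp: small_def)
  define T where "T k = \<tau> ^ (3 ^ k)" for k :: nat
  \<comment> \<open>The threshold at level \<open>Suc k\<close> is a power of the previous scale
    \<open>T k\<close>, so that \<open>bad_step\<close> with \<open>a = h k\<close> bounds
    \<open>B (Suc k) - B k\<close>.\<close>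
  define h where "h k = (case k of 0 \<Rightarrow> \<epsilon> | Suc k \<Rightarrow> T k powr (s / 4))" for k
  define B where "B k = bad (T k) (h k)" for k
  let ?\<rho> = "\<tau> powr (s / 4)"
  have T_pos: "0 < T k" for k using \<tau>01 by (simp add: T_def)
  have T_Suc: "T (Suc k) = T k ^ 3" for k by (simp add: T_def mult.commute flip: power_mult)
  have exp_ge: "Suc k \<le> 3 ^ k" for k
  proof (induction k)
    case (Suc k)
    then show ?case by simp
  qed simp
  have T_le: "T k \<le> \<tau> ^ Suc k" for k
    unfolding T_def using \<tau>01 exp_ge by (intro power_decreasing) auto
  have T_le_\<tau>: "T k \<le> \<tau>" for k
    using T_le[of k] power_decreasing[of 1 "Suc k" \<tau>] \<tau>01 by (simp del: power_Suc)
  have T_small: "small (T k)" for k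
    by (rule small_mono[OF \<tau>(1) T_pos T_le_\<tau>])
  have T_powr: "T k powr (s / 4) \<le> ?\<rho> ^ Suc k" for k
  proof -
    have "T k powr (s / 4) \<le> (\<tau> ^ Suc k) powr (s / 4)"
      using T_le T_pos s by (intro powr_mono2) (auto simp: less_imp_le)
    also have "\<dots> = ?\<rho> ^ Suc k" using \<tau>01
      by (simp only: powr_realpow[symmetric] powr_gt_zero powr_powr mult.commute)
    finally show ?thesis .
  qed
  have h_nonneg: "0 \<le> h k" for k
    using \<open>0 < \<epsilon>\<close> by (cases k) (auto simp: h_def)
  have step: "P.prob (B (Suc k) - B k) \<le> h k + C' * T k powr (s / 4)" for k
  proof -
    have "P.prob (B (Suc k) - B k) \<le> h k + C' * T k powr (s / 2)"
      using bad_step[OF T_small h_nonneg, of k k] by (simp add: B_def h_def T_Suc)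
    moreover have "T k powr (s / 2) \<le> T k powr (s / 4)"
      using T_pos[of k] T_le_\<tau>[of k] \<tau>01 s by (intro powr_mono') auto
    ultimately show ?thesis using mult_left_mono[OF _ C'_nonneg] by fastforce
  qed
  define U where "U n = (\<Union>k\<le>n. B k)" for n :: nat
  have B_sets [measurable]: "B k \<in> sets (\<mu> \<Otimes>\<^sub>M \<nu>)" for k by (simp add: B_def)
  have U_sets [measurable]: "U n \<in> sets (\<mu> \<Otimes>\<^sub>M \<nu>)" for n unfolding U_def by measurable
  have U_le: "P.prob (U n) \<le> P.prob (B 0) + (\<Sum>k<n. h k + C' * T k powr (s / 4))" for n
  proof (induction n)
    case (Suc n)
    have "U (Suc n) = U n \<union> (B (Suc n) - B n)"
      unfolding U_def by (auto simp: le_Suc_eq)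
    then have "P.prob (U (Suc n)) \<le> P.prob (U n) + P.prob (B (Suc n) - B n)"
      by (auto intro!: measure_Un_le)
    then show ?case using Suc step[of n] by simp
  qed (simp add: U_def)
  have sum_h: "(\<Sum>k<n. h k) \<le> \<epsilon> + (\<Sum>k<n. T k powr (s / 4))" for n
  proof (cases n)
    case (Suc m)
    have "(\<Sum>k<Suc m. h k) = \<epsilon> + (\<Sum>k<m. T k powr (s / 4))"
      by (subst sum.lessThan_Suc_shift) (simp add: h_def)
    also have "\<dots> \<le> \<epsilon> + (\<Sum>k<Suc m. T k powr (s / 4))" by simp
    finally show ?thesis using Suc by simp
  qed (use \<open>0 < \<epsilon>\<close> in simp)
  have sum_T: "(\<Sum>k<n. T k powr (s / 4)) \<le> 2 * ?\<rho>" for n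
  proof -
    have "(\<Sum>k<n. T k powr (s / 4)) \<le> (\<Sum>k<n. ?\<rho> ^ Suc k)" by (intro sum_mono T_powr)
    also have "\<dots> \<le> 2 * ?\<rho>" by (rule sum_power_le) (use \<tau>(3) in auto)
    finally show ?thesis .
  qed
  define \<beta> where "\<beta> = P.prob (B 0) + \<epsilon> + (1 + C') * (2 * ?\<rho>)"
  have "P.prob (U n) \<le> \<beta>" for n
  proof -
    have "(\<Sum>k<n. h k + C' * T k powr (s / 4)) = (\<Sum>k<n. h k) + C' * (\<Sum>k<n. T k powr (s / 4))"
      by (simp add: sum.distrib sum_distrib_left)
    also have "\<dots> \<le> (\<epsilon> + 2 * ?\<rho>) + C' * (2 * ?\<rho>)"
      using sum_h[of n] sum_T[of n] mult_left_mono[OF sum_T[of n] C'_nonneg] by linarith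
    finally show ?thesis using U_le[of n] unfolding \<beta>_def by (simp add: algebra_simps)
  qed
  moreover have "(\<lambda>n. P.prob (U n)) \<longlonglongrightarrow> P.prob (\<Union>n. U n)"
    by (rule P.finite_Lim_measure_incseq) (auto simp: U_def incseq_def intro: order.trans)
  ultimately have "P.prob (\<Union>n. U n) \<le> \<beta>"
    by (intro LIMSEQ_le_const2) auto
  also have "\<beta> < 3 * \<epsilon>"
    using \<tau>(2,4) unfolding \<beta>_def by (simp add: B_def h_def T_def)
  finally have U_small: "P.prob (\<Union>n. U n) < 3 * \<epsilon>" .
  define G where "G = I \<times> J - (\<Union>n. U n)"
  have IJ [measurable]: "I \<times> J \<in> sets (\<mu> \<Otimes>\<^sub>M \<nu>)" by measurable
  show thesis
  proof (rule that)
    show "G \<in> sets (\<mu> \<Otimes>\<^sub>M \<nu>)" unfolding G_def by measurable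
    show "G \<subseteq> I \<times> J" unfolding G_def by blast
    have "P.prob (I \<times> J) \<le> P.prob (G \<union> (\<Union>n. U n))"
      unfolding G_def by (intro P.finite_measure_mono) auto
    also have "\<dots> \<le> P.prob G + P.prob (\<Union>n. U n)"
      unfolding G_def by (intro measure_Un_le) auto
    finally show "0 < P.prob G" using U_small pos unfolding \<epsilon>_def by linarith
    \<comment> \<open>36 is 4 times 9. A width between two consecutive scales is compared with the
      threshold of the coarser one, which is set by the scale before it; two steps down the scales
      are a ninth power.\<close>
    show "0 < s / 36" using s by simp
    fix x y assume xy: "(x, y) \<in> G"
    have line_le: "line_measure (2 * R * T k) x y \<le> h k" for k
    proof -
      have "(x, y) \<notin> B k" using xy unfolding G_def U_def by auto
      then show ?thesis using xy sets_eq_imp_space_eq[OF sets_\<mu>] sets_eq_imp_space_eq[OF sets_\<nu>]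
        unfolding G_def B_def bad_def by (auto simp: space_pair_measure)
    qed
    \<comment> \<open>The power makes the bound exceed 1 for
      \<open>\<delta> \<ge> 2 * R * T 1\<close>, where nothing better than mass 1 is used; the
      summand 1 serves the smaller widths.\<close>
    let ?c = "(2 * R * T 1) powr - (s / 36) + 1"
    show "\<exists>c. \<forall>\<delta>. 0 < \<delta> \<longrightarrow> \<delta> \<le> 1 \<longrightarrow> line_measure \<delta> x y \<le> c * \<delta> powr (s / 36)"
    proof (intro exI[of _ ?c] allI impI)
      fix \<delta> :: real assume \<delta>: "0 < \<delta>" "\<delta> \<le> 1"
      have inv: "w powr - e * w powr e = 1" if "0 < w" for w e :: real
        using that by (simp add: powr_minus)
      have RT: "0 < 2 * R * T k" for k using R T_pos by simp
      show "line_measure \<delta> x y \<le> ?c * \<delta> powr (s / 36)"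
      proof (cases "2 * R * T 1 \<le> \<delta>")
        case True
        have "1 = (2 * R * T 1) powr - (s / 36) * (2 * R * T 1) powr (s / 36)"
          using inv[OF RT[of 1]] by simp
        also have "\<dots> \<le> (2 * R * T 1) powr - (s / 36) * \<delta> powr (s / 36)"
          using True RT[of 1] s by (intro mult_left_mono powr_mono2) auto
        also have "\<dots> \<le> ?c * \<delta> powr (s / 36)" by (simp add: distrib_right)
        finally show ?thesis using line_measure_le_1[of \<delta> x y] by linarith
      next
        case False
        have "(\<lambda>n. \<tau> ^ n) \<longlonglongrightarrow> 0" using \<tau>(1) by (intro LIMSEQ_realpow_zero) (auto simp: small_def)
        from LIMSEQ_Suc[OF tendsto_mult_left[OF this, of "2 * R"]] have "(\<lambda>n. 2 * R * \<tau> ^ Suc n) \<longlonglongrightarrow> 0" by simp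
        then have "eventually (\<lambda>n. 2 * R * \<tau> ^ Suc n < \<delta>) sequentially"
          using \<delta>(1) by (rule order_tendstoD(2))
        then obtain n where "2 * R * \<tau> ^ Suc n < \<delta>" unfolding eventually_sequentially by blast
        moreover have "2 * R * T n \<le> 2 * R * \<tau> ^ Suc n" using T_le R by (intro mult_left_mono) auto
        ultimately have ex: "2 * R * T n \<le> \<delta>" by linarith
        \<comment> \<open>Since \<open>\<delta> < 2 * R * T 1\<close>, the first scale below
          \<open>\<delta>\<close> has \<open>k \<ge> 2\<close>, so there is room for the index
          \<open>j\<close> two levels earlier.\<close>
        define k where "k = (LEAST k. 2 * R * T k \<le> \<delta>)"
        have k: "2 * R * T k \<le> \<delta>" unfolding k_def using ex by (rule LeastI)
        have less: "\<delta> < 2 * R * T l" if "l < k" for l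
          using not_less_Least[of l "\<lambda>k. 2 * R * T k \<le> \<delta>"] that unfolding k_def by simp
        have "T 1 \<le> T 0" using power_decreasing[of 1 3 \<tau>] \<tau>01 by (simp add: T_def)
        then have "2 * R * T 1 \<le> 2 * R * T 0" using R by (intro mult_left_mono) auto
        with False k have "k \<noteq> 0" "k \<noteq> 1" by (metis order.trans)+
        then obtain j where j: "k = Suc (Suc j)" by (metis One_nat_def not0_implies_Suc)
        have "line_measure \<delta> x y \<le> line_measure (2 * R * T (Suc j)) x y"
          using less[of "Suc j"] j by (intro line_measure_mono) auto
        also have "\<dots> \<le> T j powr (s / 4)" using line_le[of "Suc j"] by (simp add: h_def)
        also have "\<dots> = (T j ^ 9) powr (s / 36)"
        proof -
          have "T j ^ 9 = T j powr 9" using powr_realpow[OF T_pos, of j 9] by simp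
          then show ?thesis by (simp only: powr_powr) simp
        qed
        also have "\<dots> \<le> \<delta> powr (s / 36)"
        proof (rule powr_mono2)
          have "T j ^ 9 = T k" by (simp add: j T_Suc flip: power_mult)
          moreover have "1 * T k \<le> 2 * R * T k" using R T_pos[of k] by (intro mult_right_mono) auto
          ultimately show "T j ^ 9 \<le> \<delta>" using k by linarith
        qed (use s T_pos[of j] in auto)
        also have "\<dots> \<le> ?c * \<delta> powr (s / 36)"
          using mult_right_mono[of 1 ?c "\<delta> powr (s / 36)"] by simp
        finally show ?thesis .
      qed
    qed
  qed
qed

text \<open>The case in which \<open>J\<close> lies on one line and \<open>I\<close> avoids it: a
  strip around the transversal line through \<open>x\<close> and \<open>y\<close> cuts out a piece
  of length \<open>O(\<delta>)\<close>, so the Frostman condition gives the decay directly.\<close>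

lemma thin_strips_line:
  assumes J: "\<And>z. z \<in> J \<Longrightarrow> \<exists>t. z = p + t *\<^sub>R v" and I: "\<And>x t. x \<in> I \<Longrightarrow> x \<noteq> p + t *\<^sub>R v" and "v \<noteq> 0"
    and xy: "x \<in> I" "y \<in> J"
  shows "\<exists>c. \<forall>\<delta>. 0 < \<delta> \<longrightarrow> \<delta> \<le> 1 \<longrightarrow> line_measure \<delta> x y \<le> c * \<delta> powr s"
proof -
  let ?S = "slope x y"
  \<comment> \<open>Rate at which the height above the line through \<open>x\<close> and
    \<open>y\<close> changes along \<open>v\<close>. If it vanished, that line would be parallel to
    \<open>v\<close> and \<open>x\<close> would lie on the line carrying \<open>J\<close>.\<close>
  define \<kappa> where "\<kappa> = v $ 2 - ?S * v $ 1"
  obtain t0 where t0: "y = p + t0 *\<^sub>R v" using J[OF xy(2)] by blast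
  have S: "?S * (y $ 1 - x $ 1) = y $ 2 - x $ 2" using slope_mult coord_neq[OF xy] by metis
  have "\<kappa> \<noteq> 0"
  proof
    assume "\<kappa> = 0"
    then have v2: "v $ 2 = ?S * v $ 1" by (simp add: \<kappa>_def)
    then have "v $ 1 \<noteq> 0" using \<open>v \<noteq> 0\<close> by (auto simp: vec_eq_iff forall_2)
    define r where "r = (x $ 1 - y $ 1) / v $ 1"
    have r1: "r * v $ 1 = x $ 1 - y $ 1" using \<open>v $ 1 \<noteq> 0\<close> by (simp add: r_def)
    have "r * v $ 2 = ?S * (r * v $ 1)" by (simp add: v2)
    also have "\<dots> = x $ 2 - y $ 2" using S unfolding r1 by (simp add: right_diff_distrib)
    finally have "x = y + r *\<^sub>R v" using r1 by (simp add: vec_eq_iff forall_2)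
    then have "x = p + (t0 + r) *\<^sub>R v" by (simp add: t0 scaleR_left_distrib)
    then show False using I[OF xy(1)] by blast
  qed
  define D where "D = (\<bar>v $ 1\<bar> + \<bar>v $ 2\<bar>) / \<bar>\<kappa>\<bar>"
  have "0 \<le> D" by (simp add: D_def)
  have near: "dist z y \<le> D * \<delta>" if z: "z \<in> J \<inter> strip ?S (intercept x y) \<delta>" for z \<delta>
  proof -
    obtain t where t: "z = p + t *\<^sub>R v" using z J by blast
    have "intercept x y = y $ 2 - ?S * y $ 1" using S by (simp add: intercept_def algebra_simps)
    then have "z $ 2 - ?S * z $ 1 - intercept x y = (t - t0) * \<kappa>"
      by (simp add: t t0 \<kappa>_def algebra_simps)
    then have "\<bar>t - t0\<bar> * \<bar>\<kappa>\<bar> \<le> \<delta>" using z by (simp add: strip_def abs_mult)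
    then have "\<bar>t - t0\<bar> \<le> \<delta> / \<bar>\<kappa>\<bar>" using \<open>\<kappa> \<noteq> 0\<close> by (simp add: field_simps)
    then have "\<bar>t - t0\<bar> * (\<bar>v $ 1\<bar> + \<bar>v $ 2\<bar>) \<le> \<delta> / \<bar>\<kappa>\<bar> * (\<bar>v $ 1\<bar> + \<bar>v $ 2\<bar>)"
      by (rule mult_right_mono) simp
    moreover have "z $ i - y $ i = (t - t0) * v $ i" for i by (simp add: t t0 algebra_simps)
    then have "dist z y \<le> \<bar>t - t0\<bar> * (\<bar>v $ 1\<bar> + \<bar>v $ 2\<bar>)"
      using dist_vec2_le[of z y] by (simp add: abs_mult distrib_left)
    moreover have "D * \<delta> = \<delta> / \<bar>\<kappa>\<bar> * (\<bar>v $ 1\<bar> + \<bar>v $ 2\<bar>)" by (simp add: D_def)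
    ultimately show ?thesis by linarith
  qed
  show ?thesis
  proof (intro exI[of _ "cF * (2 * D + 1) powr s"] allI impI)
    fix \<delta> :: real assume \<delta>: "0 < \<delta>" "\<delta> \<le> 1"
    have "line_measure \<delta> x y \<le> cF * ((2 * D + 1) * \<delta>) powr s"
      unfolding line_measure_def
    proof (rule frostman_measure_le[OF \<nu>.finite_measure_axioms sets_\<nu> frost_\<nu>])
      fix z z' assume "z \<in> J \<inter> strip ?S (intercept x y) \<delta>" "z' \<in> J \<inter> strip ?S (intercept x y) \<delta>"
      then have "dist z z' \<le> D * \<delta> + D * \<delta>"
        using near dist_triangle2[of z z' y] by (meson add_mono order.trans)
      then show "dist z z' < (2 * D + 1) * \<delta>" using \<delta> by (simp add: algebra_simps)
    qed (use \<delta> \<open>0 \<le> D\<close> cF in auto)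
    then show "line_measure \<delta> x y \<le> cF * (2 * D + 1) powr s * \<delta> powr s"
      using \<open>0 \<le> D\<close> \<delta> by (simp add: powr_mult)
  qed
qed

end

section \<open>Almost sure lower bounds for complexity\<close>

definition line_point :: "real ^ 2 \<Rightarrow> real ^ 2 \<Rightarrow> real ^ 2" where
  "line_point x y = vector [slope x y, intercept x y]"

lemma line_point_nth [simp]: "line_point x y $ 1 = slope x y" "line_point x y $ 2 = intercept x y"
  by (simp_all add: line_point_def)

lemma measurable_grid_index_line_point [measurable]:
  "(\<lambda>p. grid_index m (line_point (fst p) (snd p))) \<in> measurable (borel \<Otimes>\<^sub>M borel) (count_space UNIV)"
  unfolding grid_index_def line_point_nth by measurable

section \<open>Lines, their dual points and grid tubes\<close>

lemma affine_hull_eq_graph: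
  assumes "x $ 1 \<noteq> y $ 1"
  shows "affine hull {x, y} = {p :: real ^ 2. p $ 2 = slope x y * p $ 1 + intercept x y}"
proof (intro set_eqI iffI)
  have S: "slope x y * (y $ 1 - x $ 1) = y $ 2 - x $ 2" using assms by (simp add: slope_def)
  have xy: "x $ 2 = slope x y * x $ 1 + intercept x y" "y $ 2 = slope x y * y $ 1 + intercept x y"
    using S by (simp_all add: intercept_def algebra_simps)
  {
    fix p assume "p \<in> affine hull {x, y}"
    then obtain u v where p: "p = u *\<^sub>R x + v *\<^sub>R y" "u + v = 1" by (auto simp: affine_hull_2)
    have "p $ 2 = slope x y * p $ 1 + (u + v) * intercept x y"
      using xy by (simp add: p(1) algebra_simps)
    then show "p \<in> {p. p $ 2 = slope x y * p $ 1 + intercept x y}" using p(2) by simp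
  next
    fix p :: "real ^ 2" assume "p \<in> {p. p $ 2 = slope x y * p $ 1 + intercept x y}"
    then have p: "p $ 2 = slope x y * p $ 1 + intercept x y" by simp
    define t where "t = (p $ 1 - x $ 1) / (y $ 1 - x $ 1)"
    have t: "t * (y $ 1 - x $ 1) = p $ 1 - x $ 1" using assms by (simp add: t_def)
    have "t * (y $ 2 - x $ 2) = slope x y * (t * (y $ 1 - x $ 1))" by (simp flip: S)
    also have "\<dots> = p $ 2 - x $ 2" unfolding t using p xy(1) by (simp add: algebra_simps)
    finally have "p = (1 - t) *\<^sub>R x + t *\<^sub>R y"
      using t by (simp add: vec_eq_iff forall_2 algebra_simps)
    then show "p \<in> affine hull {x, y}" unfolding affine_hull_2 by force
  }
qed

lemma graph_inject:
  assumes "{p :: real ^ 2. p $ 2 = q $ 1 * p $ 1 + q $ 2} = {p. p $ 2 = q' $ 1 * p $ 1 + q' $ 2}"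
  shows "q = (q' :: real ^ 2)"
proof -
  have "vector [t, q $ 1 * t + q $ 2] \<in> {p :: real ^ 2. p $ 2 = q $ 1 * p $ 1 + q $ 2}" for t
    by simp
  then have "q $ 1 * t + q $ 2 = q' $ 1 * t + q' $ 2" for t
    unfolding assms by simp
  from this[of 0] this[of 1] show ?thesis by (simp add: vec_eq_iff forall_2)
qed

lemma dual_point_affine_hull:
  assumes "x $ 1 \<noteq> y $ 1"
  shows "dual_point (affine hull {x, y}) = line_point x y"
proof -
  have eq: "affine hull {x, y} = {p. p $ 2 = line_point x y $ 1 * p $ 1 + line_point x y $ 2}"
    using affine_hull_eq_graph[OF assms] by simp
  then have "\<exists>q :: real ^ 2. affine hull {x, y} = {p. p $ 2 = q $ 1 * p $ 1 + q $ 2}" by blast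
  then have "dual_point (affine hull {x, y}) =
      (THE q :: real ^ 2. affine hull {x, y} = {p. p $ 2 = q $ 1 * p $ 1 + q $ 2})"
    unfolding dual_point_def by (rule if_P)
  also have "\<dots> = line_point x y"
  proof (rule the_equality)
    show "affine hull {x, y} = {p. p $ 2 = line_point x y $ 1 * p $ 1 + line_point x y $ 2}" by (rule eq)
    fix q :: "real ^ 2" assume "affine hull {x, y} = {p. p $ 2 = q $ 1 * p $ 1 + q $ 2}"
    from graph_inject[OF trans[OF sym[OF this] eq]] show "q = line_point x y" .
  qed
  finally show ?thesis .
qed

text \<open>Effect of rounding to corners, in units of \<open>2 ^ m\<close>: 1 for each second
  coordinate, \<open>a\<close> and \<open>r\<close> for the factors of the product, and a last 1 for
  the product of the two roundings.\<close>

lemma grid_tube_error: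
  fixes z l :: "real ^ 2"
  assumes "\<bar>l $ 1\<bar> \<le> a" "\<bar>z $ 1\<bar> \<le> r"
  shows "\<bar>real_of_int (coord2 (grid_index m z) * 2 ^ m - coord1 (grid_index m l) * coord1 (grid_index m z) - coord2 (grid_index m l) * 2 ^ m) -
    2 ^ m * (2 ^ m * (z $ 2 - l $ 1 * z $ 1 - l $ 2))\<bar> \<le> (3 + a + r) * 2 ^ m"
proof -
  let ?N = "2 ^ m :: real"
  have N: "1 \<le> ?N" by simp
  define f where "f t = ?N * t - of_int \<lfloor>?N * t\<rfloor>" for t
  have f: "0 \<le> f t" "f t \<le> 1" for t unfolding f_def by linarith+
  have fl: "of_int \<lfloor>?N * t\<rfloor> = ?N * t - f t" for t unfolding f_def by simp
  have "real_of_int (coord2 (grid_index m z) * 2 ^ m - coord1 (grid_index m l) * coord1 (grid_index m z) - coord2 (grid_index m l) * 2 ^ m) -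
    ?N * (?N * (z $ 2 - l $ 1 * z $ 1 - l $ 2)) =
      f (l $ 2) * ?N - f (z $ 2) * ?N + l $ 1 * f (z $ 1) * ?N + f (l $ 1) * z $ 1 * ?N - f (l $ 1) * f (z $ 1)"
    unfolding coord_grid_index of_int_diff of_int_mult of_int_power of_int_numeral fl
    by (simp add: algebra_simps)
  moreover have "\<bar>f (l $ 2) * ?N\<bar> \<le> 1 * ?N" "\<bar>f (z $ 2) * ?N\<bar> \<le> 1 * ?N"
    "\<bar>l $ 1 * f (z $ 1) * ?N\<bar> \<le> a * 1 * ?N" "\<bar>f (l $ 1) * z $ 1 * ?N\<bar> \<le> 1 * r * ?N"
    unfolding abs_mult using f assms by (intro mult_mono; auto)+
  moreover have "\<bar>f (l $ 1) * f (z $ 1)\<bar> \<le> 1 * 1" unfolding abs_mult using f by (intro mult_mono) auto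
  ultimately show ?thesis using N unfolding distrib_right by linarith
qed

lemma mem_tube_line:
  assumes "\<bar>l $ 1\<bar> \<le> a" "\<bar>z $ 1\<bar> \<le> r" "3 + a + r \<le> real C" "z $ 2 = l $ 1 * z $ 1 + l $ 2"
  shows "z \<in> tube C m (grid_index m l)"
proof -
  have "real_of_int \<bar>coord2 (grid_index m z) * 2 ^ m - coord1 (grid_index m l) * coord1 (grid_index m z) - coord2 (grid_index m l) * 2 ^ m\<bar> \<le> (3 + a + r) * 2 ^ m"
    using grid_tube_error[OF assms(1,2), of m] assms(4) by simp
  also have "\<dots> \<le> real_of_int (int C * 2 ^ m)"
    using mult_right_mono[OF assms(3), of "2 ^ m"] by simp
  finally show ?thesis unfolding tube_def in_tube_def of_int_le_iff by simp
qed

text \<open>Together with \<open>mem_tube_line\<close> this sandwiches the grid tube between the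
  line and a strip of comparable width, on bounded sets.\<close>

lemma tube_subset_strip:
  assumes "\<bar>l $ 1\<bar> \<le> a" "\<bar>z $ 1\<bar> \<le> r" "3 + a + r \<le> real C" "z \<in> tube C m (grid_index m l)"
  shows "z \<in> strip (l $ 1) (l $ 2) (2 * real C / 2 ^ m)"
proof -
  let ?X = "coord2 (grid_index m z) * 2 ^ m - coord1 (grid_index m l) * coord1 (grid_index m z) - coord2 (grid_index m l) * 2 ^ m"
  let ?d = "z $ 2 - l $ 1 * z $ 1 - l $ 2"
  have "\<bar>?X\<bar> \<le> int C * 2 ^ m" using assms(4) unfolding tube_def in_tube_def by simp
  then have "real_of_int \<bar>?X\<bar> \<le> real_of_int (int C * 2 ^ m)" unfolding of_int_le_iff .
  then have "\<bar>real_of_int ?X\<bar> \<le> real C * 2 ^ m" by (simp only: of_int_abs of_int_mult of_int_of_nat_eq of_int_power of_int_numeral)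
  moreover have "(3 + a + r) * 2 ^ m \<le> real C * 2 ^ m" using assms(3) by (intro mult_right_mono) auto
  ultimately have "\<bar>2 ^ m * (2 ^ m * ?d)\<bar> \<le> 2 * real C * 2 ^ m"
    using grid_tube_error[OF assms(1,2), of m] by linarith
  then have "2 ^ m * (2 ^ m * \<bar>?d\<bar>) \<le> 2 ^ m * (2 * real C)" by (simp add: abs_mult mult_ac)
  then have "2 ^ m * \<bar>?d\<bar> \<le> 2 * real C" by (subst (asm) mult_le_cancel_left_pos) auto
  then show ?thesis unfolding strip_def by (simp add: field_simps)
qed

section \<open>Borel-Cantelli and logarithmic bookkeeping\<close>

lemma AE_eventually_notin:
  assumes "finite_measure M" "\<And>n. A n \<in> sets M" "\<And>n. emeasure M (A n) \<le> ennreal (1 / (real n + 1) ^ 2)"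
  shows "AE x in M. eventually (\<lambda>n. x \<notin> A n) sequentially"
proof -
  interpret finite_measure M by fact
  have "summable (\<lambda>n. inverse (real n ^ 2))" by (rule inverse_power_summable) simp
  then have sum: "summable (\<lambda>n. 1 / (real n + 1) ^ 2)"
    by (subst (asm) summable_Suc_iff[symmetric]) (simp add: inverse_eq_divide add.commute)
  have "measure M (A n) \<le> 1 / (real n + 1) ^ 2" for n
    using assms(3)[of n] by (simp add: emeasure_eq_measure)
  then have "summable (\<lambda>n. measure M (A n))"
    by (intro summable_comparison_test[OF _ sum]) auto
  from borel_cantelli_AE1[OF assms(2) _ this]
  have "AE x in M. eventually (\<lambda>n. x \<in> space M - A n) sequentially"
    by (simp add: less_top[symmetric])
  then show ?thesis by (rule AE_mp) (auto elim: eventually_mono)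
qed

lemma suminf_of_bool_le_1: "(\<Sum>c. ennreal (of_bool (c = (0 :: nat)))) \<le> 1"
proof -
  have "(\<Sum>c. ennreal (of_bool (c = (0 :: nat)))) = (\<Sum>c\<in>{0 :: nat}. ennreal (of_bool (c = 0)))"
    by (rule suminf_finite) auto
  then show ?thesis by simp
qed

lemma suminf_measure_fibres_le_1:
  assumes "prob_space M" and [measurable]: "Z \<in> measurable M (count_space (UNIV :: nat set))"
  shows "(\<Sum>c. ennreal (measure M {\<omega> \<in> space M. Z \<omega> = c})) \<le> 1"
proof -
  interpret prob_space M by fact
  have "(\<Sum>c. ennreal (measure M {\<omega> \<in> space M. Z \<omega> = c})) = (\<Sum>c. emeasure M {\<omega> \<in> space M. Z \<omega> = c})"
    by (simp add: emeasure_eq_measure)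
  also have "\<dots> = emeasure M (\<Union>c. {\<omega> \<in> space M. Z \<omega> = c})"
    by (rule suminf_emeasure) (auto simp: disjoint_family_on_def)
  also have "\<dots> \<le> 1" by (rule emeasure_le_1)
  finally show ?thesis .
qed

text \<open>The case of the trivial condition: \<open>Y\<close> is constantly 0 and
  \<open>\<psi>\<close> is concentrated there. The oracle is arbitrary because Kraft's inequality
  holds relative to every oracle.\<close>

lemma AE_KC_ge:
  fixes Z :: "nat \<Rightarrow> 'a \<Rightarrow> nat" and \<phi> :: "nat \<Rightarrow> nat \<Rightarrow> real"
  assumes "prob_space M" "\<Omega> \<in> sets M" "\<And>n. Z n \<in> measurable M (count_space UNIV)"
    "\<And>n q. measure M {\<omega> \<in> \<Omega>. Z n \<omega> = q} \<le> \<phi> n q"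
  shows "AE \<omega> in M. \<omega> \<in> \<Omega> \<longrightarrow> eventually (\<lambda>n. 1 / (real n + 1) ^ 2 \<le> \<phi> n (Z n \<omega>) * 2 ^ KC A (Z n \<omega>) 0) sequentially"
proof -
  interpret prob_space M by fact
  let ?A = "\<lambda>n. {\<omega> \<in> \<Omega>. \<phi> n (Z n \<omega>) * 2 ^ KC A (Z n \<omega>) 0 < 1 / (real n + 1) ^ 2}"
  have "emeasure M {\<omega> \<in> \<Omega>. Z n \<omega> = q \<and> 0 = c} \<le> ennreal (\<phi> n q * of_bool (c = 0))" for n q and c :: nat
    using assms(4)[of n q] by (cases "c = 0") (auto simp: emeasure_eq_measure intro: ennreal_leI)
  from emeasure_low_complexity[OF assms(3) measurable_const assms(2) this _ suminf_of_bool_le_1,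
      where \<epsilon> = "1 / (real n + 1) ^ 2" and A = A for n]
  have "?A n \<in> sets M" "emeasure M (?A n) \<le> ennreal (1 / (real n + 1) ^ 2)" for n by simp_all
  from AE_eventually_notin[OF finite_measure_axioms this]
  show ?thesis by (rule AE_mp) (auto elim!: eventually_mono simp: not_less)
qed

text \<open>After taking logarithms, \<open>c\<close> and the quadratic factor cost
  \<open>O(log n)\<close>, which disappears on division by \<open>n\<close>.\<close>

lemma liminf_ratio_ge:
  fixes k :: "nat \<Rightarrow> nat"
  assumes "0 < c" and ev: "eventually (\<lambda>n. 1 / (real n + 1) ^ 2 \<le> c * 2 powr (- s * real n) * 2 ^ k n) sequentially"
  shows "ereal s \<le> liminf (\<lambda>n. ereal (real (k n) / real n))"
proof -
  let ?g = "\<lambda>n. (s * real n - 2 * log 2 (real n + 1) - log 2 c) / real n"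
  have "?g \<longlonglongrightarrow> s" by real_asymp
  then have "ereal s = liminf (\<lambda>n. ereal (?g n))"
    by (intro lim_imp_Liminf[symmetric]) (auto simp: trivial_limit_sequentially)
  also have "\<dots> \<le> liminf (\<lambda>n. ereal (real (k n) / real n))"
  proof (rule Liminf_mono)
    show "eventually (\<lambda>n. ereal (?g n) \<le> ereal (real (k n) / real n)) sequentially"
      using ev
    proof eventually_elim
      case (elim n)
      then have "log 2 (1 / (real n + 1) ^ 2) \<le> log 2 (c * 2 powr (- s * real n) * 2 ^ k n)"
        by (intro log_mono) auto
      also have "\<dots> = log 2 c - s * real n + real (k n)"
        using \<open>0 < c\<close> by (simp add: log_mult log_nat_power)
      finally have "s * real n - 2 * log 2 (real n + 1) - log 2 c \<le> real (k n)"
        by (simp add: log_divide log_nat_power)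
      then show ?case by (simp add: divide_right_mono)
    qed
  qed
  finally show ?thesis .
qed

text \<open>Multiplying the three estimates cancels the tube masses \<open>u\<close> and
  \<open>v\<close>; polynomial factors remain.\<close>

lemma KC_log_bound:
  fixes k k1 k2 m n :: nat and u v c :: real
  assumes "2 ^ k * (u * v) \<le> c * (real m + 1) ^ 4" "1 / (2 * (real n + 1) ^ 3) \<le> v * 2 ^ k1"
    "1 / (2 * (real n + 1) ^ 3) \<le> u * 2 ^ k2" "m \<le> n" "2 \<le> n" "0 < c"
  shows "real k \<le> real k1 + real k2 + (\<bar>log 2 c\<bar> + 22) * log 2 (real n)"
proof -
  let ?e = "1 / (2 * (real n + 1) ^ 3)"
  have "0 < ?e" by simp
  then have pos: "0 < u * 2 ^ k2" "0 < v * 2 ^ k1" using assms(2,3) by linarith+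
  have "2 ^ k * (?e * ?e) \<le> 2 ^ k * ((v * 2 ^ k1) * (u * 2 ^ k2))"
    using assms(2,3) \<open>0 < ?e\<close> pos by (intro mult_left_mono mult_mono) auto
  also have "\<dots> = (2 ^ k * (u * v)) * (2 ^ k1 * 2 ^ k2)" by (simp only: mult_ac)
  also have "\<dots> \<le> (c * (real m + 1) ^ 4) * (2 ^ k1 * 2 ^ k2)" by (intro mult_right_mono assms) simp
  also have "\<dots> \<le> (c * (real n + 1) ^ 4) * (2 ^ k1 * 2 ^ k2)"
    using assms(4,6) by (intro mult_right_mono mult_left_mono power_mono) auto
  finally have le: "2 ^ k * (?e * ?e) \<le> (c * (real n + 1) ^ 4) * (2 ^ k1 * 2 ^ k2)" .
  have "log 2 (4 :: real) = 2" using log_pow_cancel[of "2 :: real" 2] by simp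
  then have "log 2 (2 ^ k * (?e * ?e)) = real k - 2 - 6 * log 2 (real n + 1)"
    by (simp add: log_mult log_divide log_nat_power)
  moreover have "log 2 ((c * (real n + 1) ^ 4) * (2 ^ k1 * 2 ^ k2)) = log 2 c + 4 * log 2 (real n + 1) + real k1 + real k2"
    using \<open>0 < c\<close> by (simp add: log_mult log_nat_power)
  moreover have "log 2 (2 ^ k * (?e * ?e)) \<le> log 2 ((c * (real n + 1) ^ 4) * (2 ^ k1 * 2 ^ k2))"
    using le by (intro log_mono) auto
  ultimately have "real k \<le> real k1 + real k2 + (2 + log 2 c + 10 * log 2 (real n + 1))" by linarith
  \<comment> \<open>For \<open>n \<ge> 2\<close> both 1 and half of
    \<open>log 2 (real n + 1)\<close> are at most \<open>log 2 (real n)\<close>, so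
    \<open>2 + 10 * 2 = 22\<close>.\<close>
  also have "2 + log 2 c + 10 * log 2 (real n + 1) \<le> (\<bar>log 2 c\<bar> + 22) * log 2 (real n)"
  proof -
    have n: "2 \<le> real n" using assms(5) by simp
    have 1: "1 \<le> log 2 (real n)" using n by (simp add: le_log_iff)
    have "real n + 1 \<le> 2 * real n" using n by simp
    also have "\<dots> \<le> real n ^ 2" using n by (simp add: power2_eq_square)
    finally have "log 2 (real n + 1) \<le> log 2 (real n ^ 2)" using n by (intro log_mono) auto
    then have 2: "log 2 (real n + 1) \<le> 2 * log 2 (real n)" using n by (simp add: log_nat_power)
    have 3: "\<bar>log 2 c\<bar> * 1 \<le> \<bar>log 2 c\<bar> * log 2 (real n)" by (intro mult_left_mono 1) simp
    show ?thesis using 1 2 3 unfolding distrib_right by linarith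
  qed
  finally show ?thesis by linarith
qed

section \<open>Lower bounds for the random line\<close>

context separated_frostman
begin

text \<open>The width \<open>3 + a + r\<close> of \<open>grid_tube_error\<close> for slopes up to
  \<open>3 * R ^ 3\<close> and abscissas up to \<open>R\<close>.\<close>

definition tube_width :: nat where
  "tube_width = nat \<lceil>3 + 3 * R ^ 3 + R\<rceil>"

lemma tube_width_ge: "3 + 3 * R ^ 3 + R \<le> real tube_width"
  unfolding tube_width_def by (rule real_nat_ceiling_ge)

text \<open>The tube as a function of the full code of the dual square, scale included, so that its
  mass can serve as \<open>\<phi>\<close> in \<open>emeasure_low_complexity\<close>.\<close>

definition line_tube :: "nat \<Rightarrow> nat \<Rightarrow> (real ^ 2) set" where
  "line_tube m q = tube tube_width m (snd (prod_decode q))"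

lemma line_tube_borel [measurable]: "line_tube m q \<in> sets borel"
  unfolding line_tube_def by measurable

definition line_code :: "nat \<Rightarrow> (real ^ 2) \<times> (real ^ 2) \<Rightarrow> nat" where
  "line_code m p = prod_encode (m, grid_index m (line_point (fst p) (snd p)))"

definition point_code :: "nat \<Rightarrow> real ^ 2 \<Rightarrow> nat" where
  "point_code n x = prod_encode (n, grid_index n x)"

lemma measurable_line_code [measurable]: "line_code m \<in> measurable (\<mu> \<Otimes>\<^sub>M \<nu>) (count_space UNIV)"
  unfolding line_code_def by measurable

lemma measurable_point_code [measurable]: "point_code n \<in> measurable borel (count_space UNIV)"
  unfolding point_code_def by measurable

lemma code_defs:
  "Kcond2 A m n (line_point x y) z = KC A (line_code m (x, y)) (point_code n z)"
  "Kcond A m (line_point x y) z = KC A (line_code m (x, y)) (point_code m z)"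
  "K A n (line_point x y) = KC A (line_code n (x, y)) 0"
  by (simp_all add: Kcond2_def Kcond_def K_def cube_code_cube_at line_code_def point_code_def)

lemma mem_line_tube:
  assumes "x \<in> I" "y \<in> J"
  shows "x \<in> line_tube m (line_code m (x, y))" "y \<in> line_tube m (line_code m (x, y))"
proof -
  have "y $ 2 = slope x y * y $ 1 + intercept x y"
    using slope_mult[of y x] coord_neq[OF assms] by (simp add: intercept_def algebra_simps)
  moreover have "x $ 2 = slope x y * x $ 1 + intercept x y" by (simp add: intercept_def)
  ultimately show "x \<in> line_tube m (line_code m (x, y))" "y \<in> line_tube m (line_code m (x, y))"
    using slope_le(2)[OF assms] bounded[of x 1] bounded[of y 1] assms tube_width_ge
    by (auto simp: line_tube_def line_code_def intro!: mem_tube_line)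
qed

lemma line_tube_measure_le:
  assumes "x \<in> I" "y \<in> J"
  shows "measure \<nu> (J \<inter> line_tube m (line_code m (x, y))) \<le> line_measure (2 * real tube_width / 2 ^ m) x y"
  unfolding line_measure_def
proof (rule \<nu>.finite_measure_mono)
  show "J \<inter> line_tube m (line_code m (x, y)) \<subseteq> J \<inter> strip (slope x y) (intercept x y) (2 * real tube_width / 2 ^ m)"
    using tube_subset_strip[of "line_point x y" "3 * R ^ 3" _ R tube_width m]
      slope_le(2)[OF assms] bounded tube_width_ge
    by (auto simp: line_tube_def line_code_def)
qed measurable

text \<open>If the line has code \<open>q\<close>, then \<open>y\<close> lies in the tube of
  \<open>q\<close>. So the event with prescribed codes of the line and of \<open>x\<close> is
  contained in a rectangle whose measure factors, for every precision \<open>n\<close> of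
  \<open>x\<close>.\<close>

lemma low_complexity_given_x:
  fixes A :: "nat set" and m n :: nat and \<epsilon> :: real
  assumes "0 \<le> \<epsilon>"
  defines "B \<equiv> {p \<in> I \<times> J. measure \<nu> (J \<inter> line_tube m (line_code m p)) *
    2 ^ KC A (line_code m p) (point_code n (fst p)) < \<epsilon>}"
  shows "B \<in> sets (\<mu> \<Otimes>\<^sub>M \<nu>)" "P.prob B \<le> \<epsilon>"
proof -
  let ?S = "\<lambda>c. {x \<in> space \<mu>. point_code n x = c}" and ?T = "\<lambda>q. J \<inter> line_tube m q"
  have bound: "emeasure (\<mu> \<Otimes>\<^sub>M \<nu>) {p \<in> I \<times> J. line_code m p = q \<and> point_code n (fst p) = c} \<le>
    ennreal (measure \<nu> (?T q) * measure \<mu> (?S c))" for q c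
  proof -
    have "emeasure (\<mu> \<Otimes>\<^sub>M \<nu>) {p \<in> I \<times> J. line_code m p = q \<and> point_code n (fst p) = c} \<le>
      emeasure (\<mu> \<Otimes>\<^sub>M \<nu>) (?S c \<times> ?T q)"
      using mem_line_tube(2) sets_eq_imp_space_eq[OF sets_\<mu>] by (intro emeasure_mono) auto
    also have "\<dots> = emeasure \<mu> (?S c) * emeasure \<nu> (?T q)"
      by (rule \<nu>.emeasure_pair_measure_Times) measurable
    finally show ?thesis
      by (simp add: \<mu>.emeasure_eq_measure \<nu>.emeasure_eq_measure ennreal_mult[symmetric] mult.commute)
  qed
  have IJ: "I \<times> J \<in> sets (\<mu> \<Otimes>\<^sub>M \<nu>)" by measurable
  have Y: "(\<lambda>p. point_code n (fst p)) \<in> measurable (\<mu> \<Otimes>\<^sub>M \<nu>) (count_space UNIV)" by measurable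
  have sum: "(\<Sum>c. ennreal (measure \<mu> (?S c))) \<le> 1"
    by (rule suminf_measure_fibres_le_1[OF prob_\<mu>]) measurable
  show "B \<in> sets (\<mu> \<Otimes>\<^sub>M \<nu>)" "P.prob B \<le> \<epsilon>"
    unfolding B_def using emeasure_low_complexity[OF measurable_line_code Y IJ bound _ sum assms(1)] assms(1)
    by (simp_all add: P.emeasure_eq_measure)
qed

lemma low_complexity_given_y:
  fixes A :: "nat set" and m n :: nat and \<epsilon> :: real
  assumes "0 \<le> \<epsilon>"
  defines "B \<equiv> {p \<in> I \<times> J. measure \<mu> (I \<inter> line_tube m (line_code m p)) *
    2 ^ KC A (line_code m p) (point_code n (snd p)) < \<epsilon>}"
  shows "B \<in> sets (\<mu> \<Otimes>\<^sub>M \<nu>)" "P.prob B \<le> \<epsilon>"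
proof -
  let ?S = "\<lambda>c. {y \<in> space \<nu>. point_code n y = c}" and ?T = "\<lambda>q. I \<inter> line_tube m q"
  have bound: "emeasure (\<mu> \<Otimes>\<^sub>M \<nu>) {p \<in> I \<times> J. line_code m p = q \<and> point_code n (snd p) = c} \<le>
    ennreal (measure \<mu> (?T q) * measure \<nu> (?S c))" for q c
  proof -
    have "emeasure (\<mu> \<Otimes>\<^sub>M \<nu>) {p \<in> I \<times> J. line_code m p = q \<and> point_code n (snd p) = c} \<le>
      emeasure (\<mu> \<Otimes>\<^sub>M \<nu>) (?T q \<times> ?S c)"
      using mem_line_tube(1) sets_eq_imp_space_eq[OF sets_\<nu>] by (intro emeasure_mono) auto
    also have "\<dots> = emeasure \<mu> (?T q) * emeasure \<nu> (?S c)"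
      by (rule \<nu>.emeasure_pair_measure_Times) measurable
    finally show ?thesis
      by (simp add: \<mu>.emeasure_eq_measure \<nu>.emeasure_eq_measure ennreal_mult[symmetric])
  qed
  have IJ: "I \<times> J \<in> sets (\<mu> \<Otimes>\<^sub>M \<nu>)" by measurable
  have Y: "(\<lambda>p. point_code n (snd p)) \<in> measurable (\<mu> \<Otimes>\<^sub>M \<nu>) (count_space UNIV)" by measurable
  have sum: "(\<Sum>c. ennreal (measure \<nu> (?S c))) \<le> 1"
    by (rule suminf_measure_fibres_le_1[OF prob_\<nu>]) measurable
  show "B \<in> sets (\<mu> \<Otimes>\<^sub>M \<nu>)" "P.prob B \<le> \<epsilon>"
    unfolding B_def using emeasure_low_complexity[OF measurable_line_code Y IJ bound _ sum assms(1)] assms(1)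
    by (simp_all add: P.emeasure_eq_measure)
qed

text \<open>For each \<open>n\<close> there are two exceptional events for every \<open>m \<le> n\<close>; the bound \<open>1 / (2 (n + 1)\<^sup>3)\<close> for
  each of them adds up to the summable \<open>1 / (n + 1)\<^sup>2\<close>.\<close>

definition complexity_given_ends :: "nat set \<Rightarrow> (real ^ 2) \<times> (real ^ 2) \<Rightarrow> nat \<Rightarrow> nat \<Rightarrow> bool" where
  "complexity_given_ends A p n m \<longleftrightarrow>
     1 / (2 * (real n + 1) ^ 3) \<le> measure \<nu> (J \<inter> line_tube m (line_code m p)) * 2 ^ KC A (line_code m p) (point_code m (fst p)) \<and>
     1 / (2 * (real n + 1) ^ 3) \<le> measure \<mu> (I \<inter> line_tube m (line_code m p)) * 2 ^ KC A (line_code m p) (point_code n (snd p))"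

lemma AE_complexity_given_ends:
  "AE p in \<mu> \<Otimes>\<^sub>M \<nu>. p \<in> I \<times> J \<longrightarrow> eventually (\<lambda>n. \<forall>m\<le>n. complexity_given_ends A p n m) sequentially"
proof -
  let ?e = "\<lambda>n. 1 / (2 * (real n + 1) ^ 3)"
  define B1 where "B1 n m = {p \<in> I \<times> J. measure \<nu> (J \<inter> line_tube m (line_code m p)) *
    2 ^ KC A (line_code m p) (point_code m (fst p)) < ?e n}" for n m
  define B2 where "B2 n m = {p \<in> I \<times> J. measure \<mu> (I \<inter> line_tube m (line_code m p)) *
    2 ^ KC A (line_code m p) (point_code n (snd p)) < ?e n}" for n m
  have B [measurable]: "B1 n m \<in> sets (\<mu> \<Otimes>\<^sub>M \<nu>)" "B2 n m \<in> sets (\<mu> \<Otimes>\<^sub>M \<nu>)"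
    and B_le: "P.prob (B1 n m) \<le> ?e n" "P.prob (B2 n m) \<le> ?e n" for n m
    unfolding B1_def B2_def by (intro low_complexity_given_x low_complexity_given_y; simp)+
  let ?A = "\<lambda>n. \<Union>m\<le>n. B1 n m \<union> B2 n m"
  have A_le: "emeasure (\<mu> \<Otimes>\<^sub>M \<nu>) (?A n) \<le> ennreal (1 / (real n + 1) ^ 2)" for n
  proof -
    have "P.prob (B1 n m \<union> B2 n m) \<le> P.prob (B1 n m) + P.prob (B2 n m)" for m
      by (rule measure_Un_le) (rule B)+
    then have "P.prob (B1 n m \<union> B2 n m) \<le> ?e n + ?e n" for m
      using B_le by (meson add_mono order.trans)
    then have "P.prob (?A n) \<le> (\<Sum>m\<le>n. ?e n + ?e n)"
      by (intro order.trans[OF P.finite_measure_subadditive_finite] sum_mono) auto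
    also have "\<dots> = (real n + 1) / (real n + 1) ^ 3" by simp
    also have "\<dots> = 1 / (real n + 1) ^ 2" by (simp add: power2_eq_square power3_eq_cube)
    finally show ?thesis unfolding P.emeasure_eq_measure by (rule ennreal_leI)
  qed
  have "AE p in \<mu> \<Otimes>\<^sub>M \<nu>. eventually (\<lambda>n. p \<notin> ?A n) sequentially"
    by (rule AE_eventually_notin[OF P.finite_measure_axioms _ A_le]) measurable
  then show ?thesis
  proof (rule AE_mp, intro AE_I2 impI)
    fix p assume ev: "eventually (\<lambda>n. p \<notin> ?A n) sequentially" and p: "p \<in> I \<times> J"
    from ev show "eventually (\<lambda>n. \<forall>m\<le>n. complexity_given_ends A p n m) sequentially"
    proof eventually_elim
      case (elim n)
      then have "p \<notin> B1 n m \<and> p \<notin> B2 n m" if "m \<le> n" for m using that by auto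
      then show ?case unfolding complexity_given_ends_def B1_def B2_def using p by (auto simp: not_less)
    qed
  qed
qed

text \<open>Only \<open>y\<close> is random here, so the oracle \<open>B\<close> may depend on
  \<open>x\<close>.\<close>

lemma AE_oracle_complexity:
  assumes x: "x \<in> I"
  shows "AE y in \<nu>. y \<in> J \<longrightarrow> eventually (\<lambda>n. 1 / (real n + 1) ^ 2 \<le>
    measure \<nu> (J \<inter> line_tube n (line_code n (x, y))) * 2 ^ KC B (line_code n (x, y)) 0) sequentially"
proof (rule AE_KC_ge[OF prob_\<nu>])
  show "J \<in> \<nu>.events" by measurable
  have "x \<in> space \<mu>" using sets_eq_imp_space_eq[OF sets_\<mu>] by simp
  then have "Pair x \<in> measurable \<nu> (\<mu> \<Otimes>\<^sub>M \<nu>)" by (rule measurable_Pair1')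
  from measurable_compose[OF this measurable_line_code]
  show "(\<lambda>y. line_code n (x, y)) \<in> measurable \<nu> (count_space UNIV)" for n .
  show "measure \<nu> {y \<in> J. line_code n (x, y) = q} \<le> measure \<nu> (J \<inter> line_tube n q)" for n q
    using mem_line_tube(2)[OF x] by (intro \<nu>.finite_measure_mono) auto
qed

end

definition complexity_bounds :: "nat set \<Rightarrow> real ^ 2 \<Rightarrow> real ^ 2 \<Rightarrow> real ^ 2 \<Rightarrow> bool" where
  "complexity_bounds A x y l \<longleftrightarrow>
     (\<exists>(C\<^sub>1::real) (C\<^sub>2::real) (C\<^sub>3::real) N. \<forall>n\<ge>N.
        (\<forall>m\<le>n. real (K A m l) \<le> real (Kcond A m l x) + real (Kcond2 A m n l y)
                   + C\<^sub>1 * log 2 (real m) + C\<^sub>2 * log 2 (real n)) \<and>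
        real (K A n l) \<le> real (Kcond A n l y) + real (K (with_point A x) n l)
                   + C\<^sub>3 * log 2 (real n))"

context separated_frostman
begin

text \<open>The tube at scale \<open>n\<close> lies in a strip of half-width \<open>O(2^-n)\<close>,
  so its mass is \<open>O(2^(-\<eta> n))\<close>, and low complexity would contradict
  \<open>ev\<close>.\<close>

lemma eff_dim_pos:
  assumes xy: "x \<in> I" "y \<in> J" and "0 < \<eta>"
    and thin: "\<And>\<delta>. 0 < \<delta> \<Longrightarrow> \<delta> \<le> 1 \<Longrightarrow> line_measure \<delta> x y \<le> c * \<delta> powr \<eta>"
    and ev: "eventually (\<lambda>n. 1 / (real n + 1) ^ 2 \<le>
      measure \<nu> (J \<inter> line_tube n (line_code n (x, y))) * 2 ^ KC B (line_code n (x, y)) 0) sequentially"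
  shows "0 < eff_dim B (line_point x y)"
proof -
  let ?w = "2 * real tube_width"
  have "0 < 3 + 3 * R ^ 3 + R" using R by (intro add_pos_pos) auto
  then have w: "0 < ?w" using tube_width_ge by linarith
  \<comment> \<open>The sign of \<open>c\<close> is unknown, and a positive constant is
    required.\<close>
  let ?c = "(\<bar>c\<bar> + 1) * ?w powr \<eta>"
  have "(\<lambda>n. ?w / 2 ^ n) \<longlonglongrightarrow> 0" by (rule LIMSEQ_divide_realpow_zero) simp
  then have "eventually (\<lambda>n. ?w / 2 ^ n < 1) sequentially" by (rule order_tendstoD(2)) simp
  with ev have "eventually (\<lambda>n. 1 / (real n + 1) ^ 2 \<le> ?c * 2 powr (- \<eta> * real n) * 2 ^ KC B (line_code n (x, y)) 0) sequentially"
  proof eventually_elim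
    case (elim n)
    have "measure \<nu> (J \<inter> line_tube n (line_code n (x, y))) \<le> c * (?w / 2 ^ n) powr \<eta>"
      using line_tube_measure_le[OF xy, of n] thin[of "?w / 2 ^ n"] elim(2) w by simp
    also have "\<dots> \<le> (\<bar>c\<bar> + 1) * (?w / 2 ^ n) powr \<eta>" by (intro mult_right_mono) auto
    also have "(?w / 2 ^ n) powr \<eta> = ?w powr \<eta> * 2 powr (- \<eta> * real n)"
    proof -
      have "(2 ^ n :: real) = 2 powr real n" by (simp add: powr_realpow)
      then have "(?w / 2 ^ n) powr \<eta> = ?w powr \<eta> / 2 powr (real n * \<eta>)"
        using w by (simp only: powr_divide powr_powr)
      then show ?thesis by (simp add: powr_minus_divide mult.commute)
    qed
    finally have "measure \<nu> (J \<inter> line_tube n (line_code n (x, y))) \<le> ?c * 2 powr (- \<eta> * real n)"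
      by (simp only: mult.assoc)
    from mult_right_mono[OF this, of "2 ^ KC B (line_code n (x, y)) 0"]
    show ?case by (intro order.trans[OF elim(1)]) simp
  qed
  then have "ereal \<eta> \<le> eff_dim B (line_point x y)"
    unfolding eff_dim_def code_defs using w by (intro liminf_ratio_ge[of ?c]) auto
  then show ?thesis using \<open>0 < \<eta>\<close> by (metis ereal_less(2) less_le_trans)
qed

lemma KC_line_le:
  assumes "computable_measure A \<mu>" "computable_measure A \<nu>"
  shows "\<exists>c>0. \<exists>m0. \<forall>m\<ge>m0. \<forall>x\<in>I. \<forall>y\<in>J.
    2 ^ KC A (line_code m (x, y)) 0 * (measure \<mu> (I \<inter> line_tube m (line_code m (x, y))) *
      measure \<nu> (J \<inter> line_tube m (line_code m (x, y)))) \<le> c * (real m + 1) ^ 4"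
proof -
  define r where "r = nat \<lceil>3 * R ^ 3\<rceil>"
  \<comment> \<open>Turns the separation constant 1 of the locale into the 2 that
    \<open>KC_tube_le\<close> wants; it also serves as threshold for \<open>m\<close>, since
    \<open>S \<le> m < 2 ^ m\<close>.\<close>
  define S where "S = nat \<lceil>2 * R\<rceil>"
  have r: "3 * R ^ 3 \<le> real r" unfolding r_def by (rule real_nat_ceiling_ge)
  have S: "2 * R \<le> real S" unfolding S_def by (rule real_nat_ceiling_ge)
  have "R \<le> R ^ 3" using R by (intro self_le_power) auto
  then have "R \<le> 3 * R ^ 3" using R by linarith
  then have bounded_r: "\<bar>z $ i\<bar> \<le> real r" if "z \<in> I \<union> J" for z i
    using bounded[OF that, of i] r by linarith
  have sep: "2 \<le> real S * \<bar>x $ 1 - y $ 1\<bar>" if "x \<in> I" "y \<in> J" for x y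
    using apart[OF that] mult_right_mono[OF S, of "\<bar>x $ 1 - y $ 1\<bar>"] by simp
  have "\<exists>c>0. \<forall>m q. S \<le> 2 ^ m \<longrightarrow> q < grid_bound r * 4 ^ m \<longrightarrow>
      2 ^ KC A (prod_encode (m, q)) 0 * (measure \<mu> (I \<inter> tube tube_width m q) * measure \<nu> (J \<inter> tube tube_width m q)) \<le> c * (real m + 1) ^ 4"
    by (rule KC_tube_le[OF prob_\<mu> sets_\<mu> assms(1) prob_\<nu> sets_\<nu> assms(2) I_borel J_borel bounded_r sep])
  then obtain c where c: "0 < c \<and> (\<forall>m q. S \<le> 2 ^ m \<longrightarrow> q < grid_bound r * 4 ^ m \<longrightarrow>
      2 ^ KC A (prod_encode (m, q)) 0 * (measure \<mu> (I \<inter> tube tube_width m q) * measure \<nu> (J \<inter> tube tube_width m q)) \<le> c * (real m + 1) ^ 4)" ..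
  show ?thesis
  proof (intro exI[of _ c] exI[of _ S] conjI allI ballI impI)
    show "0 < c" using c ..
    fix m x y assume m: "S \<le> m" and xy: "x \<in> I" "y \<in> J"
    have "m < 2 ^ m" by (rule less_exp)
    then have "S \<le> 2 ^ m" using m by linarith
    moreover have "grid_index m (line_point x y) < grid_bound r * 4 ^ m"
      using slope_le(2,3)[OF xy] r by (intro grid_index_less) auto
    ultimately show "2 ^ KC A (line_code m (x, y)) 0 * (measure \<mu> (I \<inter> line_tube m (line_code m (x, y))) *
      measure \<nu> (J \<inter> line_tube m (line_code m (x, y)))) \<le> c * (real m + 1) ^ 4"
      using c by (simp add: line_code_def line_tube_def)
  qed
qed

text \<open>By Fubini the properties of pairs hold for almost every \<open>x\<close> and then almost
  every \<open>y\<close>. An \<open>x\<close> with a section of \<open>G\<close> of positive measure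
  is fixed first; only then does the oracle statement about \<open>y\<close> make sense as an almost
  sure event.\<close>

lemma exists_pair:
  assumes comp: "computable_measure A \<mu>" "computable_measure A \<nu>"
    and G: "G \<in> sets (\<mu> \<Otimes>\<^sub>M \<nu>)" "G \<subseteq> I \<times> J" "0 < P.prob G" "0 < \<eta>"
    and thin: "\<forall>x y. (x, y) \<in> G \<longrightarrow> (\<exists>c. \<forall>\<delta>. 0 < \<delta> \<longrightarrow> \<delta> \<le> 1 \<longrightarrow> line_measure \<delta> x y \<le> c * \<delta> powr \<eta>)"
    and Qx: "AE x in \<mu>. Q x" and Qy: "AE y in \<nu>. Q' y"
  shows "\<exists>x\<in>I. \<exists>y\<in>J. Q x \<and> Q' y \<and> 0 < eff_dim (with_point A x) (line_point x y) \<and>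
    complexity_bounds A x y (line_point x y)"
proof -
  let ?t = "\<lambda>m p. line_tube m (line_code m p)"
  let ?E = "\<lambda>p n. \<forall>m\<le>n. complexity_given_ends A p n m"
  have "AE x in \<mu>. AE y in \<nu>. (x, y) \<in> I \<times> J \<longrightarrow> eventually (?E (x, y)) sequentially"
    by (rule AE_pair[OF AE_complexity_given_ends])
  with Qx have AE_x: "AE x in \<mu>. Q x \<and> (AE y in \<nu>. (x, y) \<in> I \<times> J \<longrightarrow> eventually (?E (x, y)) sequentially)"
    by (rule AE_conjI)
  have "0 < emeasure (\<mu> \<Otimes>\<^sub>M \<nu>) G" using G(3) by (simp add: P.emeasure_eq_measure)
  then have int: "(\<integral>\<^sup>+ x. emeasure \<nu> (Pair x -` G) \<partial>\<mu>) \<noteq> 0"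
    by (simp add: \<nu>.emeasure_pair_measure_alt[OF G(1)])
  obtain x where x: "emeasure \<nu> (Pair x -` G) \<noteq> 0" "Q x"
    "AE y in \<nu>. (x, y) \<in> I \<times> J \<longrightarrow> eventually (?E (x, y)) sequentially"
  proof (rule ccontr)
    assume no: "\<not> thesis"
    have "AE x in \<mu>. emeasure \<nu> (Pair x -` G) = 0"
      using AE_x by (rule AE_mp) (use no that in blast)
    then have "(\<integral>\<^sup>+ x. emeasure \<nu> (Pair x -` G) \<partial>\<mu>) = 0"
      by (subst nn_integral_0_iff_AE) (auto intro: \<nu>.measurable_emeasure_Pair[OF G(1)])
    with int show False by simp
  qed
  have "Pair x -` G \<noteq> {}" using x(1) by auto
  then have xI: "x \<in> I" using G(2) by blast
  have G_x: "Pair x -` G \<in> sets \<nu>" by (rule sets_Pair1[OF G(1)])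
  have "AE y in \<nu>. Q' y \<and> ((x, y) \<in> I \<times> J \<longrightarrow> eventually (?E (x, y)) sequentially) \<and>
    (y \<in> J \<longrightarrow> eventually (\<lambda>n. 1 / (real n + 1) ^ 2 \<le>
      measure \<nu> (J \<inter> ?t n (x, y)) * 2 ^ KC (with_point A x) (line_code n (x, y)) 0) sequentially)" (is "AE y in \<nu>. ?Y y")
    by (intro AE_conjI Qy x(3) AE_oracle_complexity[OF xI])
  have "\<exists>y. (x, y) \<in> G \<and> ?Y y"
  proof (rule ccontr)
    assume no: "\<not> ?thesis"
    have "AE y in \<nu>. y \<notin> Pair x -` G"
      using \<open>AE y in \<nu>. ?Y y\<close> by (rule AE_mp) (use no in blast)
    then have "emeasure \<nu> (Pair x -` G) = 0"
      using AE_iff_measurable[OF G_x, of "\<lambda>y. y \<notin> Pair x -` G"] sets.sets_into_space[OF G_x] by auto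
    with x(1) show False by simp
  qed
  then obtain y where y: "(x, y) \<in> G" "?Y y" by blast
  then have yJ: "y \<in> J" using G(2) by blast
  have ev1: "eventually (?E (x, y)) sequentially" using y xI yJ by blast
  have ev2: "eventually (\<lambda>n. 1 / (real n + 1) ^ 2 \<le>
      measure \<nu> (J \<inter> ?t n (x, y)) * 2 ^ KC (with_point A x) (line_code n (x, y)) 0) sequentially"
    using y yJ by blast
  obtain c0 where "\<forall>\<delta>. 0 < \<delta> \<longrightarrow> \<delta> \<le> 1 \<longrightarrow> line_measure \<delta> x y \<le> c0 * \<delta> powr \<eta>"
    using thin[rule_format, OF y(1)] ..
  then have dim: "0 < eff_dim (with_point A x) (line_point x y)"
    by (intro eff_dim_pos[OF xI yJ G(4) _ ev2]) blast
  obtain c m0 where c: "0 < c" and upper: "\<And>m. m0 \<le> m \<Longrightarrow>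
    2 ^ KC A (line_code m (x, y)) 0 * (measure \<mu> (I \<inter> ?t m (x, y)) * measure \<nu> (J \<inter> ?t m (x, y))) \<le> c * (real m + 1) ^ 4"
    using KC_line_le[OF comp] xI yJ by metis
  from eventually_conj[OF ev1 ev2] obtain N where N: "\<And>n. N \<le> n \<Longrightarrow> ?E (x, y) n"
    "\<And>n. N \<le> n \<Longrightarrow> 1 / (real n + 1) ^ 2 \<le>
      measure \<nu> (J \<inter> ?t n (x, y)) * 2 ^ KC (with_point A x) (line_code n (x, y)) 0"
    unfolding eventually_sequentially by blast
  \<comment> \<open>The upper bound starts at \<open>m0\<close>. The finitely many smaller
    \<open>m\<close> are absorbed into the constant, as \<open>log 2 (real n)\<close> is at least
    1.\<close>
  define D where "D = (\<Sum>m<m0. real (KC A (line_code m (x, y)) 0))"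
  have D: "real (KC A (line_code m (x, y)) 0) \<le> D" if "m < m0" for m
    unfolding D_def using that by (intro member_le_sum) auto
  have "0 \<le> D" unfolding D_def by (intro sum_nonneg) auto
  define C where "C = \<bar>log 2 c\<bar> + 22 + D"
  have main: "real (KC A (line_code m (x, y)) 0) \<le> real k1 + real k2 + C * log 2 (real n)"
    if "2 \<le> n" "m \<le> n" "1 / (2 * (real n + 1) ^ 3) \<le> measure \<nu> (J \<inter> ?t m (x, y)) * 2 ^ k1"
      "1 / (2 * (real n + 1) ^ 3) \<le> measure \<mu> (I \<inter> ?t m (x, y)) * 2 ^ k2" for m n k1 k2 :: nat
  proof -
    have log1: "1 \<le> log 2 (real n)" using that(1) by (simp add: le_log_iff)
    show ?thesis
    proof (cases "m < m0")
      case True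
      have "D * 1 \<le> D * log 2 (real n)" using \<open>0 \<le> D\<close> by (intro mult_left_mono log1)
      moreover have "0 \<le> (\<bar>log 2 c\<bar> + 22) * log 2 (real n)" using log1 by simp
      ultimately show ?thesis using D[OF True] by (simp add: C_def distrib_right)
    next
      case False
      then have "real (KC A (line_code m (x, y)) 0) \<le> real k1 + real k2 + (\<bar>log 2 c\<bar> + 22) * log 2 (real n)"
        by (intro KC_log_bound[OF upper[of m] that(3,4,2,1) c]) simp
      moreover have "0 \<le> D * log 2 (real n)" using \<open>0 \<le> D\<close> log1 by simp
      ultimately show ?thesis by (simp add: C_def distrib_right)
    qed
  qed
  show ?thesis
  proof (intro bexI[OF _ xI] bexI[OF _ yJ] conjI x(2) dim)
    show "Q' y" using y by blast
    show "complexity_bounds A x y (line_point x y)"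
      unfolding complexity_bounds_def code_defs
    \<comment> \<open>The polynomial in \<open>m\<close> has been enlarged to one in
      \<open>n\<close>, so everything is charged to \<open>log n\<close> and
      \<open>C\<^sub>1\<close> is 0.\<close>
    proof (rule exI[of _ "0 :: real"], rule exI[of _ C], rule exI[of _ C], rule exI[of _ "max 2 N"],
        intro allI impI conjI)
      fix n m assume n: "max 2 N \<le> n" and "m \<le> n"
      then have "real (KC A (line_code m (x, y)) 0) \<le> real (KC A (line_code m (x, y)) (point_code m x)) +
          real (KC A (line_code m (x, y)) (point_code n y)) + C * log 2 (real n)"
        using N(1)[of n] unfolding complexity_given_ends_def by (intro main) auto
      then show "real (KC A (line_code m (x, y)) 0) \<le> real (KC A (line_code m (x, y)) (point_code m x)) +
          real (KC A (line_code m (x, y)) (point_code n y)) + 0 * log 2 (real m) + C * log 2 (real n)" by simp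
    next
      fix n assume n: "max 2 N \<le> n"
      \<comment> \<open>The oracle estimate is weakened to the threshold of \<open>main\<close>,
        with the oracle complexity in the place of the complexity given \<open>x\<close>.\<close>
      have "(real n + 1) ^ 2 \<le> (real n + 1) ^ 3" by (intro power_increasing) auto
      then have "(real n + 1) ^ 2 \<le> 2 * (real n + 1) ^ 3"
        using zero_le_power[of "real n + 1" 3] by linarith
      then have "1 / (2 * (real n + 1) ^ 3) \<le> 1 / (real n + 1) ^ 2"
        by (intro divide_left_mono mult_pos_pos) auto
      also have "\<dots> \<le> measure \<nu> (J \<inter> ?t n (x, y)) * 2 ^ KC (with_point A x) (line_code n (x, y)) 0"
        using N(2)[of n] n by simp
      finally have "real (KC A (line_code n (x, y)) 0) \<le> real (KC (with_point A x) (line_code n (x, y)) 0) +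
          real (KC A (line_code n (x, y)) (point_code n y)) + C * log 2 (real n)"
        using n N(1)[of n] unfolding complexity_given_ends_def by (intro main) auto
      then show "real (KC A (line_code n (x, y)) 0) \<le> real (KC A (line_code n (x, y)) (point_code n y)) +
          real (KC (with_point A x) (line_code n (x, y)) 0) + C * log 2 (real n)" by simp
    qed
  qed
qed

end

section \<open>Reduction to separated sets\<close>

text \<open>The complement of the support is covered by the null sets in a countable basis.\<close>

lemma AE_measure_support:
  fixes \<mu> :: "'a :: second_countable_topology measure"
  assumes "sets \<mu> = sets borel"
  shows "AE x in \<mu>. x \<in> measure_support \<mu>"
proof -
  obtain B :: "'a set set" where B: "countable B" "topological_basis B"
    using ex_countable_basis by blast
  have open_B: "open U" if "U \<in> B" for U using B(2) that by (rule topological_basis_open)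
  have "(\<Union>U\<in>{U \<in> B. emeasure \<mu> U = 0}. U) \<in> null_sets \<mu>"
    using B(1) open_B assms by (intro null_sets_UN') auto
  moreover have "- measure_support \<mu> \<subseteq> (\<Union>U\<in>{U \<in> B. emeasure \<mu> U = 0}. U)"
  proof
    fix x assume "x \<in> - measure_support \<mu>"
    then obtain U where U: "open U" "x \<in> U" "emeasure \<mu> U = 0"
      unfolding measure_support_def by (auto simp: not_less)
    obtain V where V: "V \<in> B" "x \<in> V" "V \<subseteq> U" using topological_basisE[OF B(2) U(1,2)] by blast
    have "emeasure \<mu> V \<le> emeasure \<mu> U" using V U(1) assms by (intro emeasure_mono) auto
    then show "x \<in> (\<Union>U\<in>{U \<in> B. emeasure \<mu> U = 0}. U)" using U(3) V by auto
  qed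
  ultimately show ?thesis by (intro AE_I'[of "\<Union>U\<in>{U \<in> B. emeasure \<mu> U = 0}. U"]) auto
qed

text \<open>Here \<open>\<phi>\<close> is the mass of the square containing the point, which the
  Frostman condition bounds by \<open>O(2^(-s n))\<close>.\<close>

lemma AE_eff_dim_ge:
  assumes "prob_space \<mu>" "sets \<mu> = sets borel" "frostman s \<mu>"
  shows "AE x in \<mu>. ereal s \<le> eff_dim A x"
proof -
  interpret prob_space \<mu> by fact
  have space: "space \<mu> = UNIV" using sets_eq_imp_space_eq[OF assms(2)] by simp
  obtain c where c: "0 < c" "\<And>x r. 0 < r \<Longrightarrow> measure \<mu> (ball x r) \<le> c * r powr s"
    using assms(3) unfolding frostman_def by blast
  let ?Z = "\<lambda>n x. prod_encode (n, grid_index n x)"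
  have Z: "?Z n \<in> measurable \<mu> (count_space UNIV)" for n
    unfolding measurable_cong_sets[OF assms(2) refl] by measurable
  have "AE x in \<mu>. x \<in> space \<mu> \<longrightarrow> eventually (\<lambda>n. 1 / (real n + 1) ^ 2 \<le>
    measure \<mu> {z \<in> space \<mu>. ?Z n z = ?Z n x} * 2 ^ KC A (?Z n x) 0) sequentially"
    by (rule AE_KC_ge[OF assms(1) sets.top Z]) simp
  then show ?thesis
  proof (rule AE_mp, intro AE_I2 impI)
    fix x assume "x \<in> space \<mu> \<longrightarrow> eventually (\<lambda>n. 1 / (real n + 1) ^ 2 \<le>
      measure \<mu> {z \<in> space \<mu>. ?Z n z = ?Z n x} * 2 ^ KC A (?Z n x) 0) sequentially"
    then have ev: "eventually (\<lambda>n. 1 / (real n + 1) ^ 2 \<le>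
      measure \<mu> {z. ?Z n z = ?Z n x} * 2 ^ KC A (?Z n x) 0) sequentially"
      by (simp add: space)
    have square: "measure \<mu> {z. ?Z n z = ?Z n x} \<le> c * 3 powr s * 2 powr (- s * real n)" for n
    proof -
      have "{z. ?Z n z = ?Z n x} \<subseteq> ball x (3 / 2 ^ n)"
      proof
        fix z assume "z \<in> {z. ?Z n z = ?Z n x}"
        then have "grid_index n z = grid_index n x" by simp
        then have "\<lfloor>2 ^ n * z $ 1\<rfloor> = \<lfloor>2 ^ n * x $ 1\<rfloor>" "\<lfloor>2 ^ n * z $ 2\<rfloor> = \<lfloor>2 ^ n * x $ 2\<rfloor>"
          by (metis coord_grid_index)+
        then have "\<bar>2 ^ n * x $ 1 - 2 ^ n * z $ 1\<bar> \<le> 1" "\<bar>2 ^ n * x $ 2 - 2 ^ n * z $ 2\<bar> \<le> 1"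
          by linarith+
        then have "2 ^ n * \<bar>x $ 1 - z $ 1\<bar> \<le> 1" "2 ^ n * \<bar>x $ 2 - z $ 2\<bar> \<le> 1"
          by (simp_all add: abs_mult flip: right_diff_distrib)
        then have "2 ^ n * (\<bar>x $ 1 - z $ 1\<bar> + \<bar>x $ 2 - z $ 2\<bar>) < 3" unfolding distrib_left by linarith
        moreover have "2 ^ n * dist x z \<le> 2 ^ n * (\<bar>x $ 1 - z $ 1\<bar> + \<bar>x $ 2 - z $ 2\<bar>)"
          by (intro mult_left_mono dist_vec2_le) simp
        ultimately have "2 ^ n * dist x z < 3" by linarith
        then show "z \<in> ball x (3 / 2 ^ n)" by (simp add: field_simps)
      qed
      then have "measure \<mu> {z. ?Z n z = ?Z n x} \<le> measure \<mu> (ball x (3 / 2 ^ n))"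
        by (rule finite_measure_mono) (simp add: assms(2))
      also have "\<dots> \<le> c * (3 / 2 ^ n) powr s" by (rule c(2)) simp
      also have "(3 / 2 ^ n) powr s = 3 powr s * 2 powr (- s * real n)"
      proof -
        have "(2 ^ n :: real) = 2 powr real n" by (simp add: powr_realpow)
        then have "(3 / 2 ^ n) powr s = 3 powr s / 2 powr (real n * s)"
          by (simp only: powr_divide powr_powr)
        then show ?thesis by (simp add: powr_minus_divide mult.commute)
      qed
      finally show ?thesis by (simp only: mult.assoc)
    qed
    have "eventually (\<lambda>n. 1 / (real n + 1) ^ 2 \<le> c * 3 powr s * 2 powr (- s * real n) * 2 ^ K A n x) sequentially"
      using ev
    proof eventually_elim
      case (elim n)
      from mult_right_mono[OF square[of n], of "2 ^ K A n x"]
      show ?case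
        by (intro order.trans[OF elim]) (simp add: K_def cube_code_cube_at)
    qed
    then show "ereal s \<le> eff_dim A x"
      unfolding eff_dim_def using c(1) by (intro liminf_ratio_ge) auto
  qed
qed

lemma frostman_weaken:
  fixes \<mu> :: "(real ^ 2) measure"
  assumes "prob_space \<mu>" "frostman s' \<mu>" "0 < s" "s \<le> s'"
  obtains c where "0 < c" "\<And>x r. 0 < r \<Longrightarrow> measure \<mu> (ball x r) \<le> c * r powr s"
proof -
  interpret prob_space \<mu> by fact
  obtain c where c: "0 < c" "\<And>x r. 0 < r \<Longrightarrow> measure \<mu> (ball x r) \<le> c * r powr s'"
    using assms(2) unfolding frostman_def by blast
  have "measure \<mu> (ball x r) \<le> (c + 1) * r powr s" if "0 < r" for x r
  proof (cases "r \<le> 1")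
    case True
    have "measure \<mu> (ball x r) \<le> c * r powr s'" by (rule c(2)[OF that])
    also have "\<dots> \<le> (c + 1) * r powr s"
      using True that c(1) assms(4) by (intro mult_mono powr_mono') auto
    finally show ?thesis .
  next
    case False
    then have "1 \<le> r powr s" using assms(3) by (intro ge_one_powr_ge_zero) auto
    then have "1 * 1 \<le> (c + 1) * r powr s" using c(1) by (intro mult_mono) auto
    then show ?thesis using prob_le_1[of "ball x r"] by linarith
  qed
  then show thesis using c(1) that[of "c + 1"] by auto
qed

text \<open>Two different lines share at most one point; this makes their intersection
  negligible.\<close>

lemma frostman_point_null:
  fixes \<mu> :: "(real ^ 2) measure"
  assumes "prob_space \<mu>" "sets \<mu> = sets borel" "frostman s \<mu>" "0 < s"
    and S: "\<And>a b. a \<in> S \<Longrightarrow> b \<in> S \<Longrightarrow> a = b"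
  shows "measure \<mu> S = 0"
proof (rule ccontr)
  interpret prob_space \<mu> by fact
  obtain c where c: "0 < c" "\<And>x r. 0 < r \<Longrightarrow> measure \<mu> (ball x r) \<le> c * r powr s"
    using assms(3) unfolding frostman_def by blast
  assume "measure \<mu> S \<noteq> 0"
  then have pos: "0 < measure \<mu> S" by (simp add: zero_less_measure_iff)
  \<comment> \<open>Chosen so that \<open>c * r powr s\<close> is half the supposed mass.\<close>
  define r where "r = (measure \<mu> S / (2 * c)) powr (1 / s)"
  have r: "0 < r" using pos c(1) by (simp add: r_def)
  have "dist a b < r" if "a \<in> S" "b \<in> S" for a b
    using S[OF that] r by simp
  then have "measure \<mu> S \<le> c * r powr s"
    using r c(1) by (intro frostman_measure_le[OF finite_measure_axioms assms(2) c(2)]) auto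
  also have "\<dots> = measure \<mu> S / 2"
    using pos c(1) assms(4) by (simp add: r_def powr_powr)
  finally show False using pos by simp
qed

section \<open>Lines in parametric form and the choice of \<open>I\<close> and
  \<open>J\<close>\<close>

definition line_through :: "real ^ 2 \<Rightarrow> real ^ 2 \<Rightarrow> (real ^ 2) set" where
  "line_through p v = affine hull {p, p + v}"

lemma mem_line_through: "z \<in> line_through p v \<longleftrightarrow> (\<exists>t. z = p + t *\<^sub>R v)"
proof
  assume "z \<in> line_through p v"
  then obtain u t where z: "z = u *\<^sub>R p + t *\<^sub>R (p + v)" "u + t = 1"
    unfolding line_through_def affine_hull_2 by blast
  have "z = (u + t) *\<^sub>R p + t *\<^sub>R v" by (simp add: z(1) algebra_simps)
  then show "\<exists>t. z = p + t *\<^sub>R v" using z(2) by auto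
next
  assume "\<exists>t. z = p + t *\<^sub>R v"
  then obtain t where "z = p + t *\<^sub>R v" ..
  then have "z = (1 - t) *\<^sub>R p + t *\<^sub>R (p + v)" by (simp add: algebra_simps)
  then show "z \<in> line_through p v" unfolding line_through_def affine_hull_2 by force
qed

lemma is_line_line_through: "v \<noteq> 0 \<Longrightarrow> is_line (line_through p v)"
  unfolding is_line_def line_through_def by (simp add: aff_dim_affine_hull aff_dim_2)

lemma line_through_borel [measurable]: "line_through p v \<in> sets borel"
  unfolding line_through_def by (intro borel_closed closed_affine_hull)

lemma line_through_eq:
  assumes "a \<in> line_through p v" "b \<in> line_through p v" "a \<noteq> b"
  shows "line_through p v = line_through a (b - a)"
proof -
  obtain s t where st: "a = p + s *\<^sub>R v" "b = p + t *\<^sub>R v" using assms mem_line_through by metis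
  then have "t - s \<noteq> 0" using assms(3) by auto
  have ba: "b - a = (t - s) *\<^sub>R v" by (simp add: st algebra_simps)
  show ?thesis
  proof (intro set_eqI iffI)
    fix z assume "z \<in> line_through p v"
    then obtain w where "z = p + w *\<^sub>R v" using mem_line_through by metis
    moreover have "(w - s) / (t - s) * (t - s) = w - s" using \<open>t - s \<noteq> 0\<close> by simp
    ultimately have "z = a + ((w - s) / (t - s)) *\<^sub>R (b - a)"
      unfolding ba scaleR_scaleR by (simp only: st(1)) (simp add: scaleR_left_diff_distrib)
    then show "z \<in> line_through a (b - a)" using mem_line_through by blast
  next
    fix z assume "z \<in> line_through a (b - a)"
    then obtain w where "z = a + w *\<^sub>R (b - a)" using mem_line_through by metis
    then have "z = p + (s + w * (t - s)) *\<^sub>R v"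
      unfolding ba by (simp add: st(1) algebra_simps)
    then show "z \<in> line_through p v" using mem_line_through by blast
  qed
qed

lemma vertical_line: "{z :: real ^ 2. z $ 1 = a} = line_through (vector [a, 0]) (vector [0, 1])"
  by (auto simp: mem_line_through vec_eq_iff forall_2)

lemma strip_0_eq_line: "strip a b 0 = line_through (vector [0, b]) (vector [1, a])"
  by (auto simp: mem_line_through vec_eq_iff forall_2 strip_def algebra_simps)

lemma vector_1_neq_0: "vector [0, 1] \<noteq> (0 :: real ^ 2)" "vector [1, a] \<noteq> (0 :: real ^ 2)"
  by (auto simp: vec_eq_iff forall_2)

text \<open>The plane is cut into vertical strips of width \<open>1 / N\<close>, and two
  non-adjacent ones of positive mass are sought. If there were none for any \<open>N\<close>, then
  for a typical \<open>x\<close> all of the mass of \<open>\<nu>\<close> on \<open>J\<^sub>0\<close>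
  would sit on the vertical line through \<open>x\<close>.\<close>

lemma separated_subsets:
  fixes \<mu> \<nu> :: "(real ^ 2) measure"
  assumes \<mu>: "prob_space \<mu>" "sets \<mu> = sets borel" and \<nu>: "prob_space \<nu>" "sets \<nu> = sets borel"
    and I0: "I\<^sub>0 \<in> sets borel" "0 < measure \<mu> I\<^sub>0" and J0: "J\<^sub>0 \<in> sets borel" "0 < measure \<nu> J\<^sub>0"
    and bounded: "bounded (I\<^sub>0 \<union> J\<^sub>0)"
    and null: "\<And>x. x \<in> I\<^sub>0 \<Longrightarrow> measure \<nu> {y \<in> J\<^sub>0. y $ 1 = x $ 1} = 0"
  obtains I J R where "I \<in> sets borel" "I \<subseteq> I\<^sub>0" "0 < measure \<mu> I" "J \<in> sets borel" "J \<subseteq> J\<^sub>0" "0 < measure \<nu> J"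
    "1 \<le> R" "\<And>z i. z \<in> I \<union> J \<Longrightarrow> \<bar>z $ i\<bar> \<le> R" "\<And>x y. x \<in> I \<Longrightarrow> y \<in> J \<Longrightarrow> 1 \<le> R * \<bar>x $ 1 - y $ 1\<bar>"
proof -
  interpret \<mu>: prob_space \<mu> by fact
  interpret \<nu>: prob_space \<nu> by fact
  define S where "S N i = {z :: real ^ 2. \<lfloor>real N * z $ 1\<rfloor> = i}" for N :: nat and i :: int
  have S [measurable]: "S N i \<in> sets borel" for N i unfolding S_def by measurable
  note I0(1) [measurable] J0(1) [measurable]
  have "\<exists>N i j. 2 \<le> \<bar>i - j\<bar> \<and> 0 < measure \<mu> (I\<^sub>0 \<inter> S N i) \<and> 0 < measure \<nu> (J\<^sub>0 \<inter> S N j)"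
  proof (rule ccontr)
    assume no: "\<not> ?thesis"
    \<comment> \<open>There are countably many strips, so almost every \<open>x\<close> avoids all
      null ones; every strip containing such a point of \<open>I\<^sub>0\<close> then has positive
      mass.\<close>
    have "AE x in \<mu>. \<forall>N i. measure \<mu> (I\<^sub>0 \<inter> S N i) = 0 \<longrightarrow> x \<notin> I\<^sub>0 \<inter> S N i"
      unfolding AE_all_countable
    proof (intro allI)
      fix N i
      show "AE x in \<mu>. measure \<mu> (I\<^sub>0 \<inter> S N i) = 0 \<longrightarrow> x \<notin> I\<^sub>0 \<inter> S N i"
      proof (cases "measure \<mu> (I\<^sub>0 \<inter> S N i) = 0")
        case True
        then have "I\<^sub>0 \<inter> S N i \<in> null_sets \<mu>"
          using I0(1) S \<mu>(2) by (intro null_setsI) (auto simp: \<mu>.emeasure_eq_measure)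
        then show ?thesis by (auto dest: AE_not_in)
      qed simp
    qed
    note good = this
    have "\<not> (AE x in \<mu>. x \<notin> I\<^sub>0)"
      using I0 \<mu>(2) AE_iff_measurable[of I\<^sub>0 \<mu> "\<lambda>x. x \<notin> I\<^sub>0"] sets_eq_imp_space_eq[OF \<mu>(2)]
      by (auto simp: \<mu>.emeasure_eq_measure)
    have "\<exists>x\<in>I\<^sub>0. \<forall>N i. measure \<mu> (I\<^sub>0 \<inter> S N i) = 0 \<longrightarrow> x \<notin> I\<^sub>0 \<inter> S N i"
    proof (rule ccontr)
      assume no_x: "\<not> ?thesis"
      have "AE x in \<mu>. x \<notin> I\<^sub>0"
        by (rule AE_mp[OF good], rule AE_I2) (use no_x in blast)
      with \<open>\<not> (AE x in \<mu>. x \<notin> I\<^sub>0)\<close> show False ..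
    qed
    then obtain x where x: "x \<in> I\<^sub>0" "\<forall>N i. measure \<mu> (I\<^sub>0 \<inter> S N i) = 0 \<longrightarrow> x \<notin> I\<^sub>0 \<inter> S N i"
      by (rule bexE)
    have x_pos: "0 < measure \<mu> (I\<^sub>0 \<inter> S N \<lfloor>real N * x $ 1\<rfloor>)" for N
    proof -
      have "x \<in> S N \<lfloor>real N * x $ 1\<rfloor>" by (simp add: S_def)
      then have "measure \<mu> (I\<^sub>0 \<inter> S N \<lfloor>real N * x $ 1\<rfloor>) \<noteq> 0" using x by blast
      then show ?thesis by (simp only: zero_less_measure_iff not_False_eq_True)
    qed
    let ?F = "{(N, j). 2 \<le> \<bar>\<lfloor>real N * x $ 1\<rfloor> - j\<bar>}"
    have "J\<^sub>0 \<inter> S N j \<in> null_sets \<nu>" if "(N, j) \<in> ?F" for N j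
      using no x_pos[of N] that J0(1) S \<nu>(2)
      by (intro null_setsI) (auto simp: \<nu>.emeasure_eq_measure zero_less_measure_iff)
    then have "(\<Union>p\<in>?F. J\<^sub>0 \<inter> S (fst p) (snd p)) \<in> null_sets \<nu>"
      by (intro null_sets_UN') auto
    moreover have "{y \<in> J\<^sub>0. y $ 1 = x $ 1} \<in> null_sets \<nu>"
    proof (rule null_setsI)
      show "emeasure \<nu> {y \<in> J\<^sub>0. y $ 1 = x $ 1} = 0" using null[OF x(1)] by (simp add: \<nu>.emeasure_eq_measure)
      have "{y \<in> J\<^sub>0. y $ 1 = x $ 1} = J\<^sub>0 \<inter> {y \<in> space borel. y $ 1 = x $ 1}" by auto
      also have "\<dots> \<in> sets borel" by measurable
      finally show "{y \<in> J\<^sub>0. y $ 1 = x $ 1} \<in> \<nu>.events" using \<nu>(2) by simp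
    qed
    ultimately have U: "(\<Union>p\<in>?F. J\<^sub>0 \<inter> S (fst p) (snd p)) \<union> {y \<in> J\<^sub>0. y $ 1 = x $ 1} \<in> null_sets \<nu>"
      by (rule null_sets.Un)
    have sub: "J\<^sub>0 \<subseteq> (\<Union>p\<in>?F. J\<^sub>0 \<inter> S (fst p) (snd p)) \<union> {y \<in> J\<^sub>0. y $ 1 = x $ 1}"
    proof
      fix y assume y: "y \<in> J\<^sub>0"
      show "y \<in> (\<Union>p\<in>?F. J\<^sub>0 \<inter> S (fst p) (snd p)) \<union> {y \<in> J\<^sub>0. y $ 1 = x $ 1}"
      proof (cases "y $ 1 = x $ 1")
        case False
        \<comment> \<open>A scaled distance above 3 forces the integer parts to differ by at least
          2.\<close>
        obtain N :: nat where "3 / \<bar>x $ 1 - y $ 1\<bar> < real N" using reals_Archimedean2 by blast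
        then have "3 < real N * \<bar>x $ 1 - y $ 1\<bar>" using False by (simp add: field_simps)
        then have "3 < \<bar>real N * x $ 1 - real N * y $ 1\<bar>"
          by (simp add: abs_mult flip: right_diff_distrib)
        then have "2 \<le> \<bar>\<lfloor>real N * x $ 1\<rfloor> - \<lfloor>real N * y $ 1\<rfloor>\<bar>" by linarith
        then have "(N, \<lfloor>real N * y $ 1\<rfloor>) \<in> ?F" by simp
        then have "y \<in> (\<Union>p\<in>?F. J\<^sub>0 \<inter> S (fst p) (snd p))"
          by (rule UN_I) (simp add: S_def y)
        then show ?thesis by (rule UnI1)
      qed (use y in simp)
    qed
    have "J\<^sub>0 \<in> sets \<nu>" by (simp only: \<nu>(2) J0(1))
    from null_sets_subset[OF U this sub] have "J\<^sub>0 \<in> null_sets \<nu>" .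
    then show False using J0(2) by (simp add: measure_def null_setsD1)
  qed
  then obtain N i j where Nij: "2 \<le> \<bar>i - j\<bar>" "0 < measure \<mu> (I\<^sub>0 \<inter> S N i)" "0 < measure \<nu> (J\<^sub>0 \<inter> S N j)"
    by blast
  obtain b where b: "\<And>z. z \<in> I\<^sub>0 \<union> J\<^sub>0 \<Longrightarrow> norm z \<le> b" using bounded unfolding bounded_iff by blast
  define R where "R = max 1 (max b (real N))"
  show thesis
  proof (rule that[of "I\<^sub>0 \<inter> S N i" "J\<^sub>0 \<inter> S N j" R])
    show "\<bar>z $ k\<bar> \<le> R" if "z \<in> I\<^sub>0 \<inter> S N i \<union> J\<^sub>0 \<inter> S N j" for z k
      using b[of z] that component_le_norm_cart[of z k] unfolding R_def by auto
    show "1 \<le> R * \<bar>x $ 1 - y $ 1\<bar>" if "x \<in> I\<^sub>0 \<inter> S N i" "y \<in> J\<^sub>0 \<inter> S N j" for x y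
    proof -
      have "\<lfloor>real N * x $ 1\<rfloor> = i" "\<lfloor>real N * y $ 1\<rfloor> = j" using that by (auto simp: S_def)
      then have "1 \<le> \<bar>real N * x $ 1 - real N * y $ 1\<bar>" using Nij(1) by linarith
      also have "\<dots> = real N * \<bar>x $ 1 - y $ 1\<bar>" by (simp add: abs_mult flip: right_diff_distrib)
      also have "\<dots> \<le> R * \<bar>x $ 1 - y $ 1\<bar>" unfolding R_def by (intro mult_right_mono) auto
      finally show ?thesis .
    qed
  qed (use Nij in \<open>auto simp: R_def\<close>)
qed

lemma (in separated_frostman) prob_Times: "P.prob (I \<times> J) = \<mu>.prob I * \<nu>.prob J"
proof -
  have "ennreal (P.prob (I \<times> J)) = ennreal (\<mu>.prob I * \<nu>.prob J)"
    using \<nu>.emeasure_pair_measure_Times[of I \<mu> J] I_borel J_borel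
    by (simp add: P.emeasure_eq_measure \<mu>.emeasure_eq_measure \<nu>.emeasure_eq_measure sets_\<mu> sets_\<nu> ennreal_mult)
  then show ?thesis by simp
qed

lemma exists_separated_frostman:
  fixes \<mu> \<nu> :: "(real ^ 2) measure" and s cF :: real
  assumes \<mu>: "prob_space \<mu>" "sets \<mu> = sets borel" and \<nu>: "prob_space \<nu>" "sets \<nu> = sets borel"
    and s: "0 < s" "0 < cF"
    and frost: "\<And>x r. 0 < r \<Longrightarrow> measure \<mu> (ball x r) \<le> cF * r powr s"
      "\<And>x r. 0 < r \<Longrightarrow> measure \<nu> (ball x r) \<le> cF * r powr s"
    and "I\<^sub>0 \<in> sets borel" "0 < measure \<mu> I\<^sub>0" "J\<^sub>0 \<in> sets borel" "0 < measure \<nu> J\<^sub>0"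
    and "bounded (I\<^sub>0 \<union> J\<^sub>0)"
    and "\<And>x. x \<in> I\<^sub>0 \<Longrightarrow> measure \<nu> {y \<in> J\<^sub>0. y $ 1 = x $ 1} = 0"
  obtains I J R where "separated_frostman \<mu> \<nu> I J s cF R" "I \<subseteq> I\<^sub>0" "J \<subseteq> J\<^sub>0"
    "0 < measure (\<mu> \<Otimes>\<^sub>M \<nu>) (I \<times> J)"
proof (rule separated_subsets[OF \<mu> \<nu> assms(9-14)])
  fix I J R
  assume IJ: "I \<in> sets borel" "I \<subseteq> I\<^sub>0" "0 < measure \<mu> I" "J \<in> sets borel" "J \<subseteq> J\<^sub>0" "0 < measure \<nu> J"
    "1 \<le> R" "\<And>z i. z \<in> I \<union> J \<Longrightarrow> \<bar>z $ i\<bar> \<le> R" "\<And>x y. x \<in> I \<Longrightarrow> y \<in> J \<Longrightarrow> 1 \<le> R * \<bar>x $ 1 - y $ 1\<bar>"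
  interpret separated_frostman \<mu> \<nu> I J s cF R
    by (intro separated_frostman.intro \<mu> \<nu> s frost IJ)
  show thesis
  proof (rule that)
    show "separated_frostman \<mu> \<nu> I J s cF R" by unfold_locales
    show "0 < measure (\<mu> \<Otimes>\<^sub>M \<nu>) (I \<times> J)" using IJ by (simp add: prob_Times)
  qed (use IJ in auto)
qed

text \<open>The dichotomy is asymmetric because the strip estimate concerns \<open>\<nu>\<close>
  only. When every line charged by \<open>\<nu>\<close> has full \<open>\<mu>\<close>-measure, there
  is at most one such line, and removing it leaves a set \<open>J\<^sub>0\<close> on which all lines
  are null.\<close>

lemma exists_thin_strips:
  fixes \<mu> \<nu> :: "(real ^ 2) measure" and s cF :: real
  assumes \<mu>: "prob_space \<mu>" "sets \<mu> = sets borel" and \<nu>: "prob_space \<nu>" "sets \<nu> = sets borel"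
    and s: "0 < s" "0 < cF"
    and frost: "\<And>x r. 0 < r \<Longrightarrow> measure \<mu> (ball x r) \<le> cF * r powr s"
      "\<And>x r. 0 < r \<Longrightarrow> measure \<nu> (ball x r) \<le> cF * r powr s"
    and X: "compact X" "measure \<mu> X = 1" and Y: "compact Y" "measure \<nu> Y = 1"
    and lines: "\<And>l. is_line l \<Longrightarrow> measure \<mu> l * measure \<nu> l < 1"
  obtains I J R G \<eta> where "separated_frostman \<mu> \<nu> I J s cF R" "I \<subseteq> X" "J \<subseteq> Y"
    "G \<in> sets (\<mu> \<Otimes>\<^sub>M \<nu>)" "G \<subseteq> I \<times> J" "0 < measure (\<mu> \<Otimes>\<^sub>M \<nu>) G" "0 < \<eta>"
    "\<And>x y. (x, y) \<in> G \<Longrightarrow> \<exists>c. \<forall>\<delta>. 0 < \<delta> \<longrightarrow> \<delta> \<le> 1 \<longrightarrow>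
       separated_frostman.line_measure \<nu> J \<delta> x y \<le> c * \<delta> powr \<eta>"
proof -
  interpret \<mu>: prob_space \<mu> by fact
  interpret \<nu>: prob_space \<nu> by fact
  have frostman: "frostman s \<mu>" "frostman s \<nu>" unfolding frostman_def using s frost by blast+
  have XY_borel: "X \<in> sets borel" "Y \<in> sets borel"
    using X(1) Y(1) by (auto intro: borel_closed compact_imp_closed)
  have XY_bounded: "bounded X" "bounded Y" using X(1) Y(1) by (auto intro: compact_imp_bounded)
  have line_sets: "line_through p v \<in> sets \<mu>" "line_through p v \<in> sets \<nu>" for p v
    unfolding \<mu>(2) \<nu>(2) by (rule line_through_borel)+
  have Xs: "X \<in> sets \<mu>" and Ys: "Y \<in> sets \<nu>" unfolding \<mu>(2) \<nu>(2) by (rule XY_borel)+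
  have "AE y in \<nu>. y \<in> Y" using \<nu>.prob_eq_1[OF Ys] Y(2) by simp
  then have full_Int: "measure \<nu> (Y \<inter> S) = measure \<nu> S" if "S \<in> sets \<nu>" for S
    using Ys that by (intro \<nu>.finite_measure_eq_AE) auto
  show thesis
  proof (cases "\<exists>p v. v \<noteq> 0 \<and> 0 < measure \<nu> (line_through p v) \<and> measure \<mu> (line_through p v) < 1")
    case True
    then obtain p v where pv: "v \<noteq> 0" "0 < measure \<nu> (line_through p v)" "measure \<mu> (line_through p v) < 1" by blast
    let ?L = "line_through p v"
    have "measure \<mu> X - measure \<mu> ?L \<le> measure \<mu> (X - ?L)"
      using \<mu>.finite_measure_mono[of X "(X - ?L) \<union> ?L"] measure_Un_le[of "X - ?L" \<mu> ?L] Xs line_sets by auto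
    then have pos: "0 < measure \<mu> (X - ?L)" using pv(3) X(2) by linarith
    \<comment> \<open>A point \<open>x\<close> off \<open>?L\<close> rules out that
      \<open>?L\<close> is the vertical line through \<open>x\<close>, so the two lines share at
      most one point.\<close>
    have null: "measure \<nu> {y \<in> Y \<inter> ?L. y $ 1 = x $ 1} = 0" if x: "x \<in> X - ?L" for x
    proof (rule frostman_point_null[OF \<nu> frostman(2) s(1)], rule ccontr)
      fix a b assume ab: "a \<in> {y \<in> Y \<inter> ?L. y $ 1 = x $ 1}" "b \<in> {y \<in> Y \<inter> ?L. y $ 1 = x $ 1}" "a \<noteq> b"
      have "{z :: real ^ 2. z $ 1 = x $ 1} = line_through a (b - a)"
        unfolding vertical_line using ab by (intro line_through_eq) (auto simp flip: vertical_line)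
      moreover have "?L = line_through a (b - a)" using ab by (intro line_through_eq) auto
      ultimately show False using x by blast
    qed
    obtain I J R where IJ: "separated_frostman \<mu> \<nu> I J s cF R" "I \<subseteq> X - ?L" "J \<subseteq> Y \<inter> ?L"
      "0 < measure (\<mu> \<Otimes>\<^sub>M \<nu>) (I \<times> J)"
    proof (rule exists_separated_frostman[OF \<mu> \<nu> s frost _ pos _ _ _ null])
      show "X - ?L \<in> sets borel" "Y \<inter> ?L \<in> sets borel"
        using XY_borel line_through_borel by (auto intro: sets.Diff sets.Int)
      show "0 < measure \<nu> (Y \<inter> ?L)" unfolding full_Int[OF line_sets(2)] by (rule pv(2))
      show "bounded (X - ?L \<union> Y \<inter> ?L)" using XY_bounded by (auto intro: bounded_subset)
    qed
    interpret separated_frostman \<mu> \<nu> I J s cF R by (rule IJ(1))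
    show thesis
    proof (rule that[OF IJ(1) _ _ _ order_refl IJ(4) s(1)])
      show "I \<times> J \<in> sets (\<mu> \<Otimes>\<^sub>M \<nu>)" by measurable
      fix x y assume "(x, y) \<in> I \<times> J"
      then show "\<exists>c. \<forall>\<delta>. 0 < \<delta> \<longrightarrow> \<delta> \<le> 1 \<longrightarrow> line_measure \<delta> x y \<le> c * \<delta> powr s"
        using IJ(2,3) pv(1) mem_line_through by (intro thin_strips_line[of p v]) blast+
    qed (use IJ in auto)
  next
    case False
    then have full: "measure \<mu> (line_through p v) = 1" if "v \<noteq> 0" "0 < measure \<nu> (line_through p v)" for p v
      using that \<mu>.prob_le_1[of "line_through p v"] by (metis less_eq_real_def)
    obtain J\<^sub>0 where J0: "J\<^sub>0 \<in> sets borel" "J\<^sub>0 \<subseteq> Y" "0 < measure \<nu> J\<^sub>0"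
      "\<And>p v. v \<noteq> 0 \<Longrightarrow> measure \<nu> (J\<^sub>0 \<inter> line_through p v) = 0"
    proof (cases "\<exists>p v. v \<noteq> 0 \<and> 0 < measure \<nu> (line_through p v)")
      case True
      then obtain p v where pv: "v \<noteq> 0" "0 < measure \<nu> (line_through p v)" by blast
      let ?L = "line_through p v"
      \<comment> \<open>\<open>?L\<close> has full \<open>\<mu>\<close>-measure in this case, so the
        hypothesis on lines leaves some mass of \<open>\<nu>\<close> outside
        \<open>?L\<close>.\<close>
      have "measure \<nu> ?L < 1" using lines[OF is_line_line_through[OF pv(1)], of p] full[OF pv] by simp
      moreover have "measure \<nu> Y - measure \<nu> ?L \<le> measure \<nu> (Y - ?L)"
        using \<nu>.finite_measure_mono[of Y "(Y - ?L) \<union> ?L"] measure_Un_le[of "Y - ?L" \<nu> ?L] Ys line_sets by auto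
      ultimately have pos: "0 < measure \<nu> (Y - ?L)" using Y(2) by linarith
      show thesis
      proof (rule that[OF _ _ pos])
        show "Y - ?L \<in> sets borel" using XY_borel line_through_borel by (auto intro: sets.Diff)
        fix q w :: "real ^ 2" assume "w \<noteq> 0"
        let ?M = "line_through q w"
        show "measure \<nu> ((Y - ?L) \<inter> ?M) = 0"
        proof (rule ccontr)
          assume ne: "measure \<nu> ((Y - ?L) \<inter> ?M) \<noteq> 0"
          then have "0 < measure \<nu> ((Y - ?L) \<inter> ?M)" by (simp add: zero_less_measure_iff)
          also have "\<dots> \<le> measure \<nu> ?M" by (intro \<nu>.finite_measure_mono line_sets) auto
          finally have M: "measure \<mu> ?M = 1" by (rule full[OF \<open>w \<noteq> 0\<close>])
          \<comment> \<open>A second charged line would also have full \<open>\<mu>\<close>-measure,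
            and so would its intersection with \<open>?L\<close>; but this has at most one
            point.\<close>
          have "?L \<noteq> ?M"
          proof
            assume "?L = ?M"
            then have "(Y - ?L) \<inter> ?M = {}" by blast
            with ne show False by simp
          qed
          then have "a = b" if "a \<in> ?L \<inter> ?M" "b \<in> ?L \<inter> ?M" for a b
            using line_through_eq[of a p v b] line_through_eq[of a q w b] that by blast
          then have "measure \<mu> (?L \<inter> ?M) = 0"
            by (rule frostman_point_null[OF \<mu> frostman(1) s(1)])
          moreover have "measure \<mu> (?L \<union> ?M) = measure \<mu> ?L + measure \<mu> ?M - measure \<mu> (?L \<inter> ?M)"
            using measure_Un3[of ?L \<mu> ?M] line_sets \<mu>.fmeasurable_eq_sets by simp
          ultimately show False using full[OF pv] M \<mu>.prob_le_1[of "?L \<union> ?M"] by simp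
        qed
      qed auto
    next
      case False
      then have "measure \<nu> (line_through p v) = 0" if "v \<noteq> 0" for p v
        using that by (metis zero_less_measure_iff)
      then have "measure \<nu> (Y \<inter> line_through p v) = 0" if "v \<noteq> 0" for p v
        using that full_Int line_sets by simp
      then show thesis using XY_borel Y(2) by (intro that[of Y]) auto
    qed
    obtain I J R where IJ: "separated_frostman \<mu> \<nu> I J s cF R" "I \<subseteq> X" "J \<subseteq> J\<^sub>0"
      "0 < measure (\<mu> \<Otimes>\<^sub>M \<nu>) (I \<times> J)"
    proof (rule exists_separated_frostman[OF \<mu> \<nu> s frost XY_borel(1) _ J0(1,3)])
      show "0 < measure \<mu> X" using X(2) by simp
      show "bounded (X \<union> J\<^sub>0)" using XY_bounded J0(2) by (auto intro: bounded_subset)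
      fix x :: "real ^ 2"
      have "{y \<in> J\<^sub>0. y $ 1 = x $ 1} = J\<^sub>0 \<inter> {y. y $ 1 = x $ 1}" by auto
      then show "measure \<nu> {y \<in> J\<^sub>0. y $ 1 = x $ 1} = 0"
        unfolding vertical_line by (simp only: J0(4)[OF vector_1_neq_0(1)])
    qed
    interpret separated_frostman \<mu> \<nu> I J s cF R by (rule IJ(1))
    have null: "line_measure 0 x y = 0" for x y
    proof -
      have "line_measure 0 x y \<le> measure \<nu> (J\<^sub>0 \<inter> line_through (vector [0, intercept x y]) (vector [1, slope x y]))"
        unfolding line_measure_def strip_0_eq_line
        using IJ(3) J0(1) line_through_borel \<nu>(2) by (intro \<nu>.finite_measure_mono) auto
      also have "\<dots> = 0" by (rule J0(4)[OF vector_1_neq_0(2)])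
      finally show ?thesis by (simp add: line_measure_def measure_le_0_iff)
    qed
    obtain G \<eta> where G: "G \<in> sets (\<mu> \<Otimes>\<^sub>M \<nu>)" "G \<subseteq> I \<times> J" "0 < P.prob G" "0 < \<eta>"
      "\<And>x y. (x, y) \<in> G \<Longrightarrow> \<exists>c. \<forall>\<delta>. 0 < \<delta> \<longrightarrow> \<delta> \<le> 1 \<longrightarrow> line_measure \<delta> x y \<le> c * \<delta> powr \<eta>"
      by (rule thin_strips[OF IJ(4) null]) (use that in blast)
    show thesis
      by (rule that[OF IJ(1,2) order.trans[OF IJ(3) J0(2)] G(1-4)]) (rule G(5))
  qed
qed

theorem theorem4p3:
  fixes X Y :: "(real ^ 2) set"
    and \<sigma>\<^sub>X \<sigma>\<^sub>Y :: real
    and \<mu> \<nu> :: "(real ^ 2) measure"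
    and A :: "nat set"
  assumes "compact X" and "compact Y"
    and "hausdorff_dim X > 0" and "hausdorff_dim Y > 0"
    and "\<sigma>\<^sub>X < hausdorff_dim X" and "\<sigma>\<^sub>Y < hausdorff_dim Y"
    and "borel_prob_measure \<mu>" and "borel_prob_measure \<nu>"
    and "measure_support \<mu> = X" and "measure_support \<nu> = Y"
    and "frostman (hausdorff_dim X) \<mu>" and "frostman (hausdorff_dim Y) \<nu>"
    and "effectively_compact A X" and "effectively_compact A Y"
    and "computable_measure A \<mu>" and "computable_measure A \<nu>"
    and "\<And>l. is_line l \<Longrightarrow> measure \<mu> l * measure \<nu> l < 1"
  shows "\<exists>x\<in>X. \<exists>y\<in>Y. x \<noteq> y \<and>
    (let l = dual_point (affine hull {x, y}) in
       eff_dim A x > ereal \<sigma>\<^sub>X \<and> eff_dim A y > ereal \<sigma>\<^sub>Y \<and> eff_dim (with_point A x) l > 0 \<and>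
       (\<exists>(C\<^sub>1::real) (C\<^sub>2::real) (C\<^sub>3::real) N. \<forall>n\<ge>N.
          (\<forall>m\<le>n. real (K A m l) \<le> real (Kcond A m l x) + real (Kcond2 A m n l y)
                     + C\<^sub>1 * log 2 (real m) + C\<^sub>2 * log 2 (real n)) \<and>
          real (K A n l) \<le> real (Kcond A n l y) + real (K (with_point A x) n l)
                     + C\<^sub>3 * log 2 (real n)))"
proof -
  have \<mu>: "prob_space \<mu>" "sets \<mu> = sets borel" and \<nu>: "prob_space \<nu>" "sets \<nu> = sets borel"
    using assms(7,8) by (auto simp: borel_prob_measure_def)
  have borel: "X \<in> sets \<mu>" "Y \<in> sets \<nu>"
    unfolding \<mu>(2) \<nu>(2) using assms(1,2) by (auto intro: borel_closed compact_imp_closed)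
  have "AE x in \<mu>. x \<in> X" "AE y in \<nu>. y \<in> Y"
    using AE_measure_support[OF \<mu>(2)] AE_measure_support[OF \<nu>(2)] assms(9,10) by simp_all
  then have full: "measure \<mu> X = 1" "measure \<nu> Y = 1"
    using prob_space.prob_eq_1[OF \<mu>(1) borel(1)] prob_space.prob_eq_1[OF \<nu>(1) borel(2)] by simp_all
  \<comment> \<open>The geometric part works with a common exponent; the original exponents are
    still used in \<open>dims\<close>, which has to reach up to the Hausdorff dimensions.\<close>
  define s where "s = min (hausdorff_dim X) (hausdorff_dim Y)"
  have s: "0 < s" "s \<le> hausdorff_dim X" "s \<le> hausdorff_dim Y" using assms(3,4) by (auto simp: s_def)
  obtain c\<^sub>1 where c1: "0 < c\<^sub>1" "\<And>x r. 0 < r \<Longrightarrow> measure \<mu> (ball x r) \<le> c\<^sub>1 * r powr s"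
    by (rule frostman_weaken[OF \<mu>(1) assms(11) s(1,2)]) (use that in blast)
  obtain c\<^sub>2 where c2: "0 < c\<^sub>2" "\<And>x r. 0 < r \<Longrightarrow> measure \<nu> (ball x r) \<le> c\<^sub>2 * r powr s"
    by (rule frostman_weaken[OF \<nu>(1) assms(12) s(1,3)]) (use that in blast)
  have frost: "measure \<mu> (ball x r) \<le> (c\<^sub>1 + c\<^sub>2) * r powr s" "measure \<nu> (ball x r) \<le> (c\<^sub>1 + c\<^sub>2) * r powr s"
    if "0 < r" for x r
  proof -
    have "0 \<le> c\<^sub>1 * r powr s" "0 \<le> c\<^sub>2 * r powr s" using c1(1) c2(1) by simp_all
    then show "measure \<mu> (ball x r) \<le> (c\<^sub>1 + c\<^sub>2) * r powr s" "measure \<nu> (ball x r) \<le> (c\<^sub>1 + c\<^sub>2) * r powr s"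
      using c1(2)[OF that, of x] c2(2)[OF that, of x] unfolding distrib_right by linarith+
  qed
  have c12: "0 < c\<^sub>1 + c\<^sub>2" using c1(1) c2(1) by simp
  have less: "ereal \<sigma>\<^sub>X < ereal (hausdorff_dim X)" "ereal \<sigma>\<^sub>Y < ereal (hausdorff_dim Y)" using assms(5,6) by simp_all
  have dims: "AE x in \<mu>. ereal \<sigma>\<^sub>X < eff_dim A x" "AE y in \<nu>. ereal \<sigma>\<^sub>Y < eff_dim A y"
    by (rule AE_mp[OF AE_eff_dim_ge[OF \<mu> assms(11)]], rule AE_I2, use less(1) less_le_trans in blast)
      (rule AE_mp[OF AE_eff_dim_ge[OF \<nu> assms(12)]], rule AE_I2, use less(2) less_le_trans in blast)
  show ?thesis
  proof (rule exists_thin_strips[OF \<mu> \<nu> s(1) c12 frost assms(1) full(1) assms(2) full(2) assms(17)])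
    fix I J R G \<eta>
    assume IJ: "separated_frostman \<mu> \<nu> I J s (c\<^sub>1 + c\<^sub>2) R" "I \<subseteq> X" "J \<subseteq> Y"
      and G: "G \<in> sets (\<mu> \<Otimes>\<^sub>M \<nu>)" "G \<subseteq> I \<times> J" "0 < measure (\<mu> \<Otimes>\<^sub>M \<nu>) G" "0 < \<eta>"
      "\<And>x y. (x, y) \<in> G \<Longrightarrow> \<exists>c. \<forall>\<delta>. 0 < \<delta> \<longrightarrow> \<delta> \<le> 1 \<longrightarrow>
         separated_frostman.line_measure \<nu> J \<delta> x y \<le> c * \<delta> powr \<eta>"
    interpret separated_frostman \<mu> \<nu> I J s "c\<^sub>1 + c\<^sub>2" R by (rule IJ(1))
    have thin: "\<forall>x y. (x, y) \<in> G \<longrightarrow> (\<exists>c. \<forall>\<delta>. 0 < \<delta> \<longrightarrow> \<delta> \<le> 1 \<longrightarrow> line_measure \<delta> x y \<le> c * \<delta> powr \<eta>)"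
      using G(5) by (intro allI impI)
    obtain x y where xy: "x \<in> I" "y \<in> J"
      and concl: "ereal \<sigma>\<^sub>X < eff_dim A x \<and> ereal \<sigma>\<^sub>Y < eff_dim A y \<and>
        0 < eff_dim (with_point A x) (line_point x y) \<and> complexity_bounds A x y (line_point x y)"
      using exists_pair[OF assms(15,16) G(1-4) thin dims] by (elim bexE)
    have "x \<noteq> y" using coord_neq[OF xy] by auto
    then show ?thesis
      using xy IJ(2,3) concl unfolding Let_def complexity_bounds_def
      by (intro bexI[of _ x] bexI[of _ y]) (auto simp only: dual_point_affine_hull[OF coord_neq[OF xy]])
  qed
qed

end
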